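(* Let $L$ be a finite torsion-free Lie conformal algebra over a field $\Bbbk$ of characteristic zero with a basis $B$ over $H=\Bbbk[D]$. Assume that $L$ has the PBW property with respect to $B$. Then $L$ has a finite faithful representation on a free $H$-module.
   Context: $\Bbbk$ is a field of characteristic $0$ and $H=\Bbbk[D]$. A conformal algebra is a left unital $H$-module $C$ with $\Bbbk$-bilinear products $a_{(n)}b$, $n\in\mathbb Z_{\ge 0}$, such that for all $a,b\in C$: $a_{(n)}b=0$ for almost all $n$; $(Da)_{(n)}b=-n\,a_{(n-1)}b$; $a_{(n)}(Db)=D(a_{(n)}b)+n\,a_{(n-1)}b$ (products with negative index are zero). Put $\{a_{(n)}b\}=\sum_{s\ge0}\frac{(-1)^{n+s}}{s!}D^s(a_{(n+s)}b)$, and let $N_C(a,b)$ be the minimal non-negative integer such that $a_{(n)}b=0$ for all $n\ge N_C(a,b)$. $C$ is associative if $a_{(n)}(b_{(m)}c)=\sum_{s\ge0}\binom ns (a_{(n-s)}b)_{(m+s)}c$; it is (associative and) commutative if moreover $a_{(n)}b=\{b_{(n)}a\}$. A Lie conformal algebra is a conformal algebra whose products satisfy $a_{(n)}b=-\{b_{(n)}a\}$ and $a_{(n)}(b_{(m)}c)-b_{(m)}(a_{(n)}c)=\sum_{s\ge0}\binom ns(a_{(n-s)}b)_{(m+s)}c$. "Finite" means finitely generated as an $H$-module; "torsion-free" means without $H$-torsion. For an associative conformal algebra $C$, $C^{(-)}$ is the Lie conformal algebra on the same $H$-module with products $[a_{(n)}b]=a_{(n)}b-\{b_{(n)}a\}$.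 An associative envelope of a Lie conformal algebra $L$ is a pair $(U,\iota)$, where $U$ is an associative conformal algebra, $\iota:L\to U^{(-)}$ is a homomorphism of conformal algebras, and $U$ is generated as an associative conformal algebra by $\iota(L)$. A morphism of envelopes $(U_1,\iota_1)\to(U_2,\iota_2)$ is a homomorphism $\varphi:U_1\to U_2$ with $\varphi\iota_1=\iota_2$. For $L$ generated by $B$ and a function $N:B\times B\to\mathbb Z_{\ge0}$, $(U_N(L),\iota_N)$ is the universal associative envelope with respect to $N$: $N_{U_N(L)}(\iota_N(a),\iota_N(b))\le N(a,b)$ for $a,b\in B$, and for every associative envelope $(U,\iota)$ of $L$ such that $N_U(\iota(a),\iota(b))\le N(a,b)$ for all $a,b\in B$ there is a morphism of envelopes $U_N(L)\to U$. Any associative envelope $(U,\iota)$ has a filtration $U_1\subseteq U_2\subseteq\cdots$, where $U_n$ is the $H$-span of all products $\iota(a_1)_{(n_1)}\cdots{}_{(n_{k-1})}\iota(a_k)$ with any bracketing, $a_i\in B$, $1\le k\le n$, $n_i\ge0$. Since $x_{(j)}y\in U_{n+m}$ for $x\in U_n$, $y\in U_m$, $j\ge 0$, the associated graded associative conformal algebra $\mathrm{gr}\,U=\bigoplus_{n\ge1}U_n/U_{n-1}$ ($U_0=0$) is defined. The free commutative conformal algebra generated by $B$ with respect to the locality function $N$ is the (associative) commutative conformal algebra generated by $B$ with locality on $B$ bounded by $N$ that is universal: every map $\alpha$ from $B$ to a commutative conformal algebra $C$ with $N_C(\alpha(a),\alpha(b))\le N(a,b)$ for $a,b\in B$ extends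 uniquely to a homomorphism. $L$ has the PBW property with respect to a basis $B$ over $H$ if for every sufficiently large constant function $N$ on $B\times B$ the conformal algebra $\mathrm{gr}\,U_N(L)$ is isomorphic to the free commutative conformal algebra generated by $B$ with respect to the locality function $N$. A representation of a Lie conformal algebra $L$ (with products written $[a_{(n)}b]$) on an $H$-module $M$ is given by $\Bbbk$-bilinear maps $L\times M\to M$, $(a,v)\mapsto a_{(n)}v$, $n\ge0$, such that: $a_{(n)}v=0$ for almost all $n$; $(Da)_{(n)}v=-n\,a_{(n-1)}v$; $a_{(n)}(Dv)=D(a_{(n)}v)+n\,a_{(n-1)}v$; $a_{(n)}(b_{(m)}v)-b_{(m)}(a_{(n)}v)=\sum_{s\ge0}\binom ns [a_{(n-s)}b]_{(m+s)}v$. It is finite if $M$ is finitely generated over $H$, and faithful if $a_{(n)}v=0$ for all $n\ge0$, $v\in M$ implies $a=0$. *)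

theory Defs
  imports "Jordan_Normal_Form.VS_Connect" "HOL-Algebra.AbelCoset"
begin

section \<open>Modules over \<open>H = k[D]\<close>\<close>

abbreviation H :: "'k::field_char_0 poly ring" where
  "H \<equiv> class_ring"

definition finitely_generated :: "('k::field_char_0 poly, 'a, 'x) module_scheme \<Rightarrow> bool" where
  "finitely_generated M \<longleftrightarrow> (\<exists>S. finite S \<and> S \<subseteq> carrier M \<and> LinearCombinations.module.span H M S = carrier M)"

definition torsion_free :: "('k::field_char_0 poly, 'a, 'x) module_scheme \<Rightarrow> bool" where
  "torsion_free M \<longleftrightarrow> (\<forall>h. \<forall>x\<in>carrier M. h \<odot>\<^bsub>M\<^esub> x = \<zero>\<^bsub>M\<^esub> \<longrightarrow> h = 0 \<or> x = \<zero>\<^bsub>M\<^esub>)"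

definition H_basis :: "('k::field_char_0 poly, 'a, 'x) module_scheme \<Rightarrow> 'a set \<Rightarrow> bool" where
  "H_basis M S \<longleftrightarrow> S \<subseteq> carrier M \<and> \<not> module.lin_dep H M S \<and> LinearCombinations.module.span H M S = carrier M"

definition free_module :: "('k::field_char_0 poly, 'a, 'x) module_scheme \<Rightarrow> bool" where
  "free_module M \<longleftrightarrow> (\<exists>S. H_basis M S)"

section \<open>Conformal algebras\<close>

text \<open>The ring fields \<open>mult\<close> and \<open>one\<close> that \<open>module\<close> inherits play no role here;
  \<open>nprod C n a b\<close> is the product of \<open>a\<close> and \<open>b\<close> with index \<open>n\<close>.\<close>

record ('h, 'a) conf_alg = "('h, 'a) module" +
  nprod :: "nat \<Rightarrow> 'a \<Rightarrow> 'a \<Rightarrow> 'a"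

text \<open>For \<open>n = 0\<close> the terms with the truncated index \<open>n - 1\<close> have coefficient \<open>0\<close>.
  The polynomial \<open>[:0, 1:]\<close> is \<open>D\<close>, and \<open>[:c:]\<close> is the scalar \<open>c\<close>.\<close>

locale conformal_algebra = Module.module "H :: 'k::field_char_0 poly ring" C
  for C :: "('k::field_char_0 poly, 'a) conf_alg" (structure) +
  assumes nprod_closed [simp, intro]:
      "a \<in> carrier C \<Longrightarrow> b \<in> carrier C \<Longrightarrow> nprod C n a b \<in> carrier C"
    and nprod_add_left:
      "a \<in> carrier C \<Longrightarrow> a' \<in> carrier C \<Longrightarrow> b \<in> carrier C \<Longrightarrow>
        nprod C n (a \<oplus> a') b = nprod C n a b \<oplus> nprod C n a' b"
    and nprod_add_right:
      "a \<in> carrier C \<Longrightarrow> b \<in> carrier C \<Longrightarrow> b' \<in> carrier C \<Longrightarrow>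
        nprod C n a (b \<oplus> b') = nprod C n a b \<oplus> nprod C n a b'"
    and nprod_scalar_left:
      "a \<in> carrier C \<Longrightarrow> b \<in> carrier C \<Longrightarrow>
        nprod C n ([:c:] \<odot>\<^bsub>C\<^esub> a) b = [:c:] \<odot>\<^bsub>C\<^esub> nprod C n a b"
    and nprod_scalar_right:
      "a \<in> carrier C \<Longrightarrow> b \<in> carrier C \<Longrightarrow>
        nprod C n a ([:c:] \<odot>\<^bsub>C\<^esub> b) = [:c:] \<odot>\<^bsub>C\<^esub> nprod C n a b"
    and nprod_local:
      "a \<in> carrier C \<Longrightarrow> b \<in> carrier C \<Longrightarrow> finite {n. nprod C n a b \<noteq> \<zero>}"
    and nprod_D_left:
      "a \<in> carrier C \<Longrightarrow> b \<in> carrier C \<Longrightarrow>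
        nprod C n ([:0, 1:] \<odot>\<^bsub>C\<^esub> a) b = (- of_nat n) \<odot>\<^bsub>C\<^esub> nprod C (n - 1) a b"
    and nprod_D_right:
      "a \<in> carrier C \<Longrightarrow> b \<in> carrier C \<Longrightarrow>
        nprod C n a ([:0, 1:] \<odot>\<^bsub>C\<^esub> b) =
          [:0, 1:] \<odot>\<^bsub>C\<^esub> nprod C n a b \<oplus> of_nat n \<odot>\<^bsub>C\<^esub> nprod C (n - 1) a b"

text \<open>The element \<open>{a\<^sub>(\<^sub>n\<^sub>)b}\<close>, where \<open>monom c s = c D\<^sup>s\<close>; the sum runs over its nonzero terms,
  which are finitely many.\<close>

definition nprod_brace :: "('k::field_char_0 poly, 'a) conf_alg \<Rightarrow> nat \<Rightarrow> 'a \<Rightarrow> 'a \<Rightarrow> 'a" where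
  "nprod_brace C n a b =
    (\<Oplus>\<^bsub>C\<^esub> s\<in>{s. nprod C (n + s) a b \<noteq> \<zero>\<^bsub>C\<^esub>}.
      monom ((-1) ^ (n + s) / fact s) s \<odot>\<^bsub>C\<^esub> nprod C (n + s) a b)"

definition locality_deg :: "('k::field_char_0 poly, 'a) conf_alg \<Rightarrow> 'a \<Rightarrow> 'a \<Rightarrow> nat" where
  "locality_deg C a b = (LEAST N. \<forall>n\<ge>N. nprod C n a b = \<zero>\<^bsub>C\<^esub>)"

text \<open>In the identities below, \<open>n choose s = 0\<close> for \<open>s > n\<close>, so the sums stop at \<open>s = n\<close>.\<close>

locale assoc_conformal_algebra = conformal_algebra C
  for C :: "('k::field_char_0 poly, 'a) conf_alg" (structure) +
  assumes nprod_assoc: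
      "a \<in> carrier C \<Longrightarrow> b \<in> carrier C \<Longrightarrow> c \<in> carrier C \<Longrightarrow>
        nprod C n a (nprod C m b c) =
          (\<Oplus> s\<in>{..n}. of_nat (n choose s) \<odot>\<^bsub>C\<^esub> nprod C (m + s) (nprod C (n - s) a b) c)"

locale comm_conformal_algebra = assoc_conformal_algebra C
  for C :: "('k::field_char_0 poly, 'a) conf_alg" (structure) +
  assumes nprod_comm:
      "a \<in> carrier C \<Longrightarrow> b \<in> carrier C \<Longrightarrow> nprod C n a b = nprod_brace C n b a"

locale lie_conformal_algebra = conformal_algebra C
  for C :: "('k::field_char_0 poly, 'a) conf_alg" (structure) +
  assumes nprod_anticomm:
      "a \<in> carrier C \<Longrightarrow> b \<in> carrier C \<Longrightarrow> nprod C n a b = \<ominus> nprod_brace C n b a"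
    and nprod_jacobi:
      "a \<in> carrier C \<Longrightarrow> b \<in> carrier C \<Longrightarrow> c \<in> carrier C \<Longrightarrow>
        nprod C n a (nprod C m b c) \<ominus> nprod C m b (nprod C n a c) =
          (\<Oplus> s\<in>{..n}. of_nat (n choose s) \<odot>\<^bsub>C\<^esub> nprod C (m + s) (nprod C (n - s) a b) c)"

definition commutator_alg ::
    "('k::field_char_0 poly, 'a) conf_alg \<Rightarrow> ('k poly, 'a) conf_alg" where
  "commutator_alg C = C\<lparr>nprod := \<lambda>n a b. nprod C n a b \<ominus>\<^bsub>C\<^esub> nprod_brace C n b a\<rparr>"

definition conf_hom ::
    "('k::field_char_0 poly, 'a) conf_alg \<Rightarrow> ('k poly, 'b) conf_alg \<Rightarrow> ('a \<Rightarrow> 'b) set" where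
  "conf_hom C C' = {f \<in> LinearCombinations.module_hom H C C'.
    \<forall>n. \<forall>a\<in>carrier C. \<forall>b\<in>carrier C. f (nprod C n a b) = nprod C' n (f a) (f b)}"

definition conf_isomorphic ::
    "('k::field_char_0 poly, 'a) conf_alg \<Rightarrow> ('k poly, 'b) conf_alg \<Rightarrow> bool" where
  "conf_isomorphic C C' \<longleftrightarrow> (\<exists>f\<in>conf_hom C C'. bij_betw f (carrier C) (carrier C'))"

definition conf_subalgebra :: "('k::field_char_0 poly, 'a) conf_alg \<Rightarrow> 'a set \<Rightarrow> bool" where
  "conf_subalgebra C S \<longleftrightarrow> submodule H S C \<and> (\<forall>n. \<forall>a\<in>S. \<forall>b\<in>S. nprod C n a b \<in> S)"

definition conf_generated :: "('k::field_char_0 poly, 'a) conf_alg \<Rightarrow> 'a set \<Rightarrow> 'a set" where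
  "conf_generated C X = \<Inter>{S. conf_subalgebra C S \<and> X \<subseteq> S}"

definition locality_bounded ::
    "('k::field_char_0 poly, 'a) conf_alg \<Rightarrow> 'g set \<Rightarrow> ('g \<Rightarrow> 'g \<Rightarrow> nat) \<Rightarrow> ('g \<Rightarrow> 'a) \<Rightarrow> bool" where
  "locality_bounded C B N i \<longleftrightarrow> (\<forall>a\<in>B. \<forall>b\<in>B. locality_deg C (i a) (i b) \<le> N a b)"

section \<open>Associative envelopes\<close>

definition assoc_envelope ::
    "('k::field_char_0 poly, 'l) conf_alg \<Rightarrow> ('k poly, 'u) conf_alg \<Rightarrow> ('l \<Rightarrow> 'u) \<Rightarrow> bool" where
  "assoc_envelope L U \<iota> \<longleftrightarrow> assoc_conformal_algebra U \<and> \<iota> \<in> conf_hom L (commutator_alg U) \<and>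
    conf_generated U (\<iota> ` carrier L) = carrier U"

definition envelope_morphisms ::
    "('k::field_char_0 poly, 'l) conf_alg \<Rightarrow> ('k poly, 'u) conf_alg \<Rightarrow> ('l \<Rightarrow> 'u) \<Rightarrow>
      ('k poly, 'v) conf_alg \<Rightarrow> ('l \<Rightarrow> 'v) \<Rightarrow> ('u \<Rightarrow> 'v) set" where
  "envelope_morphisms L U \<iota> V \<kappa> = {\<phi> \<in> conf_hom U V. \<forall>x\<in>carrier L. \<phi> (\<iota> x) = \<kappa> x}"

text \<open>\<open>(U, \<iota>)\<close> is the universal envelope with respect to \<open>N\<close>, the universal property being tested
  on the envelopes with carrier in the type \<open>'v\<close>.\<close>

definition universal_envelope ::
    "'v itself \<Rightarrow> ('k::field_char_0 poly, 'l) conf_alg \<Rightarrow> 'l set \<Rightarrow> ('l \<Rightarrow> 'l \<Rightarrow> nat) \<Rightarrow>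
      ('k poly, 'u) conf_alg \<Rightarrow> ('l \<Rightarrow> 'u) \<Rightarrow> bool" where
  "universal_envelope T L B N U \<iota> \<longleftrightarrow>
    assoc_envelope L U \<iota> \<and> locality_bounded U B N \<iota> \<and>
    (\<forall>(V :: ('k poly, 'v) conf_alg) \<kappa>. assoc_envelope L V \<kappa> \<and> locality_bounded V B N \<kappa> \<longrightarrow>
      envelope_morphisms L U \<iota> V \<kappa> \<noteq> {})"

section \<open>The free commutative conformal algebra\<close>

definition free_comm_conformal ::
    "'v itself \<Rightarrow> 'g set \<Rightarrow> ('g \<Rightarrow> 'g \<Rightarrow> nat) \<Rightarrow>
      ('k::field_char_0 poly, 'f) conf_alg \<Rightarrow> ('g \<Rightarrow> 'f) \<Rightarrow> bool" where
  "free_comm_conformal T B N F i \<longleftrightarrow>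
    comm_conformal_algebra F \<and> i ` B \<subseteq> carrier F \<and> locality_bounded F B N i \<and>
    conf_generated F (i ` B) = carrier F \<and>
    (\<forall>(C :: ('k poly, 'v) conf_alg) \<alpha>.
      comm_conformal_algebra C \<and> \<alpha> ` B \<subseteq> carrier C \<and> locality_bounded C B N \<alpha> \<longrightarrow>
      (\<exists>\<phi>\<in>conf_hom F C. (\<forall>b\<in>B. \<phi> (i b) = \<alpha> b) \<and>
        (\<forall>\<psi>\<in>conf_hom F C. (\<forall>b\<in>B. \<psi> (i b) = \<alpha> b) \<longrightarrow> (\<forall>x\<in>carrier F. \<psi> x = \<phi> x))))"

section \<open>The associated graded algebra of an envelope\<close>

text \<open>\<open>conf_monomial C X k x\<close>: \<open>x\<close> is a product of \<open>k\<close> elements of \<open>X\<close> with some bracketing.\<close>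

inductive conf_monomial :: "('h, 'a) conf_alg \<Rightarrow> 'a set \<Rightarrow> nat \<Rightarrow> 'a \<Rightarrow> bool"
  for C :: "('h, 'a) conf_alg" and X :: "'a set" where
  "x \<in> X \<Longrightarrow> conf_monomial C X 1 x"
| "conf_monomial C X k x \<Longrightarrow> conf_monomial C X l y \<Longrightarrow> conf_monomial C X (k + l) (nprod C n x y)"

definition env_filtration ::
    "('k::field_char_0 poly, 'u) conf_alg \<Rightarrow> 'u set \<Rightarrow> nat \<Rightarrow> 'u set" where
  "env_filtration U X n = LinearCombinations.module.span H U {x. \<exists>k\<in>{1..n}. conf_monomial U X k x}"

text \<open>An element of the graded algebra is a finitely supported family of cosets
  \<open>f n \<in> U\<^sub>n / U\<^sub>n\<^sub>-\<^sub>1\<close>. The family has a component \<open>f 0\<close> as well, but \<open>U\<^sub>0 = {0}\<close> and, by truncated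
  subtraction, \<open>f 0\<close> lies in the trivial module \<open>U\<^sub>0 / U\<^sub>0\<close>. Operations on cosets are those on all
  representatives, with \<open>U\<^sub>n\<^sub>-\<^sub>1\<close> added to complete the resulting set to a coset.\<close>

definition gr_alg ::
    "('k::field_char_0 poly, 'u) conf_alg \<Rightarrow> 'u set \<Rightarrow> ('k poly, nat \<Rightarrow> 'u set) conf_alg" where
  "gr_alg U X = (let F = env_filtration U X in
    \<lparr>carrier = {f. (\<forall>n. \<exists>x\<in>F n. f n = F (n - 1) +>\<^bsub>U\<^esub> x) \<and> finite {n. f n \<noteq> F (n - 1)}},
     mult = undefined, one = undefined,
     zero = (\<lambda>n. F (n - 1)),
     add = (\<lambda>f g n. f n <+>\<^bsub>U\<^esub> g n),
     smult = (\<lambda>h f n. F (n - 1) <+>\<^bsub>U\<^esub> (\<lambda>x. h \<odot>\<^bsub>U\<^esub> x) ` f n),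
     nprod = (\<lambda>j f g n. F (n - 1) <+>\<^bsub>U\<^esub>
       {\<Oplus>\<^bsub>U\<^esub> k\<in>{..n}. nprod U j (x k) (y (n - k)) | x y. \<forall>k. x k \<in> f k \<and> y k \<in> g k})\<rparr>)"

section \<open>The PBW property\<close>

text \<open>Every conformal algebra generated by the images of elements of \<open>'g\<close> has the values of these
  terms as its elements, hence is isomorphic to one whose carrier is a set of terms. So it suffices
  to test the two universal properties on carriers in this type; see \<open>universal_envelope_any\<close> and
  \<open>free_comm_conformal_any\<close> below. Both objects are unique up to isomorphism, so that the
  existential quantifier in \<open>PBW_property\<close> merely names them.\<close>

datatype ('h, 'g) conf_term =
    Gen 'g
  | Zero
  | Add "('h, 'g) conf_term" "('h, 'g) conf_term"
  | Scale 'h "('h, 'g) conf_term"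
  | NProd nat "('h, 'g) conf_term" "('h, 'g) conf_term"

definition PBW_property :: "('k::field_char_0 poly, 'l) conf_alg \<Rightarrow> 'l set \<Rightarrow> bool" where
  "PBW_property L B \<longleftrightarrow> (\<exists>N\<^sub>0. \<forall>N\<ge>N\<^sub>0.
    \<exists>(U :: ('k poly, ('k poly, 'l) conf_term) conf_alg) \<iota>
     (F :: ('k poly, ('k poly, 'l) conf_term) conf_alg) i.
      universal_envelope TYPE(('k poly, 'l) conf_term) L B (\<lambda>_ _. N) U \<iota> \<and>
      free_comm_conformal TYPE(('k poly, 'l) conf_term) B (\<lambda>_ _. N) F i \<and>
      conf_isomorphic (gr_alg U (\<iota> ` B)) F)"

section \<open>Representations\<close>

text \<open>A free \<open>H\<close>-module of finite rank \<open>r\<close> is isomorphic to \<open>H\<^sup>r\<close>, hence to a module whose carrier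
  lies in the type \<open>nat \<Rightarrow> 'k poly\<close>.\<close>

locale conformal_representation =
    L: lie_conformal_algebra L + M: Module.module "H :: 'k poly ring" M
  for L :: "('k::field_char_0 poly, 'l) conf_alg"
    and M :: "('k poly, 'm) module"
    and act :: "nat \<Rightarrow> 'l \<Rightarrow> 'm \<Rightarrow> 'm" +
  assumes act_closed: "a \<in> carrier L \<Longrightarrow> v \<in> carrier M \<Longrightarrow> act n a v \<in> carrier M"
    and act_add_left: "a \<in> carrier L \<Longrightarrow> a' \<in> carrier L \<Longrightarrow> v \<in> carrier M \<Longrightarrow>
        act n (a \<oplus>\<^bsub>L\<^esub> a') v = act n a v \<oplus>\<^bsub>M\<^esub> act n a' v"
    and act_add_right: "a \<in> carrier L \<Longrightarrow> v \<in> carrier M \<Longrightarrow> v' \<in> carrier M \<Longrightarrow>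
        act n a (v \<oplus>\<^bsub>M\<^esub> v') = act n a v \<oplus>\<^bsub>M\<^esub> act n a v'"
    and act_scalar_left: "a \<in> carrier L \<Longrightarrow> v \<in> carrier M \<Longrightarrow>
        act n ([:c:] \<odot>\<^bsub>L\<^esub> a) v = [:c:] \<odot>\<^bsub>M\<^esub> act n a v"
    and act_scalar_right: "a \<in> carrier L \<Longrightarrow> v \<in> carrier M \<Longrightarrow>
        act n a ([:c:] \<odot>\<^bsub>M\<^esub> v) = [:c:] \<odot>\<^bsub>M\<^esub> act n a v"
    and act_local: "a \<in> carrier L \<Longrightarrow> v \<in> carrier M \<Longrightarrow> finite {n. act n a v \<noteq> \<zero>\<^bsub>M\<^esub>}"
    and act_D_left: "a \<in> carrier L \<Longrightarrow> v \<in> carrier M \<Longrightarrow>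
        act n ([:0, 1:] \<odot>\<^bsub>L\<^esub> a) v = (- of_nat n) \<odot>\<^bsub>M\<^esub> act (n - 1) a v"
    and act_D_right: "a \<in> carrier L \<Longrightarrow> v \<in> carrier M \<Longrightarrow>
        act n a ([:0, 1:] \<odot>\<^bsub>M\<^esub> v) =
          [:0, 1:] \<odot>\<^bsub>M\<^esub> act n a v \<oplus>\<^bsub>M\<^esub> of_nat n \<odot>\<^bsub>M\<^esub> act (n - 1) a v"
    and act_commutator: "a \<in> carrier L \<Longrightarrow> b \<in> carrier L \<Longrightarrow> v \<in> carrier M \<Longrightarrow>
        act n a (act m b v) \<ominus>\<^bsub>M\<^esub> act m b (act n a v) =
          (\<Oplus>\<^bsub>M\<^esub> s\<in>{..n}. of_nat (n choose s) \<odot>\<^bsub>M\<^esub> act (m + s) (nprod L (n - s) a b) v)"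

definition faithful_action ::
    "('k::field_char_0 poly, 'l) conf_alg \<Rightarrow> ('k poly, 'm) module \<Rightarrow> (nat \<Rightarrow> 'l \<Rightarrow> 'm \<Rightarrow> 'm) \<Rightarrow> bool"
  where
  "faithful_action L M act \<longleftrightarrow>
    (\<forall>a\<in>carrier L. (\<forall>n. \<forall>v\<in>carrier M. act n a v = \<zero>\<^bsub>M\<^esub>) \<longrightarrow> a = \<zero>\<^bsub>L\<^esub>)"

section \<open>The type of terms suffices for the universal properties\<close>

locale conf_embedding =
    C: conformal_algebra C + C': Module.module "H :: 'k poly ring" C'
  for C :: "('k::field_char_0 poly, 'a) conf_alg" and C' :: "('k poly, 'b) conf_alg" and g +
  assumes nprod'_closed: "a \<in> carrier C' \<Longrightarrow> b \<in> carrier C' \<Longrightarrow> nprod C' n a b \<in> carrier C'"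
    and g_hom: "g \<in> conf_hom C' C"
    and g_inj: "inj_on g (carrier C')"
begin

lemma g_closed: "x \<in> carrier C' \<Longrightarrow> g x \<in> carrier C"
  using g_hom by (auto simp: conf_hom_def LinearCombinations.module_hom_def)

lemma g_add: "x \<in> carrier C' \<Longrightarrow> y \<in> carrier C' \<Longrightarrow> g (x \<oplus>\<^bsub>C'\<^esub> y) = g x \<oplus>\<^bsub>C\<^esub> g y"
  using g_hom by (auto simp: conf_hom_def LinearCombinations.module_hom_def)

lemma g_smult: "x \<in> carrier C' \<Longrightarrow> g (h \<odot>\<^bsub>C'\<^esub> x) = h \<odot>\<^bsub>C\<^esub> g x"
  using g_hom by (auto simp: conf_hom_def LinearCombinations.module_hom_def)

lemma g_nprod: "x \<in> carrier C' \<Longrightarrow> y \<in> carrier C' \<Longrightarrow> g (nprod C' n x y) = nprod C n (g x) (g y)"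
  using g_hom by (auto simp: conf_hom_def)

lemma g_eq: "x \<in> carrier C' \<Longrightarrow> y \<in> carrier C' \<Longrightarrow> g x = g y \<longleftrightarrow> x = y"
  using g_inj by (auto dest: inj_onD)

lemma g_eqI: "g x = g y \<Longrightarrow> x \<in> carrier C' \<Longrightarrow> y \<in> carrier C' \<Longrightarrow> x = y"
  using g_eq by blast

lemma smult'_closed: "x \<in> carrier C' \<Longrightarrow> h \<odot>\<^bsub>C'\<^esub> x \<in> carrier C'"
  by (rule C'.smult_closed) auto

lemma smult_closed: "x \<in> carrier C \<Longrightarrow> h \<odot>\<^bsub>C\<^esub> x \<in> carrier C"
  by (rule C.smult_closed) auto

lemma g_zero: "g \<zero>\<^bsub>C'\<^esub> = \<zero>\<^bsub>C\<^esub>"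
proof -
  have "0 \<odot>\<^bsub>C'\<^esub> \<zero>\<^bsub>C'\<^esub> = \<zero>\<^bsub>C'\<^esub>"
    using C'.smult_l_null[of "\<zero>\<^bsub>C'\<^esub>"] by simp
  moreover have "0 \<odot>\<^bsub>C\<^esub> g \<zero>\<^bsub>C'\<^esub> = \<zero>\<^bsub>C\<^esub>"
    using C.smult_l_null[of "g \<zero>\<^bsub>C'\<^esub>"] g_closed by simp
  ultimately show ?thesis
    using g_smult[of "\<zero>\<^bsub>C'\<^esub>" 0] by simp
qed

lemma g_eq_zero: "x \<in> carrier C' \<Longrightarrow> g x = \<zero>\<^bsub>C\<^esub> \<longleftrightarrow> x = \<zero>\<^bsub>C'\<^esub>"
  using g_eq[of x "\<zero>\<^bsub>C'\<^esub>"] g_zero by simp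

lemma g_minus: "x \<in> carrier C' \<Longrightarrow> g (\<ominus>\<^bsub>C'\<^esub> x) = \<ominus>\<^bsub>C\<^esub> g x"
  by (metis C'.M.a_inv_closed C'.M.l_neg C.M.minus_equality g_add g_closed g_zero)

lemma g_diff: "x \<in> carrier C' \<Longrightarrow> y \<in> carrier C' \<Longrightarrow> g (x \<ominus>\<^bsub>C'\<^esub> y) = g x \<ominus>\<^bsub>C\<^esub> g y"
  by (simp add: a_minus_def g_add g_minus)

lemma g_finsum: "t \<in> A \<rightarrow> carrier C' \<Longrightarrow> g (finsum C' t A) = finsum C (\<lambda>s. g (t s)) A"
proof (induction A rule: infinite_finite_induct)
  case (insert x A)
  then show ?case
    by (subst C'.M.finsum_insert C.M.finsum_insert; auto simp: g_closed g_add Pi_iff)+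
qed (auto simp: g_zero C.M.finsum_infinite C'.M.finsum_infinite)

lemma conformal': "conformal_algebra C'"
proof unfold_locales
  fix a b assume ab: "a \<in> carrier C'" "b \<in> carrier C'"
  have "{n. nprod C' n a b \<noteq> \<zero>\<^bsub>C'\<^esub>} = {n. nprod C n (g a) (g b) \<noteq> \<zero>\<^bsub>C\<^esub>}"
    using ab nprod'_closed by (auto simp flip: g_nprod simp: g_eq_zero)
  then show "finite {n. nprod C' n a b \<noteq> \<zero>\<^bsub>C'\<^esub>}"
    using C.nprod_local ab g_closed by simp
qed ((rule nprod'_closed; assumption) |
    (rule g_eqI; simp add: g_add g_smult g_nprod g_closed nprod'_closed smult_closed
      smult'_closed C.nprod_add_left C.nprod_add_right C.nprod_scalar_left
      C.nprod_scalar_right C.nprod_D_left C.nprod_D_right))+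

lemma brace'_closed:
  assumes "a \<in> carrier C'" "b \<in> carrier C'"
  shows "nprod_brace C' n a b \<in> carrier C'"
  unfolding nprod_brace_def using assms
  by (intro C'.M.finsum_closed) (auto simp: nprod'_closed smult'_closed)

lemma g_brace:
  assumes "a \<in> carrier C'" "b \<in> carrier C'"
  shows "g (nprod_brace C' n a b) = nprod_brace C n (g a) (g b)"
proof -
  have "{s. nprod C' (n + s) a b \<noteq> \<zero>\<^bsub>C'\<^esub>} = {s. nprod C (n + s) (g a) (g b) \<noteq> \<zero>\<^bsub>C\<^esub>}"
    using assms nprod'_closed by (auto simp flip: g_nprod simp: g_eq_zero)
  then show ?thesis
    unfolding nprod_brace_def using assms
    by (subst g_finsum)
      (auto simp: nprod'_closed smult'_closed g_smult g_nprod)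
qed

lemma g_locality:
  assumes "a \<in> carrier C'" "b \<in> carrier C'"
  shows "locality_deg C' a b = locality_deg C (g a) (g b)"
  unfolding locality_deg_def using assms nprod'_closed
  by (simp flip: g_nprod add: g_eq_zero)

lemma assoc':
  assumes "assoc_conformal_algebra C"
  shows "assoc_conformal_algebra C'"
proof -
  interpret D: assoc_conformal_algebra C by fact
  interpret D': conformal_algebra C' by (rule conformal')
  show ?thesis
  proof unfold_locales
    fix a b c n m
    assume abc: "a \<in> carrier C'" "b \<in> carrier C'" "c \<in> carrier C'"
    let ?t = "\<lambda>s. of_nat (n choose s) \<odot>\<^bsub>C'\<^esub> nprod C' (m + s) (nprod C' (n - s) a b) c"
    have t: "?t \<in> {..n} \<rightarrow> carrier C'"
      using abc by (auto simp: nprod'_closed smult'_closed)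
    show "nprod C' n a (nprod C' m b c) = finsum C' ?t {..n}"
    proof (rule g_eqI)
      show "g (nprod C' n a (nprod C' m b c)) = g (finsum C' ?t {..n})"
        unfolding g_finsum[OF t] using abc
        by (simp add: g_nprod g_smult nprod'_closed D.nprod_assoc g_closed)
    qed (use abc t in \<open>auto simp: nprod'_closed intro!: C'.M.finsum_closed\<close>)
  qed
qed

lemma comm':
  assumes "comm_conformal_algebra C"
  shows "comm_conformal_algebra C'"
proof -
  interpret D: comm_conformal_algebra C by fact
  interpret D': assoc_conformal_algebra C' by (rule assoc') unfold_locales
  show ?thesis
  proof unfold_locales
    fix a b n
    assume ab: "a \<in> carrier C'" "b \<in> carrier C'"
    show "nprod C' n a b = nprod_brace C' n b a"
      by (rule g_eqI) (use ab in \<open>auto simp: nprod'_closed brace'_closed g_nprod g_brace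
            g_closed intro: D.nprod_comm\<close>)
  qed
qed

end

context conformal_algebra
begin

lemma smultH_closed [simp]: "x \<in> carrier C \<Longrightarrow> h \<odot>\<^bsub>C\<^esub> x \<in> carrier C"
  by (rule smult_closed) auto

lemma subalgebra_closed:
  assumes "conf_subalgebra C S"
  shows "S \<subseteq> carrier C" "\<zero> \<in> S" "x \<in> S \<Longrightarrow> y \<in> S \<Longrightarrow> x \<oplus> y \<in> S" "x \<in> S \<Longrightarrow> h \<odot>\<^bsub>C\<^esub> x \<in> S"
    "x \<in> S \<Longrightarrow> y \<in> S \<Longrightarrow> nprod C n x y \<in> S"
  using assms unfolding conf_subalgebra_def LinearCombinations.submodule_def by auto

lemma subalgebraI:
  assumes "S \<subseteq> carrier C" "\<zero> \<in> S" "\<And>x y. x \<in> S \<Longrightarrow> y \<in> S \<Longrightarrow> x \<oplus> y \<in> S"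
    "\<And>h x. x \<in> S \<Longrightarrow> h \<odot>\<^bsub>C\<^esub> x \<in> S" "\<And>n x y. x \<in> S \<Longrightarrow> y \<in> S \<Longrightarrow> nprod C n x y \<in> S"
  shows "conf_subalgebra C S"
  using assms unfolding conf_subalgebra_def LinearCombinations.submodule_def
  by (auto intro: module_axioms)

lemma subalgebra_carrier: "conf_subalgebra C (carrier C)"
  by (rule subalgebraI) auto

lemma generated_subalgebra:
  assumes "X \<subseteq> carrier C"
  shows "conf_subalgebra C (conf_generated C X)"
proof (rule subalgebraI)
  show "conf_generated C X \<subseteq> carrier C"
    using assms subalgebra_carrier unfolding conf_generated_def by blast
qed (auto simp: conf_generated_def subalgebra_closed)

lemma generated_least: "conf_subalgebra C S \<Longrightarrow> X \<subseteq> S \<Longrightarrow> conf_generated C X \<subseteq> S"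
  unfolding conf_generated_def by auto

lemma generated_superset: "X \<subseteq> conf_generated C X"
  unfolding conf_generated_def by auto

lemma embedding_subalgebra:
  assumes "conf_subalgebra C S"
  shows "conf_embedding C (C\<lparr>carrier := S\<rparr>) id"
proof -
  interpret S: Module.module "H :: 'k poly ring" "C\<lparr>carrier := S\<rparr>"
    by (rule submodule_is_module) (use assms in \<open>auto simp: conf_subalgebra_def\<close>)
  show ?thesis
    by unfold_locales
      (use subalgebra_closed[OF assms] in \<open>auto simp: conf_hom_def LinearCombinations.module_hom_def\<close>)
qed

lemma homs_eq_on_generated:
  assumes "f \<in> conf_hom C C'" "f' \<in> conf_hom C C'" "X \<subseteq> carrier C" "conformal_algebra C'"
    and eq: "\<And>x. x \<in> X \<Longrightarrow> f x = f' x" and x: "x \<in> conf_generated C X"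
  shows "f x = f' x"
proof -
  interpret C': conformal_algebra C' by fact
  have z: "h \<zero> = \<zero>\<^bsub>C'\<^esub>" if "h \<in> conf_hom C C'" for h
  proof -
    have 0: "h \<zero> \<in> carrier C'"
      using that by (auto simp: conf_hom_def LinearCombinations.module_hom_def)
    have "h (0 \<odot>\<^bsub>C\<^esub> \<zero>) = 0 \<odot>\<^bsub>C'\<^esub> h \<zero>"
      using that M.zero_closed unfolding conf_hom_def LinearCombinations.module_hom_def by force
    then show ?thesis
      using smult_l_null[of \<zero>] C'.smult_l_null[OF 0] by simp
  qed
  have "conf_subalgebra C {x \<in> carrier C. f x = f' x}"
  proof -
    have "h (x \<oplus> y) = h x \<oplus>\<^bsub>C'\<^esub> h y" "h (r \<odot>\<^bsub>C\<^esub> x) = r \<odot>\<^bsub>C'\<^esub> h x"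
      "h (nprod C n x y) = nprod C' n (h x) (h y)"
      if "h \<in> conf_hom C C'" "x \<in> carrier C" "y \<in> carrier C" for h x y r n
      using that by (auto simp: conf_hom_def LinearCombinations.module_hom_def)
    note hom = this[OF assms(1)] this[OF assms(2)]
    show ?thesis
      by (rule subalgebraI) (auto simp: z[OF assms(1)] z[OF assms(2)] hom)
  qed
  from generated_least[OF this, of X] show ?thesis using assms by auto
qed

end

text \<open>Transport of structure along a map that is injective on the carrier.\<close>

definition transport_alg ::
    "('a \<Rightarrow> 'b) \<Rightarrow> ('k::field_char_0 poly, 'a) conf_alg \<Rightarrow> ('k poly, 'b) conf_alg" where
  "transport_alg f C = (let g = the_inv_into (carrier C) f in
    \<lparr>carrier = f ` carrier C, mult = undefined, one = undefined, zero = f \<zero>\<^bsub>C\<^esub>,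
     add = (\<lambda>x y. f (g x \<oplus>\<^bsub>C\<^esub> g y)), smult = (\<lambda>h x. f (h \<odot>\<^bsub>C\<^esub> g x)),
     nprod = (\<lambda>n x y. f (nprod C n (g x) (g y)))\<rparr>)"

locale conf_transport = conformal_algebra C
  for C :: "('k::field_char_0 poly, 'a) conf_alg" (structure) and f :: "'a \<Rightarrow> 'b" +
  assumes f_inj: "inj_on f (carrier C)"
begin

abbreviation "T \<equiv> transport_alg f C"
abbreviation "g \<equiv> the_inv_into (carrier C) f"

lemma g_f [simp]: "x \<in> carrier C \<Longrightarrow> g (f x) = x"
  using f_inj by (rule the_inv_into_f_f)

lemma T_simps [simp]:
  "carrier T = f ` carrier C" "\<zero>\<^bsub>T\<^esub> = f \<zero>" "x \<oplus>\<^bsub>T\<^esub> y = f (g x \<oplus> g y)"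
  "h \<odot>\<^bsub>T\<^esub> x = f (h \<odot>\<^bsub>C\<^esub> g x)" "nprod T n x y = f (nprod C n (g x) (g y))"
  by (simp_all add: transport_alg_def Let_def)

lemma module_T: "Module.module (H :: 'k poly ring) T"
proof (rule moduleI)
  show "cring (H :: 'k poly ring)" ..
  show "abelian_group T"
  proof (rule abelian_groupI)
    fix x assume "x \<in> carrier T"
    then obtain y where "y \<in> carrier C" "x = f y" by auto
    then show "\<exists>z\<in>carrier T. z \<oplus>\<^bsub>T\<^esub> x = \<zero>\<^bsub>T\<^esub>"
      by (intro bexI[of _ "f (\<ominus> y)"]) (auto simp: M.l_neg)
  qed (auto simp: M.a_ac)
next
  fix h k :: "'k poly" and x
  assume "x \<in> carrier T"
  then obtain u where u: "u \<in> carrier C" "x = f u" by auto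
  show "(h \<oplus>\<^bsub>H\<^esub> k) \<odot>\<^bsub>T\<^esub> x = h \<odot>\<^bsub>T\<^esub> x \<oplus>\<^bsub>T\<^esub> k \<odot>\<^bsub>T\<^esub> x"
    using smult_l_distr[of h k u] u by simp
  show "(h \<otimes>\<^bsub>H\<^esub> k) \<odot>\<^bsub>T\<^esub> x = h \<odot>\<^bsub>T\<^esub> (k \<odot>\<^bsub>T\<^esub> x)"
    using smult_assoc1[of h k u] u by simp
  show "\<one>\<^bsub>H\<^esub> \<odot>\<^bsub>T\<^esub> x = x"
    using smult_one[of u] u by simp
qed (auto simp: smult_r_distr)

sublocale emb: conf_embedding C T g
proof -
  interpret T: Module.module "H :: 'k poly ring" T by (rule module_T)
  show "conf_embedding C T g"
    by unfold_locales (auto simp: conf_hom_def LinearCombinations.module_hom_def inj_on_def)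
qed

lemma f_hom: "f \<in> conf_hom C T"
  by (auto simp: conf_hom_def LinearCombinations.module_hom_def)

lemma f_brace:
  assumes "a \<in> carrier C" "b \<in> carrier C"
  shows "nprod_brace T n (f a) (f b) = f (nprod_brace C n a b)"
proof -
  have ab: "f a \<in> carrier T" "f b \<in> carrier T" using assms by auto
  obtain z where z: "z \<in> carrier C" "nprod_brace T n (f a) (f b) = f z"
    using emb.brace'_closed[OF ab, of n] by auto
  with emb.g_brace[OF ab, of n] assms show ?thesis by simp
qed

lemma f_diff:
  assumes "x \<in> carrier C" "y \<in> carrier C"
  shows "f x \<ominus>\<^bsub>T\<^esub> f y = f (x \<ominus> y)"
proof (rule emb.g_eqI)
  show "f x \<ominus>\<^bsub>T\<^esub> f y \<in> carrier T"
    by (rule emb.C'.M.minus_closed) (use assms in auto)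
  show "g (f x \<ominus>\<^bsub>T\<^esub> f y) = g (f (x \<ominus> y))"
    using emb.g_diff[of "f x" "f y"] assms by simp
qed (use assms in auto)

lemma generated_T:
  assumes "X \<subseteq> carrier C" "conf_generated C X = carrier C"
  shows "conf_generated T (f ` X) = carrier T"
proof -
  interpret T: conformal_algebra T by (rule emb.conformal')
  show ?thesis
  proof
    show "conf_generated T (f ` X) \<subseteq> carrier T"
      by (rule T.generated_least[OF T.subalgebra_carrier]) (use assms in auto)
    have "carrier T \<subseteq> S" if S: "conf_subalgebra T S" "f ` X \<subseteq> S" for S
    proof -
      note S' = T.subalgebra_closed[OF S(1)]
      have "conf_subalgebra C {x \<in> carrier C. f x \<in> S}"
      proof (rule subalgebraI)
        fix x y assume xy: "x \<in> {x \<in> carrier C. f x \<in> S}" "y \<in> {x \<in> carrier C. f x \<in> S}"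
        show "x \<oplus> y \<in> {x \<in> carrier C. f x \<in> S}"
          using S'(3)[of "f x" "f y"] xy by simp
      next
        fix h x assume xy: "x \<in> {x \<in> carrier C. f x \<in> S}"
        show "h \<odot>\<^bsub>C\<^esub> x \<in> {x \<in> carrier C. f x \<in> S}"
          using S'(4)[of "f x" h] xy by simp
      next
        fix n x y assume xy: "x \<in> {x \<in> carrier C. f x \<in> S}" "y \<in> {x \<in> carrier C. f x \<in> S}"
        show "nprod C n x y \<in> {x \<in> carrier C. f x \<in> S}"
          using S'(5)[of "f x" "f y" n] xy by simp
      qed (use S'(2) in auto)
      from generated_least[OF this, of X] show ?thesis using assms S(2) by auto
    qed
    then show "carrier T \<subseteq> conf_generated T (f ` X)"
      by (auto simp: conf_generated_def)
  qed
qed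

end

lemma conf_hom_comp:
  assumes "f \<in> conf_hom A B" "f' \<in> conf_hom B C"
  shows "(\<lambda>x. f' (f x)) \<in> conf_hom A C"
  using assms by (auto simp: conf_hom_def LinearCombinations.module_hom_def Pi_iff)

primrec term_value ::
    "('k::field_char_0 poly, 'a) conf_alg \<Rightarrow> ('g \<Rightarrow> 'a) \<Rightarrow> ('k poly, 'g) conf_term \<Rightarrow> 'a" where
  "term_value C \<alpha> (Gen x) = \<alpha> x"
| "term_value C \<alpha> Zero = \<zero>\<^bsub>C\<^esub>"
| "term_value C \<alpha> (Add s t) = term_value C \<alpha> s \<oplus>\<^bsub>C\<^esub> term_value C \<alpha> t"
| "term_value C \<alpha> (Scale h t) = h \<odot>\<^bsub>C\<^esub> term_value C \<alpha> t"
| "term_value C \<alpha> (NProd n s t) = nprod C n (term_value C \<alpha> s) (term_value C \<alpha> t)"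

lemma (in conformal_algebra) inj_into_terms:
  fixes \<alpha> :: "'g \<Rightarrow> 'a"
  assumes \<alpha>: "\<alpha> ` X \<subseteq> carrier C" and gen: "conf_generated C (\<alpha> ` X) = carrier C"
  shows "\<exists>f :: 'a \<Rightarrow> ('k poly, 'g) conf_term. inj_on f (carrier C)"
proof -
  define v where "v = term_value C (\<lambda>x. if x \<in> X then \<alpha> x else \<zero>)"
  have v: "v t \<in> carrier C" for t
    unfolding v_def by (induction t) (use \<alpha> in auto)
  have "conf_subalgebra C (range v)"
  proof (rule subalgebraI)
    show "\<zero> \<in> range v" unfolding v_def by (rule range_eqI[of _ _ Zero]) simp
  next
    fix x y assume "x \<in> range v" "y \<in> range v"
    then obtain s t where "x = v s" "y = v t" by auto
    then show "x \<oplus> y \<in> range v" unfolding v_def by (intro range_eqI[of _ _ "Add s t"]) simp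
  next
    fix h x assume "x \<in> range v"
    then obtain s where "x = v s" by auto
    then show "h \<odot>\<^bsub>C\<^esub> x \<in> range v" unfolding v_def by (intro range_eqI[of _ _ "Scale h s"]) simp
  next
    fix n x y assume "x \<in> range v" "y \<in> range v"
    then obtain s t where "x = v s" "y = v t" by auto
    then show "nprod C n x y \<in> range v"
      unfolding v_def by (intro range_eqI[of _ _ "NProd n s t"]) simp
  qed (use v in auto)
  moreover have "\<alpha> ` X \<subseteq> range v"
  proof
    fix y assume "y \<in> \<alpha> ` X"
    then obtain x where "x \<in> X" "y = \<alpha> x" by auto
    then show "y \<in> range v" unfolding v_def by (intro range_eqI[of _ _ "Gen x"]) simp
  qed
  ultimately have "carrier C \<subseteq> range v" using generated_least gen by metis
  then show ?thesis using inj_on_inv_into by blast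
qed

theorem universal_envelope_any:
  fixes L :: "('k::field_char_0 poly, 'l) conf_alg" and V :: "('k poly, 'v) conf_alg"
  assumes U: "universal_envelope TYPE(('k poly, 'l) conf_term) L B N U \<iota>"
    and B: "B \<subseteq> carrier L"
    and V: "assoc_envelope L V \<kappa>" "locality_bounded V B N \<kappa>"
  shows "envelope_morphisms L U \<iota> V \<kappa> \<noteq> {}"
proof -
  have aV: "assoc_conformal_algebra V" and \<kappa>: "\<kappa> \<in> conf_hom L (commutator_alg V)"
    and gV: "conf_generated V (\<kappa> ` carrier L) = carrier V"
    using V(1) by (auto simp: assoc_envelope_def)
  interpret V: assoc_conformal_algebra V by fact
  have \<kappa>_in: "\<kappa> ` carrier L \<subseteq> carrier V"
    using \<kappa> by (auto simp: conf_hom_def LinearCombinations.module_hom_def commutator_alg_def)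
  obtain f :: "'v \<Rightarrow> ('k poly, 'l) conf_term" where f: "inj_on f (carrier V)"
    using V.inj_into_terms[OF \<kappa>_in gV] by blast
  interpret conf_transport V f by unfold_locales (rule f)
  have "(\<lambda>x. f (\<kappa> x)) \<in> conf_hom L (commutator_alg T)"
  proof -
    have br: "nprod_brace V n a b \<in> carrier V" if "a \<in> carrier V" "b \<in> carrier V" for n a b
      unfolding nprod_brace_def by (intro V.M.finsum_closed) (use that in auto)
    have in_V: "\<kappa> a \<in> carrier V" if "a \<in> carrier L" for a
      using that \<kappa>_in by blast
    have "\<kappa> (x \<oplus>\<^bsub>L\<^esub> y) = \<kappa> x \<oplus>\<^bsub>V\<^esub> \<kappa> y" "\<kappa> (h \<odot>\<^bsub>L\<^esub> x) = h \<odot>\<^bsub>V\<^esub> \<kappa> x"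
      "\<kappa> (nprod L n x y) = nprod V n (\<kappa> x) (\<kappa> y) \<ominus>\<^bsub>V\<^esub> nprod_brace V n (\<kappa> y) (\<kappa> x)"
      if "x \<in> carrier L" "y \<in> carrier L" for x y h n
      using \<kappa> that
      by (auto simp: conf_hom_def LinearCombinations.module_hom_def commutator_alg_def a_minus_def)
    note \<kappa>_hom = this
    have ops: "carrier (commutator_alg A) = carrier A" "add (commutator_alg A) = add A"
      "smult (commutator_alg A) = smult A"
      "nprod (commutator_alg A) n x y = nprod A n x y \<ominus>\<^bsub>A\<^esub> nprod_brace A n y x"
      for A :: "('k poly, 'c) conf_alg" and n x y
      by (simp_all add: commutator_alg_def)
    show ?thesis
      unfolding conf_hom_def LinearCombinations.module_hom_def ops
    proof (intro CollectI conjI allI impI ballI Pi_I)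
      fix n x y assume xy: "x \<in> carrier L" "y \<in> carrier L"
      have "nprod T n (f (\<kappa> x)) (f (\<kappa> y)) = f (nprod V n (\<kappa> x) (\<kappa> y))"
        using xy in_V by simp
      then show "f (\<kappa> (nprod L n x y)) =
          nprod T n (f (\<kappa> x)) (f (\<kappa> y)) \<ominus>\<^bsub>T\<^esub> nprod_brace T n (f (\<kappa> y)) (f (\<kappa> x))"
        using xy in_V by (simp only: f_brace f_diff br V.nprod_closed \<kappa>_hom)
    qed (use in_V in \<open>auto simp: \<kappa>_hom\<close>)
  qed
  moreover have "conf_generated T ((\<lambda>x. f (\<kappa> x)) ` carrier L) = carrier T"
    using generated_T[OF \<kappa>_in gV] by (simp add: image_image)
  ultimately have "assoc_envelope L T (\<lambda>x. f (\<kappa> x))"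
    using emb.assoc'[OF aV] by (simp add: assoc_envelope_def)
  moreover have "locality_bounded T B N (\<lambda>x. f (\<kappa> x))"
    unfolding locality_bounded_def
  proof (intro ballI)
    fix a b assume ab: "a \<in> B" "b \<in> B"
    then have "\<kappa> a \<in> carrier V" "\<kappa> b \<in> carrier V" using B \<kappa>_in by blast+
    then have "locality_deg T (f (\<kappa> a)) (f (\<kappa> b)) = locality_deg V (\<kappa> a) (\<kappa> b)"
      using emb.g_locality[of "f (\<kappa> a)" "f (\<kappa> b)"] by simp
    then show "locality_deg T (f (\<kappa> a)) (f (\<kappa> b)) \<le> N a b"
      using V(2) ab by (simp add: locality_bounded_def)
  qed
  ultimately obtain \<phi> where "\<phi> \<in> envelope_morphisms L U \<iota> T (\<lambda>x. f (\<kappa> x))"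
    using U unfolding universal_envelope_def by blast
  then have \<phi>: "\<phi> \<in> conf_hom U T" "\<And>x. x \<in> carrier L \<Longrightarrow> \<phi> (\<iota> x) = f (\<kappa> x)"
    by (auto simp: envelope_morphisms_def)
  have "g (\<phi> (\<iota> x)) = \<kappa> x" if "x \<in> carrier L" for x
  proof -
    have "\<kappa> x \<in> carrier V" using that \<kappa>_in by blast
    then show ?thesis using \<phi>(2)[OF that] by simp
  qed
  then have "(\<lambda>x. g (\<phi> x)) \<in> envelope_morphisms L U \<iota> V \<kappa>"
    using conf_hom_comp[OF \<phi>(1) emb.g_hom] by (simp add: envelope_morphisms_def)
  then show ?thesis by blast
qed

theorem free_comm_conformal_any:
  fixes F :: "('k::field_char_0 poly, 'f) conf_alg" and C :: "('k poly, 'v) conf_alg"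
    and B :: "'g set"
  assumes F: "free_comm_conformal TYPE(('k poly, 'g) conf_term) B N F i"
    and C: "comm_conformal_algebra C" "\<alpha> ` B \<subseteq> carrier C" "locality_bounded C B N \<alpha>"
  shows "\<exists>\<phi>\<in>conf_hom F C. (\<forall>b\<in>B. \<phi> (i b) = \<alpha> b) \<and>
    (\<forall>\<psi>\<in>conf_hom F C. (\<forall>b\<in>B. \<psi> (i b) = \<alpha> b) \<longrightarrow> (\<forall>x\<in>carrier F. \<psi> x = \<phi> x))"
proof -
  interpret C: comm_conformal_algebra C by fact
  note F' = F[unfolded free_comm_conformal_def]
  interpret F: comm_conformal_algebra F using F' by (rule conjunct1)
  have i: "i ` B \<subseteq> carrier F" using F' by (elim conjE)
  have gF: "conf_generated F (i ` B) = carrier F" using F' by (elim conjE)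
  have univ: "\<exists>\<phi>. \<phi> \<in> conf_hom F T \<and> (\<forall>b\<in>B. \<phi> (i b) = \<beta> b)"
    if "comm_conformal_algebra T" "\<beta> ` B \<subseteq> carrier T" "locality_bounded T B N \<beta>"
    for T :: "('k poly, ('k poly, 'g) conf_term) conf_alg" and \<beta>
  proof -
    have "\<exists>\<phi>\<in>conf_hom F T. (\<forall>b\<in>B. \<phi> (i b) = \<beta> b) \<and>
        (\<forall>\<psi>\<in>conf_hom F T. (\<forall>b\<in>B. \<psi> (i b) = \<beta> b) \<longrightarrow> (\<forall>x\<in>carrier F. \<psi> x = \<phi> x))"
      using F'[THEN conjunct2, THEN conjunct2, THEN conjunct2, THEN conjunct2, THEN spec[of _ T],
          THEN spec[of _ \<beta>], THEN mp] that by simp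
    then show ?thesis by (elim bexE conjE) (intro exI conjI)
  qed
  define S where "S = conf_generated C (\<alpha> ` B)"
  have S: "conf_subalgebra C S" unfolding S_def by (rule C.generated_subalgebra) fact
  define D where "D = C\<lparr>carrier := S\<rparr>"
  interpret sub: conf_embedding C D id unfolding D_def by (rule C.embedding_subalgebra[OF S])
  interpret D: comm_conformal_algebra D by (rule sub.comm') fact
  have cD: "carrier D = S" and D_ops: "zero D = zero C" "add D = add C" "smult D = smult C"
      "nprod D = nprod C"
    by (simp_all add: D_def)
  have \<alpha>S: "\<alpha> ` B \<subseteq> carrier D" unfolding cD S_def by (rule C.generated_superset)
  have gD: "conf_generated D (\<alpha> ` B) = carrier D"
  proof
    show "conf_generated D (\<alpha> ` B) \<subseteq> carrier D"
      by (rule D.generated_least[OF D.subalgebra_carrier \<alpha>S])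
    note G = D.subalgebra_closed[OF D.generated_subalgebra[OF \<alpha>S]]
    have "conf_subalgebra C (conf_generated D (\<alpha> ` B))"
    proof (rule C.subalgebraI)
      show "conf_generated D (\<alpha> ` B) \<subseteq> carrier C"
        using G(1) C.subalgebra_closed(1)[OF S] unfolding cD by (rule order_trans)
    qed (use G(2-5) in \<open>simp_all add: D_ops\<close>)
    then show "carrier D \<subseteq> conf_generated D (\<alpha> ` B)"
      unfolding cD S_def by (rule C.generated_least) (rule D.generated_superset)
  qed
  obtain f :: "'v \<Rightarrow> ('k poly, 'g) conf_term" where f: "inj_on f (carrier D)"
    using D.inj_into_terms[OF \<alpha>S gD] by blast
  interpret conf_transport D f by unfold_locales (rule f)
  have locT: "locality_bounded T B N (\<lambda>x. f (\<alpha> x))"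
    unfolding locality_bounded_def
  proof (intro ballI)
    fix a b assume ab: "a \<in> B" "b \<in> B"
    have ab': "\<alpha> a \<in> carrier D" "\<alpha> b \<in> carrier D" using ab \<alpha>S by blast+
    have "locality_deg T (f (\<alpha> a)) (f (\<alpha> b)) = locality_deg D (\<alpha> a) (\<alpha> b)"
      using emb.g_locality[of "f (\<alpha> a)" "f (\<alpha> b)"] ab' by simp
    also have "\<dots> = locality_deg C (\<alpha> a) (\<alpha> b)"
      using sub.g_locality[OF ab'] by simp
    finally show "locality_deg T (f (\<alpha> a)) (f (\<alpha> b)) \<le> N a b"
      using C(3) ab by (simp add: locality_bounded_def)
  qed
  have comT: "comm_conformal_algebra T" by (rule emb.comm') unfold_locales
  have imT: "(\<lambda>x. f (\<alpha> x)) ` B \<subseteq> carrier T"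
    unfolding T_simps by (rule image_subsetI) (use \<alpha>S in blast)
  obtain \<phi> where \<phi>: "\<phi> \<in> conf_hom F T" "\<forall>b\<in>B. \<phi> (i b) = f (\<alpha> b)"
    using univ[OF comT imT locT] by (elim exE conjE)
  let ?\<phi> = "\<lambda>x. id (g (\<phi> x))"
  have hom: "?\<phi> \<in> conf_hom F C"
    by (rule conf_hom_comp[OF conf_hom_comp[OF \<phi>(1) emb.g_hom] sub.g_hom])
  show ?thesis
  proof (intro bexI[OF _ hom] conjI ballI impI)
    show val: "?\<phi> (i b) = \<alpha> b" if "b \<in> B" for b
    proof -
      have "\<alpha> b \<in> carrier D" using \<alpha>S that by blast
      then show ?thesis using bspec[OF \<phi>(2) that] by simp
    qed
    fix \<psi> x assume \<psi>: "\<psi> \<in> conf_hom F C" "\<forall>b\<in>B. \<psi> (i b) = \<alpha> b" and x: "x \<in> carrier F"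
    show "\<psi> x = ?\<phi> x"
    proof (rule F.homs_eq_on_generated[OF \<psi>(1) hom i C.conformal_algebra_axioms])
      show "\<psi> y = ?\<phi> y" if "y \<in> i ` B" for y
        using that val \<psi>(2) by fastforce
      show "x \<in> conf_generated F (i ` B)"
        using x gF by simp
    qed
  qed
qed

end

theory Submission
  imports Defs
begin

text \<open>Let \<open>U = U\<^sub>N(L)\<close> for a large \<open>N\<close>, and let \<open>U\<^sub>2\<close> be spanned by \<open>\<iota>(L)\<close> and the products of two
  elements of \<open>\<iota>(L)\<close>; by locality it is finitely generated over \<open>H\<close>. The algebra \<open>L\<close> acts on itself and on \<open>U\<^sub>2\<close>
  by commutators. Left multiplication \<open>L \<rightarrow> Chom(L, U\<^sub>2)\<close> is not a cocycle for these actions, but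
  since \<open>D\<close> is a derivation of \<open>L\<close>, the map \<open>a \<mapsto> (y \<mapsto> \<iota>(Da)\<^sub>(\<^sub>n\<^sub>)\<iota>(y))\<close> is one. So it turns \<open>L \<oplus> U\<^sub>2\<close>
  into a finite representation, whose quotient by the torsion is free. As
  \<open>\<iota>(Da)\<^sub>(\<^sub>n\<^sub>)\<iota>(y) = -n \<iota>(a)\<^sub>(\<^sub>n\<^sub>-\<^sub>1\<^sub>)\<iota>(y)\<close>, it is faithful if for every \<open>a \<noteq> 0\<close> some
  product \<open>\<iota>(a)\<^sub>(\<^sub>n\<^sub>)\<iota>(b)\<close> is not a torsion element.

  The latter is seen in \<open>gr U\<close>, which maps to the commutative conformal algebra \<open>H t \<oplus> H t\<^sup>2\<close> with
  \<open>t\<^sup>3 = 0\<close> via the free commutative algebra, for every \<open>b \<in> B\<close> by sending \<open>b\<close> to \<open>t\<close> and the rest of \<open>B\<close>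
  to \<open>0\<close>. The isomorphism between \<open>gr U\<close> and the free algebra need not be graded; but the
  coefficients of \<open>t\<close> vanish on products, so that together they give a surjection from the component of
  degree 1, which has \<open>|B|\<close> generators, onto \<open>H\<^sup>B\<close>. Such a map is injective.\<close>

section \<open>Modules over \<open>k[D]\<close>\<close>

text \<open>Neither of the two obvious actions suffices. The adjoint action preserves the finite
  modules \<open>L\<close> and \<open>U2\<close> but kills the centre of \<open>L\<close>. Left
  multiplication detects, under the PBW hypothesis, every nonzero element but raises the filtration
  degree. The off-diagonal block of a triangular action can combine the two, provided that it is a
  cocycle.

  Left multiplication itself misses this by a factor 2: the commutator of the left multiplications
  by a and b enters its coboundary once from each argument, which gives twice the left
  multiplication by the bracket. If a derivation d is inserted, the two occurrences become the
  commutators for the pairs (a, db) and (da, b), and these add up to left multiplication by d of the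
  bracket, exactly as required. The derivation D is always at hand, and it costs only an index shift
  and a nonzero factor.

  Passing to a free module is compatible with the axioms because every representation annihilates
  torsion vectors. Values of the action that are torsion get lost, however; this is why products are
  required to be nonzero modulo torsion.\<close>

locale H_module = Module.module "H :: 'k::field_char_0 poly ring" M
  for M :: "('k::field_char_0 poly, 'a, 'x) module_scheme" (structure)
begin

lemma smultH [simp, intro]: "x \<in> carrier M \<Longrightarrow> h \<odot>\<^bsub>M\<^esub> x \<in> carrier M"
  by (rule smult_closed) auto

lemma smult_add_left: "x \<in> carrier M \<Longrightarrow> (h + k) \<odot>\<^bsub>M\<^esub> x = h \<odot>\<^bsub>M\<^esub> x \<oplus> k \<odot>\<^bsub>M\<^esub> x"
  using smult_l_distr[of h k x] by simp

lemma smult_add_right: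
  "x \<in> carrier M \<Longrightarrow> y \<in> carrier M \<Longrightarrow> h \<odot>\<^bsub>M\<^esub> (x \<oplus> y) = h \<odot>\<^bsub>M\<^esub> x \<oplus> h \<odot>\<^bsub>M\<^esub> y"
  using smult_r_distr[of h x y] by simp

lemma smult_mult: "x \<in> carrier M \<Longrightarrow> (h * k) \<odot>\<^bsub>M\<^esub> x = h \<odot>\<^bsub>M\<^esub> (k \<odot>\<^bsub>M\<^esub> x)"
  using smult_assoc1[of h k x] by simp

lemma smult_1 [simp]: "x \<in> carrier M \<Longrightarrow> 1 \<odot>\<^bsub>M\<^esub> x = x"
  using smult_one[of x] by simp

lemma smult_0 [simp]: "x \<in> carrier M \<Longrightarrow> 0 \<odot>\<^bsub>M\<^esub> x = \<zero>"
  using smult_l_null[of x] by simp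

lemma smult_zero [simp]: "h \<odot>\<^bsub>M\<^esub> \<zero> = \<zero>"
  using smult_r_null[of h] by simp

lemma smult_uminus: "x \<in> carrier M \<Longrightarrow> (- h) \<odot>\<^bsub>M\<^esub> x = \<ominus> (h \<odot>\<^bsub>M\<^esub> x)"
  by (metis M.minus_equality add.left_inverse smultH smult_0 smult_add_left)

lemma smult_neg: "x \<in> carrier M \<Longrightarrow> h \<odot>\<^bsub>M\<^esub> (\<ominus> x) = \<ominus> (h \<odot>\<^bsub>M\<^esub> x)"
  using smult_r_minus[of h x] by simp

lemma diff_eq_zero: "x \<in> carrier M \<Longrightarrow> y \<in> carrier M \<Longrightarrow> x \<ominus> y = \<zero> \<longleftrightarrow> x = y"
  using M.add.inv_solve_right[of \<zero> x y] by (auto simp: a_minus_def M.r_neg)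

lemma smult_diff_right:
  "x \<in> carrier M \<Longrightarrow> y \<in> carrier M \<Longrightarrow> h \<odot>\<^bsub>M\<^esub> (x \<ominus> y) = h \<odot>\<^bsub>M\<^esub> x \<ominus> h \<odot>\<^bsub>M\<^esub> y"
  by (simp add: a_minus_def smult_add_right smult_neg)

lemma smult_commute: "x \<in> carrier M \<Longrightarrow> h \<odot>\<^bsub>M\<^esub> (k \<odot>\<^bsub>M\<^esub> x) = k \<odot>\<^bsub>M\<^esub> (h \<odot>\<^bsub>M\<^esub> x)"
  by (simp flip: smult_mult add: mult.commute)

lemma smult_pCons:
  "x \<in> carrier M \<Longrightarrow> pCons c h \<odot>\<^bsub>M\<^esub> x = [:c:] \<odot>\<^bsub>M\<^esub> x \<oplus> [:0, 1:] \<odot>\<^bsub>M\<^esub> (h \<odot>\<^bsub>M\<^esub> x)"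
  by (simp flip: smult_add_left smult_mult)

lemma smult_finsum:
  "f \<in> A \<rightarrow> carrier M \<Longrightarrow> h \<odot>\<^bsub>M\<^esub> finsum M f A = (\<Oplus>i\<in>A. h \<odot>\<^bsub>M\<^esub> f i)"
  by (induction A rule: infinite_finite_induct) (auto simp: smult_add_right Pi_iff)

lemma submoduleD:
  assumes "LinearCombinations.submodule H S M"
  shows "S \<subseteq> carrier M" "\<zero> \<in> S" "x \<in> S \<Longrightarrow> y \<in> S \<Longrightarrow> x \<oplus> y \<in> S" "x \<in> S \<Longrightarrow> h \<odot>\<^bsub>M\<^esub> x \<in> S"
  using assms unfolding LinearCombinations.submodule_def by auto

lemma submoduleI':
  assumes "S \<subseteq> carrier M" "\<zero> \<in> S" "\<And>x y. x \<in> S \<Longrightarrow> y \<in> S \<Longrightarrow> x \<oplus> y \<in> S"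
    "\<And>h x. x \<in> S \<Longrightarrow> h \<odot>\<^bsub>M\<^esub> x \<in> S"
  shows "LinearCombinations.submodule H S M"
  using assms unfolding LinearCombinations.submodule_def by (auto intro: module_axioms)

lemma span_in_carrier: "X \<subseteq> carrier M \<Longrightarrow> span X \<subseteq> carrier M"
  using span_is_submodule[of X] submoduleD(1) by blast

lemma span_least:
  assumes "LinearCombinations.submodule H S M" "X \<subseteq> S"
  shows "span X \<subseteq> S"
proof
  fix v assume "v \<in> span X"
  then obtain a A where A: "finite A" "A \<subseteq> X" "v = lincomb a A" unfolding span_def by blast
  have "lincomb a A \<in> S \<and> lincomb a A \<in> carrier M" using A(1,2)
  proof (induction A rule: finite_induct)
    case empty
    then show ?case using submoduleD[OF assms(1)] by (simp add: lincomb_def)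
  next
    case (insert w A)
    have w: "w \<in> S" "w \<in> carrier M" and A': "A \<subseteq> carrier M"
      using insert.prems assms(2) submoduleD(1)[OF assms(1)] by auto
    have "lincomb a (insert w A) = a w \<odot>\<^bsub>M\<^esub> w \<oplus> lincomb a A"
      using lincomb_insert[of A a w] insert.hyps w A' by simp
    then show ?case using insert w submoduleD[OF assms(1)] by auto
  qed
  then show "v \<in> S" using A by simp
qed

lemma span_incl: "X \<subseteq> carrier M \<Longrightarrow> X \<subseteq> span X"
  by (rule in_own_span)

lemma span_induct [consumes 2, case_names base zero add smult]:
  assumes "x \<in> span X" "X \<subseteq> carrier M"
    and "\<And>x. x \<in> X \<Longrightarrow> P x" "P \<zero>"
    and "\<And>x y. x \<in> carrier M \<Longrightarrow> y \<in> carrier M \<Longrightarrow> P x \<Longrightarrow> P y \<Longrightarrow> P (x \<oplus> y)"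
    and "\<And>h x. x \<in> carrier M \<Longrightarrow> P x \<Longrightarrow> P (h \<odot>\<^bsub>M\<^esub> x)"
  shows "P x"
proof -
  have "LinearCombinations.submodule H {x \<in> carrier M. P x} M"
    by (rule submoduleI') (use assms in auto)
  from span_least[OF this, of X] show ?thesis using assms by auto
qed

text \<open>Coefficients belong to indices and not to vectors as in \<open>lincomb\<close>: a family
  may repeat a vector, and it can be changed at one index while the coefficients keep their
  places.\<close>

definition lc :: "'i set \<Rightarrow> ('i \<Rightarrow> 'a) \<Rightarrow> ('i \<Rightarrow> 'k poly) \<Rightarrow> 'a" where
  "lc I x c = (\<Oplus>i\<in>I. c i \<odot>\<^bsub>M\<^esub> x i)"

lemma lc_closed [simp, intro]: "x \<in> I \<rightarrow> carrier M \<Longrightarrow> lc I x c \<in> carrier M"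
  unfolding lc_def by (rule M.finsum_closed) auto

lemma lc_add:
  "x \<in> I \<rightarrow> carrier M \<Longrightarrow> lc I x (\<lambda>i. c i + d i) = lc I x c \<oplus> lc I x d"
  unfolding lc_def
  by (subst M.finsum_addf[symmetric])
    (auto intro!: M.finsum_cong' M.add.m_closed simp: smult_add_left Pi_iff simp del: M.finsum_addf)

lemma lc_smult: "x \<in> I \<rightarrow> carrier M \<Longrightarrow> lc I x (\<lambda>i. h * c i) = h \<odot>\<^bsub>M\<^esub> lc I x c"
  unfolding lc_def
  by (subst smult_finsum) (auto intro!: M.finsum_cong' simp: smult_mult Pi_iff)

lemma lc_cong:
  "x \<in> I \<rightarrow> carrier M \<Longrightarrow> (\<And>i. i \<in> I \<Longrightarrow> c i = d i) \<Longrightarrow> (\<And>i. i \<in> I \<Longrightarrow> x i = y i) \<Longrightarrow>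
    lc I x c = lc I y d"
  unfolding lc_def by (rule M.finsum_cong') (auto simp: Pi_iff)

lemma lc_remove:
  assumes "finite I" "i \<in> I" "x \<in> I \<rightarrow> carrier M"
  shows "lc I x c = c i \<odot>\<^bsub>M\<^esub> x i \<oplus> lc (I - {i}) x c"
proof -
  have "I = insert i (I - {i})" using assms by auto
  then show ?thesis unfolding lc_def
    using M.finsum_insert[of "I - {i}" i "\<lambda>i. c i \<odot>\<^bsub>M\<^esub> x i"] assms by (auto simp: Pi_iff)
qed

lemma lc_zero: "x \<in> I \<rightarrow> carrier M \<Longrightarrow> (\<And>i. i \<in> I \<Longrightarrow> c i = 0) \<Longrightarrow> lc I x c = \<zero>"
  unfolding lc_def by (rule M.add.finprod_one_eqI) (auto simp: Pi_iff)

lemma lc_unit: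
  assumes "finite I" "i \<in> I" "x \<in> I \<rightarrow> carrier M"
  shows "lc I x (\<lambda>j. if j = i then h else 0) = h \<odot>\<^bsub>M\<^esub> x i"
  using assms by (subst lc_remove[OF assms]) (subst lc_zero, auto simp: Pi_iff)

lemma span_eq_lc:
  assumes "finite I" "x \<in> I \<rightarrow> carrier M" "v \<in> span (x ` I)"
  shows "\<exists>c. v = lc I x c"
proof -
  have "x ` I \<subseteq> carrier M" using assms by auto
  with assms(3) show ?thesis
  proof (induction rule: span_induct)
    case (base v)
    then obtain i where "i \<in> I" "v = x i" by auto
    moreover have "x i \<in> carrier M" using assms(2) calculation by auto
    ultimately have "v = lc I x (\<lambda>j. if j = i then 1 else 0)"
      using lc_unit[OF assms(1) _ assms(2), of i 1] by simp
    then show ?case by blast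
  next
    case zero
    show ?case using lc_zero[OF assms(2), of "\<lambda>_. 0"] by metis
  next
    case (add v w)
    then show ?case using lc_add[OF assms(2)] by metis
  next
    case (smult h v)
    then show ?case using lc_smult[OF assms(2)] by metis
  qed
qed

section \<open>Torsion and coordinates modulo torsion\<close>

definition torsion :: "'a \<Rightarrow> bool" where
  "torsion x \<longleftrightarrow> (\<exists>h. h \<noteq> 0 \<and> h \<odot>\<^bsub>M\<^esub> x = \<zero>)"

text \<open>On the carrier this is congruence modulo the torsion submodule
  (\<open>tcong_diff\<close>), expressed without cosets. Multipliers of two congruences can be
  multiplied, as \<open>H\<close> is a domain.\<close>

definition tcong :: "'a \<Rightarrow> 'a \<Rightarrow> bool" (infix "\<sim>" 50) where
  "x \<sim> y \<longleftrightarrow> (\<exists>h. h \<noteq> 0 \<and> h \<odot>\<^bsub>M\<^esub> x = h \<odot>\<^bsub>M\<^esub> y)"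

lemma tcong_refl: "x \<sim> x" unfolding tcong_def by (rule exI[of _ 1]) auto

lemma tcong_sym: "x \<sim> y \<Longrightarrow> y \<sim> x" unfolding tcong_def by metis

lemma tcong_trans:
  assumes "x \<in> carrier M" "y \<in> carrier M" "z \<in> carrier M" "x \<sim> y" "y \<sim> z"
  shows "x \<sim> z"
proof -
  obtain h k where h: "h \<noteq> 0" "h \<odot>\<^bsub>M\<^esub> x = h \<odot>\<^bsub>M\<^esub> y" and k: "k \<noteq> 0" "k \<odot>\<^bsub>M\<^esub> y = k \<odot>\<^bsub>M\<^esub> z"
    using assms unfolding tcong_def by auto
  have "(k * h) \<odot>\<^bsub>M\<^esub> x = (k * h) \<odot>\<^bsub>M\<^esub> z"
    using assms h k by (metis smult_mult smult_commute)
  then show ?thesis using h k unfolding tcong_def by (intro exI[of _ "k * h"]) auto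
qed

lemma tcong_add:
  assumes "x \<in> carrier M" "y \<in> carrier M" "x' \<in> carrier M" "y' \<in> carrier M" "x \<sim> x'" "y \<sim> y'"
  shows "x \<oplus> y \<sim> x' \<oplus> y'"
proof -
  obtain h k where h: "h \<noteq> 0" "h \<odot>\<^bsub>M\<^esub> x = h \<odot>\<^bsub>M\<^esub> x'" and k: "k \<noteq> 0" "k \<odot>\<^bsub>M\<^esub> y = k \<odot>\<^bsub>M\<^esub> y'"
    using assms unfolding tcong_def by auto
  have "(h * k) \<odot>\<^bsub>M\<^esub> x = (h * k) \<odot>\<^bsub>M\<^esub> x'" "(h * k) \<odot>\<^bsub>M\<^esub> y = (h * k) \<odot>\<^bsub>M\<^esub> y'"
    using assms h k by (metis smult_mult smult_commute)+
  then have "(h * k) \<odot>\<^bsub>M\<^esub> (x \<oplus> y) = (h * k) \<odot>\<^bsub>M\<^esub> (x' \<oplus> y')"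
    using assms by (simp add: smult_add_right)
  then show ?thesis using h k unfolding tcong_def by (intro exI[of _ "h * k"]) auto
qed

lemma tcong_smult:
  assumes "x \<in> carrier M" "x' \<in> carrier M" "x \<sim> x'"
  shows "h \<odot>\<^bsub>M\<^esub> x \<sim> h \<odot>\<^bsub>M\<^esub> x'"
  using assms unfolding tcong_def by (metis smult_commute)

lemma tcong_zero: "x \<sim> \<zero> \<longleftrightarrow> torsion x"
  unfolding tcong_def torsion_def by simp

lemma tcong_diff:
  assumes "x \<in> carrier M" "y \<in> carrier M"
  shows "x \<sim> y \<longleftrightarrow> torsion (x \<ominus> y)"
  using assms unfolding tcong_def torsion_def by (simp add: diff_eq_zero smult_diff_right)

text \<open>An elementary operation: adding \<open>q\<close> times \<open>x j\<close> to
  \<open>x i\<close> is compensated by subtracting \<open>q * c i\<close> from \<open>c j\<close>.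
  With \<open>q = c j div c i\<close> it is a step of the Euclidean algorithm on the
  coefficients.\<close>

lemma lc_shift:
  assumes "finite I" "i \<in> I" "j \<in> I" "i \<noteq> j" "x \<in> I \<rightarrow> carrier M"
  shows "lc I (x(i := x i \<oplus> q \<odot>\<^bsub>M\<^esub> x j)) (c(j := c j - q * c i)) = lc I x c"
proof -
  let ?x = "x(i := x i \<oplus> q \<odot>\<^bsub>M\<^esub> x j)" and ?c = "c(j := c j - q * c i)"
  have xi: "x i \<in> carrier M" "x j \<in> carrier M" using assms by auto
  have x: "?x \<in> I \<rightarrow> carrier M" using assms by (auto simp: Pi_iff)
  define R where "R = lc (I - {i} - {j}) x c"
  have R: "R \<in> carrier M" unfolding R_def using assms by auto
  have R': "lc (I - {i} - {j}) ?x ?c = R"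
    unfolding R_def using assms by (intro lc_cong) (auto simp: Pi_iff)
  have "lc I ?x ?c = c i \<odot>\<^bsub>M\<^esub> (x i \<oplus> q \<odot>\<^bsub>M\<^esub> x j) \<oplus> ((c j - q * c i) \<odot>\<^bsub>M\<^esub> x j \<oplus> R)"
    using assms x by (subst lc_remove[of _ i], simp_all)
      (subst lc_remove[of _ j], auto simp: R' Pi_iff)
  also have "\<dots> = c i \<odot>\<^bsub>M\<^esub> x i \<oplus> ((c i * q) \<odot>\<^bsub>M\<^esub> x j \<oplus> (c j - q * c i) \<odot>\<^bsub>M\<^esub> x j) \<oplus> R"
    using xi R by (simp add: smult_add_right smult_mult M.a_assoc)
  also have "(c i * q) \<odot>\<^bsub>M\<^esub> x j \<oplus> (c j - q * c i) \<odot>\<^bsub>M\<^esub> x j = c j \<odot>\<^bsub>M\<^esub> x j"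
    using xi by (simp flip: smult_add_left add: mult.commute)
  also have "c i \<odot>\<^bsub>M\<^esub> x i \<oplus> c j \<odot>\<^bsub>M\<^esub> x j \<oplus> R = lc I x c"
    using assms xi R unfolding R_def
    by (subst (2) lc_remove[of _ i], simp_all) (subst (2) lc_remove[of _ j], auto simp: Pi_iff M.a_assoc)
  finally show ?thesis .
qed

definition gen_mod_torsion :: "'i set \<Rightarrow> ('i \<Rightarrow> 'a) \<Rightarrow> bool" where
  "gen_mod_torsion I x \<longleftrightarrow> finite I \<and> x \<in> I \<rightarrow> carrier M \<and> (\<forall>m\<in>carrier M. \<exists>c. m \<sim> lc I x c)"

text \<open>A minimal generating family modulo torsion is independent: otherwise take, among all such
  families and relations, a nonzero coefficient of minimal degree. By Euclidean division it divides
  all other coefficients of its relation, so that one generator is redundant.\<close>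

lemma exists_coordinates:
  assumes "finitely_generated M"
  shows "\<exists>I (x :: nat \<Rightarrow> 'a). gen_mod_torsion I x \<and>
    (\<forall>c. lc I x c = \<zero> \<longrightarrow> (\<forall>i\<in>I. c i = 0))"
proof -
  obtain S where S: "finite S" "S \<subseteq> carrier M" "span S = carrier M"
    using assms unfolding finitely_generated_def by auto
  obtain e :: "nat \<Rightarrow> 'a" where e: "bij_betw e {0..<card S} S"
    using ex_bij_betw_nat_finite[OF S(1)] by auto
  have eS: "e ` {0..<card S} = S" using e by (rule bij_betw_imp_surj_on)
  have "gen_mod_torsion {0..<card S} e"
    unfolding gen_mod_torsion_def
  proof (intro conjI ballI)
    fix m assume "m \<in> carrier M"
    then have "m \<in> span (e ` {0..<card S})" using S eS by auto
    then obtain c where "m = lc {0..<card S} e c"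
      using span_eq_lc[of "{0..<card S}" e m] S eS by fastforce
    then show "\<exists>c. m \<sim> lc {0..<card S} e c" using tcong_refl by metis
  qed (use eS S in auto)
  then have "\<exists>n I (x :: nat \<Rightarrow> 'a). gen_mod_torsion I x \<and> card I = n" by blast
  then obtain n where n: "\<exists>I (x :: nat \<Rightarrow> 'a). gen_mod_torsion I x \<and> card I = n"
    and n_min: "\<And>m. m < n \<Longrightarrow> \<not> (\<exists>I (x :: nat \<Rightarrow> 'a). gen_mod_torsion I x \<and> card I = m)"
    using exists_least_iff[of "\<lambda>n. \<exists>I (x :: nat \<Rightarrow> 'a). gen_mod_torsion I x \<and> card I = n"] by metis
  obtain I and x\<^sub>0 :: "nat \<Rightarrow> 'a" where I: "gen_mod_torsion I x\<^sub>0" "card I = n" using n by auto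
  have finI: "finite I" using I by (auto simp: gen_mod_torsion_def)
  \<comment> \<open>The families vary and only the index set \<open>I\<close> of minimal size is
    fixed, because the division step replaces the family along with the relation.\<close>
  define bad where "bad d \<longleftrightarrow> (\<exists>(x :: nat \<Rightarrow> 'a) c. \<exists>i\<in>I. gen_mod_torsion I x \<and> lc I x c = \<zero> \<and>
    c i \<noteq> 0 \<and> degree (c i) = d)" for d
  have "\<not> bad d" for d
  proof
    assume "bad d"
    then obtain d where "bad d" and min: "\<And>d'. d' < d \<Longrightarrow> \<not> bad d'"
      using exists_least_iff[of bad] by metis
    then obtain x :: "nat \<Rightarrow> 'a" and c i where x: "gen_mod_torsion I x" "lc I x c = \<zero>"
      and i: "i \<in> I" "c i \<noteq> 0" "degree (c i) = d" unfolding bad_def by blast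
    have xI: "x \<in> I \<rightarrow> carrier M" using x by (auto simp: gen_mod_torsion_def)
    have dvd: "c i dvd c j" if j: "j \<in> I" for j
    proof (cases "j = i")
      case False
      define q where "q = c j div c i"
      define x' where "x' = x(i := x i \<oplus> q \<odot>\<^bsub>M\<^esub> x j)"
      define c' where "c' = c(j := c j - q * c i)"
      have sh: "lc I x' (d(j := d j - q * d i)) = lc I x d" for d
        unfolding x'_def by (rule lc_shift) (use finI i j False xI in auto)
      have "gen_mod_torsion I x'" unfolding gen_mod_torsion_def
      proof (intro conjI ballI)
        show "x' \<in> I \<rightarrow> carrier M" unfolding x'_def using xI i j by (auto simp: Pi_iff)
        fix m assume "m \<in> carrier M"
        then obtain d where "m \<sim> lc I x d" using x by (auto simp: gen_mod_torsion_def)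
        then show "\<exists>c. m \<sim> lc I x' c" using sh[of d] by metis
      qed (rule finI)
      moreover have "lc I x' c' = \<zero>" unfolding c'_def using sh x by simp
      ultimately have "c' j \<noteq> 0 \<Longrightarrow> bad (degree (c' j))" unfolding bad_def using j by blast
      moreover have "c' j = c j mod c i" by (simp add: c'_def q_def minus_div_mult_eq_mod)
      moreover have "c j mod c i \<noteq> 0 \<Longrightarrow> degree (c j mod c i) < d"
        using degree_mod_less'[of "c i" "c j"] i by simp
      ultimately have "c j mod c i = 0" using min by metis
      then show ?thesis by auto
    qed simp
    \<comment> \<open>Dividing the relation by \<open>c i\<close> gives a torsion element in which
      \<open>x i\<close> has coefficient 1. Subtracting multiples of \<open>y\<close> removes
      \<open>x i\<close> from any combination, against the minimal size of \<open>I\<close>.\<close>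
    define y where "y = lc I x (\<lambda>j. c j div c i)"
    have "c i \<odot>\<^bsub>M\<^esub> y = lc I x c"
      unfolding y_def lc_smult[OF xI, symmetric] using xI dvd by (intro lc_cong) auto
    then have y: "torsion y" unfolding torsion_def using x i by auto
    have yc: "y \<in> carrier M" unfolding y_def using xI by simp
    have "gen_mod_torsion (I - {i}) x" unfolding gen_mod_torsion_def
    proof (intro conjI ballI)
      fix m assume m: "m \<in> carrier M"
      then obtain a where a: "m \<sim> lc I x a" using x by (auto simp: gen_mod_torsion_def)
      let ?b = "\<lambda>j. a j + (- a i) * (c j div c i)"
      have "lc I x ?b = lc I x a \<oplus> (- a i) \<odot>\<^bsub>M\<^esub> y"
        unfolding lc_add[OF xI] y_def lc_smult[OF xI] ..
      moreover have "lc I x a \<oplus> (- a i) \<odot>\<^bsub>M\<^esub> y \<sim> lc I x a \<oplus> (- a i) \<odot>\<^bsub>M\<^esub> \<zero>"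
        using y xI yc by (intro tcong_add tcong_smult) (auto simp: tcong_zero tcong_refl)
      ultimately have "lc I x ?b \<sim> lc I x a" using xI by simp
      then have "m \<sim> lc I x ?b" 
        using tcong_trans[of m "lc I x a" "lc I x ?b"] a m xI tcong_sym by blast
      moreover have "lc I x ?b = lc (I - {i}) x ?b"
        using finI i xI by (subst lc_remove[of I i]) (auto simp: Pi_iff)
      ultimately have "m \<sim> lc (I - {i}) x ?b" by (simp only:)
      then show "\<exists>c. m \<sim> lc (I - {i}) x c" by (intro exI[of _ ?b])
    qed (use finI xI in auto)
    moreover have "card (I - {i}) < n" using I i finI by (metis card_Diff1_less)
    ultimately show False using n_min by blast
  qed
  then show ?thesis using I unfolding bad_def by (intro exI[of _ I] exI[of _ x\<^sub>0]) blast
qed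

end

section \<open>Free modules of finite rank\<close>

definition Hpow :: "nat set \<Rightarrow> ('k::field_char_0 poly, nat \<Rightarrow> 'k poly) module" where
  "Hpow I = \<lparr>carrier = {f. \<forall>i. i \<notin> I \<longrightarrow> f i = 0}, mult = undefined, one = undefined,
    zero = \<lambda>_. 0, add = \<lambda>f g i. f i + g i, smult = \<lambda>h f i. h * f i\<rparr>"

lemma Hpow_simps [simp]:
  "f \<in> carrier (Hpow I) \<longleftrightarrow> (\<forall>i. i \<notin> I \<longrightarrow> f i = 0)" "\<zero>\<^bsub>Hpow I\<^esub> = (\<lambda>_. 0)"
  "f \<oplus>\<^bsub>Hpow I\<^esub> g = (\<lambda>i. f i + g i)" "h \<odot>\<^bsub>Hpow I\<^esub> f = (\<lambda>i. h * f i)"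
  by (simp_all add: Hpow_def)

lemma H_module_Hpow: "H_module (Hpow I :: ('k::field_char_0 poly, nat \<Rightarrow> 'k poly) module)"
  unfolding H_module_def
proof (rule moduleI)
  show "cring (H :: 'k poly ring)" ..
  show "abelian_group (Hpow I :: ('k poly, nat \<Rightarrow> 'k poly) module)"
  proof (rule abelian_groupI)
    fix f :: "nat \<Rightarrow> 'k poly" assume "f \<in> carrier (Hpow I)"
    then show "\<exists>g\<in>carrier (Hpow I). g \<oplus>\<^bsub>Hpow I\<^esub> f = \<zero>\<^bsub>Hpow I\<^esub>"
      by (intro bexI[of _ "\<lambda>i. - f i"]) auto
  qed (auto simp: add_ac)
qed (auto simp: algebra_simps)

interpretation Hpow: H_module "Hpow I" for I
  by (rule H_module_Hpow)

lemma Hpow_finsum: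
  "f \<in> A \<rightarrow> carrier (Hpow I) \<Longrightarrow> finsum (Hpow I) f A = (\<lambda>i. \<Sum>a\<in>A. f a i)"
proof (induction A rule: infinite_finite_induct)
  case (insert a A)
  have "finsum (Hpow I) f (insert a A) = f a \<oplus>\<^bsub>Hpow I\<^esub> finsum (Hpow I) f A"
    using insert by (intro Hpow.M.finsum_insert) (auto simp del: Hpow_simps)
  then show ?case using insert by auto
qed (simp_all add: Hpow.M.finsum_infinite)

definition Hunit :: "nat \<Rightarrow> nat \<Rightarrow> 'k::field_char_0 poly" where
  "Hunit i = (\<lambda>j. if j = i then 1 else 0)"

lemma inj_Hunit: "inj Hunit"
  by (rule injI) (metis Hunit_def zero_neq_one)

lemma Hpow_basis:
  assumes "finite I"
  shows "H_basis (Hpow I) (Hunit ` I :: (nat \<Rightarrow> 'k::field_char_0 poly) set)"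
  unfolding H_basis_def
proof (intro conjI)
  let ?M = "Hpow I :: ('k poly, nat \<Rightarrow> 'k poly) module"
  show sub: "Hunit ` I \<subseteq> carrier ?M" by (auto simp: Hunit_def)
  have at: "(\<Sum>v\<in>Hunit ` I. a v * v i) = a (Hunit i)" if "i \<in> I" for a :: "(nat \<Rightarrow> 'k poly) \<Rightarrow> 'k poly" and i
  proof -
    have "(\<Sum>v\<in>Hunit ` I. a v * v i) = (\<Sum>j\<in>I. a (Hunit j) * (Hunit j i :: 'k poly))"
      using inj_Hunit by (subst sum.reindex) (auto intro: inj_on_subset)
    also have "\<dots> = (\<Sum>j\<in>I. if j = i then a (Hunit i) else 0)"
      by (rule sum.cong) (auto simp: Hunit_def)
    finally show ?thesis using assms that by simp
  qed
  have eval: "Hpow.lincomb I a (Hunit ` I) = (\<lambda>i. \<Sum>v\<in>Hunit ` I. a v * (v i :: 'k poly))" for a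
    unfolding Hpow.lincomb_def by (subst Hpow_finsum) (auto simp: Hunit_def)
  show "Hpow.lin_indpt I (Hunit ` I :: (nat \<Rightarrow> 'k poly) set)"
  proof (rule Hpow.finite_lin_indpt2)
    fix a :: "(nat \<Rightarrow> 'k poly) \<Rightarrow> 'k poly"
    assume "Hpow.lincomb I a (Hunit ` I) = \<zero>\<^bsub>Hpow I\<^esub>"
    then have z: "(\<Sum>v\<in>Hunit ` I. a v * v i) = 0" for i
      unfolding eval by (auto dest: fun_cong)
    show "\<forall>v\<in>Hunit ` I. a v = \<zero>\<^bsub>H\<^esub>"
    proof
      fix v :: "nat \<Rightarrow> 'k poly" assume "v \<in> Hunit ` I"
      then obtain i where "i \<in> I" "v = Hunit i" by blast
      then show "a v = \<zero>\<^bsub>H\<^esub>" using at[of i a] z[of i] by simp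
    qed
  qed (use assms sub in auto)
  show "Hpow.span I (Hunit ` I) = carrier ?M"
  proof (intro equalityI subsetI)
    fix f assume f: "f \<in> carrier ?M"
    have "f = Hpow.lincomb I (\<lambda>v. f (inv_into UNIV Hunit v)) (Hunit ` I)"
    proof
      fix i
      show "f i = Hpow.lincomb I (\<lambda>v. f (inv_into UNIV Hunit v)) (Hunit ` I) i"
      proof (cases "i \<in> I")
        case True
        moreover have "inj (Hunit :: nat \<Rightarrow> nat \<Rightarrow> 'k poly)" by (rule inj_Hunit)
        ultimately show ?thesis unfolding eval using at by (simp add: inv_f_f)
      next
        case False
        then have "Hunit j i = (0 :: 'k poly)" if "j \<in> I" for j using that by (auto simp: Hunit_def)
        then show ?thesis unfolding eval using False f by (auto intro!: sum.neutral)
      qed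
    qed
    then show "f \<in> Hpow.span I (Hunit ` I)" unfolding Hpow.span_def using assms by auto
  qed (use Hpow.span_in_carrier sub in blast)
qed

lemma Hpow_free: "finite I \<Longrightarrow> free_module (Hpow I)"
  unfolding free_module_def using Hpow_basis by blast

lemma Hpow_fg: "finite I \<Longrightarrow> finitely_generated (Hpow I)"
  unfolding finitely_generated_def using Hpow_basis[of I] unfolding H_basis_def
  by (meson finite_imageI)

lemma module_homI:
  assumes "\<And>x. x \<in> carrier M \<Longrightarrow> f x \<in> carrier N"
    "\<And>x y. x \<in> carrier M \<Longrightarrow> y \<in> carrier M \<Longrightarrow> f (x \<oplus>\<^bsub>M\<^esub> y) = f x \<oplus>\<^bsub>N\<^esub> f y"
    "\<And>h x. x \<in> carrier M \<Longrightarrow> f (h \<odot>\<^bsub>M\<^esub> x) = h \<odot>\<^bsub>N\<^esub> f x"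
  shows "f \<in> LinearCombinations.module_hom H M N"
  using assms by (auto simp: LinearCombinations.module_hom_def)

locale H_hom = M: H_module M + N: H_module N
  for M :: "('k::field_char_0 poly, 'a, 'x) module_scheme"
    and N :: "('k poly, 'b, 'y) module_scheme" +
  fixes f :: "'a \<Rightarrow> 'b"
  assumes hom: "f \<in> LinearCombinations.module_hom H M N"
begin

lemma closed [simp, intro]: "x \<in> carrier M \<Longrightarrow> f x \<in> carrier N"
  and add: "x \<in> carrier M \<Longrightarrow> y \<in> carrier M \<Longrightarrow> f (x \<oplus>\<^bsub>M\<^esub> y) = f x \<oplus>\<^bsub>N\<^esub> f y"
  and smult: "x \<in> carrier M \<Longrightarrow> f (h \<odot>\<^bsub>M\<^esub> x) = h \<odot>\<^bsub>N\<^esub> f x"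
  using hom by (auto simp: LinearCombinations.module_hom_def)

lemma zero [simp]: "f \<zero>\<^bsub>M\<^esub> = \<zero>\<^bsub>N\<^esub>"
  using smult[of "\<zero>\<^bsub>M\<^esub>" 0] by simp

lemma neg: "x \<in> carrier M \<Longrightarrow> f (\<ominus>\<^bsub>M\<^esub> x) = \<ominus>\<^bsub>N\<^esub> f x"
  using smult[of x "- 1"] M.smult_uminus[of x 1] N.smult_uminus[of "f x" 1] by simp

lemma diff: "x \<in> carrier M \<Longrightarrow> y \<in> carrier M \<Longrightarrow> f (x \<ominus>\<^bsub>M\<^esub> y) = f x \<ominus>\<^bsub>N\<^esub> f y"
  by (simp add: a_minus_def add neg)

lemma finsum: "t \<in> A \<rightarrow> carrier M \<Longrightarrow> f (finsum M t A) = finsum N (\<lambda>s. f (t s)) A"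
  by (induction A rule: infinite_finite_induct)
    (auto simp: add Pi_iff M.M.finsum_infinite N.M.finsum_infinite)

end

text \<open>Generation modulo torsion and independence make the coefficients of each element exist
  uniquely, so that choosing them is linear. Up to isomorphism \<open>co\<close> is the quotient map
  by the torsion, and \<open>lc I x\<close> is a section of it.\<close>

lemma (in H_module) coordinates:
  assumes "finitely_generated M"
  shows "\<exists>I (x :: nat \<Rightarrow> 'a) co. finite I \<and> x \<in> I \<rightarrow> carrier M \<and> H_hom M (Hpow I) co \<and>
    (\<forall>m\<in>carrier M. m \<sim> lc I x (co m)) \<and> (\<forall>m\<in>carrier M. co m = (\<lambda>_. 0) \<longleftrightarrow> torsion m) \<and>
    (\<forall>f\<in>carrier (Hpow I). co (lc I x f) = f)"
proof -
  obtain I and x :: "nat \<Rightarrow> 'a" where gen: "gen_mod_torsion I x"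
    and indep: "\<And>c i. lc I x c = \<zero> \<Longrightarrow> i \<in> I \<Longrightarrow> c i = 0"
    using exists_coordinates[OF assms] by blast
  have finI: "finite I" and xI: "x \<in> I \<rightarrow> carrier M" using gen by (auto simp: gen_mod_torsion_def)
  define good where "good m c \<longleftrightarrow> c \<in> carrier (Hpow I) \<and> m \<sim> lc I x c" for m c
  define co where "co m = (SOME c. good m c)" for m
  have good_ex: "\<exists>c. good m c" if m: "m \<in> carrier M" for m
  proof -
    obtain c where c: "m \<sim> lc I x c" using gen m by (auto simp: gen_mod_torsion_def)
    have "lc I x (\<lambda>i. if i \<in> I then c i else 0) = lc I x c" by (rule lc_cong) (use xI in auto)
    with c show ?thesis unfolding good_def by (intro exI[of _ "\<lambda>i. if i \<in> I then c i else 0"]) auto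
  qed
  have co: "good m (co m)" if "m \<in> carrier M" for m
    unfolding co_def using good_ex[OF that] by (rule someI_ex)
  have uniq: "c = d" if "good m c" "good m d" "m \<in> carrier M" for m c d
  proof
    fix i
    have "lc I x c \<sim> m" using that unfolding good_def by (metis tcong_sym)
    then have "lc I x c \<sim> lc I x d"
      by (rule tcong_trans[rotated 3]) (use that xI in \<open>auto simp: good_def\<close>)
    then obtain h where h: "h \<noteq> 0" "h \<odot>\<^bsub>M\<^esub> lc I x c = h \<odot>\<^bsub>M\<^esub> lc I x d"
      unfolding tcong_def by auto
    have "lc I x (\<lambda>i. h * c i + (- h) * d i) = h \<odot>\<^bsub>M\<^esub> lc I x c \<oplus> (- h) \<odot>\<^bsub>M\<^esub> lc I x d"
      by (simp only: lc_add[OF xI] lc_smult[OF xI])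
    also have "\<dots> = \<zero>" using h xI by (simp add: smult_uminus M.r_neg)
    finally have z: "lc I x (\<lambda>i. h * c i + (- h) * d i) = \<zero>" .
    show "c i = d i"
    proof (cases "i \<in> I")
      case True
      then show ?thesis using indep[OF z True] h by simp
    next
      case False
      then show ?thesis using that by (simp add: good_def)
    qed
  qed
  have coI: "co m = c" if "good m c" "m \<in> carrier M" for m c
    using uniq[OF co[OF that(2)] that(1)] that by simp
  have co': "co m \<in> carrier (Hpow I)" "m \<sim> lc I x (co m)" if "m \<in> carrier M" for m
    using co[OF that] by (auto simp: good_def)
  have "H_hom M (Hpow I) co"
  proof (unfold_locales)
    show "co \<in> LinearCombinations.module_hom H M (Hpow I)"
    proof (rule module_homI)
      fix m n assume mn: "m \<in> carrier M" "n \<in> carrier M"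
      show "co (m \<oplus> n) = co m \<oplus>\<^bsub>Hpow I\<^esub> co n"
      proof (rule coI)
        show "good (m \<oplus> n) (co m \<oplus>\<^bsub>Hpow I\<^esub> co n)"
          unfolding good_def using co' mn xI
          by (auto simp: lc_add[OF xI] intro!: tcong_add)
      qed (use mn in auto)
    next
      fix h m assume m: "m \<in> carrier M"
      show "co (h \<odot>\<^bsub>M\<^esub> m) = h \<odot>\<^bsub>Hpow I\<^esub> co m"
      proof (rule coI)
        show "good (h \<odot>\<^bsub>M\<^esub> m) (h \<odot>\<^bsub>Hpow I\<^esub> co m)"
          unfolding good_def using co' m xI
          by (auto simp: lc_smult[OF xI] intro!: tcong_smult)
      qed (use m in auto)
    qed (use co' in blast)
  qed
  moreover have "co m = (\<lambda>_. 0) \<longleftrightarrow> torsion m" if m: "m \<in> carrier M" for m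
  proof -
    have z: "lc I x (\<lambda>_. 0) = \<zero>" using xI by (rule lc_zero) auto
    show ?thesis
    proof
      assume "co m = (\<lambda>_. 0)"
      then show "torsion m" using co'(2)[OF m] z by (simp add: tcong_zero)
    next
      assume "torsion m"
      then have "good m (\<lambda>_. 0)" unfolding good_def using z by (simp add: tcong_zero)
      then show "co m = (\<lambda>_. 0)" using coI m by blast
    qed
  qed
  moreover have "co (lc I x f) = f" if "f \<in> carrier (Hpow I)" for f
    using that xI by (intro coI) (auto simp: good_def tcong_refl)
  ultimately show ?thesis using finI xI co'(2)
    by (intro exI[of _ I] exI[of _ x] exI[of _ co]) blast
qed

section \<open>Passing to a free module\<close>

sublocale conformal_algebra \<subseteq> H_module C by unfold_locales

sublocale conformal_representation \<subseteq> MH: H_module M by unfold_locales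

context conformal_representation
begin

lemma act_zero_right: "a \<in> carrier L \<Longrightarrow> act n a \<zero>\<^bsub>M\<^esub> = \<zero>\<^bsub>M\<^esub>"
  using act_scalar_right[of a "\<zero>\<^bsub>M\<^esub>" n 0] act_closed[of a "\<zero>\<^bsub>M\<^esub>" n] by simp

lemma act_neg_right:
  "a \<in> carrier L \<Longrightarrow> v \<in> carrier M \<Longrightarrow> act n a (\<ominus>\<^bsub>M\<^esub> v) = \<ominus>\<^bsub>M\<^esub> act n a v"
  using act_add_right[of a "\<ominus>\<^bsub>M\<^esub> v" v n] act_zero_right[of a n] act_closed[of a _ n]
  by (intro M.M.minus_equality[symmetric]) (auto simp: M.M.l_neg)

lemma act_diff_right:
  "a \<in> carrier L \<Longrightarrow> v \<in> carrier M \<Longrightarrow> w \<in> carrier M \<Longrightarrow>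
    act n a (v \<ominus>\<^bsub>M\<^esub> w) = act n a v \<ominus>\<^bsub>M\<^esub> act n a w"
  by (simp add: a_minus_def act_add_right act_neg_right)

text \<open>For the generating function a_\<lambda> v of the \<open>act n a v\<close> one has
  a_\<lambda>(h(D) v) = h(D + \<lambda>) a_\<lambda> v; the claim compares top coefficients in
  \<lambda>. The Pochhammer symbol is (p + d)! / p!, collected from the indices p + 1, ..., p +
  d.\<close>

lemma act_top:
  assumes a: "a \<in> carrier L" and v: "v \<in> carrier M" and p: "\<And>n. n > p \<Longrightarrow> act n a v = \<zero>\<^bsub>M\<^esub>"
  shows "degree h \<le> d \<Longrightarrow>
    act (p + d) a (h \<odot>\<^bsub>M\<^esub> v) = [:coeff h d * pochhammer (of_nat (Suc p)) d:] \<odot>\<^bsub>M\<^esub> act p a v"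
proof (induction h arbitrary: d)
  case 0
  then show ?case using a v act_zero_right act_closed by simp
next
  case (pCons c h)
  note cl = act_closed[OF a] v
  show ?case
  proof (cases d)
    case 0
    then have "h = 0" using pCons.prems by (metis degree_pCons_eq le_0_eq nat.distinct(1))
    then show ?thesis using 0 act_scalar_right[OF a v] by simp
  next
    case (Suc e)
    have deg: "degree h \<le> e" using pCons.prems Suc by (cases "h = 0") auto
    \<comment> \<open>The induction hypothesis at \<open>d\<close>, above the degree of
      \<open>h\<close>, has coefficient 0 and removes the first term of the D-rule. For this the
      lemma admits \<open>d\<close> larger than the degree.\<close>
    have z: "act (p + d) a (h \<odot>\<^bsub>M\<^esub> v) = \<zero>\<^bsub>M\<^esub>"
      using pCons.IH[of d] deg Suc cl by (simp add: coeff_eq_0)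
    have "act (p + d) a (pCons c h \<odot>\<^bsub>M\<^esub> v) =
        act (p + d) a ([:c:] \<odot>\<^bsub>M\<^esub> v) \<oplus>\<^bsub>M\<^esub> act (p + d) a ([:0, 1:] \<odot>\<^bsub>M\<^esub> (h \<odot>\<^bsub>M\<^esub> v))"
      unfolding MH.smult_pCons[OF v, of c h] using a v by (intro act_add_right) auto
    also have "act (p + d) a ([:c:] \<odot>\<^bsub>M\<^esub> v) = \<zero>\<^bsub>M\<^esub>"
      using act_scalar_right[OF a v, of "p + d" c] p[of "p + d"] Suc by simp
    also have "act (p + d) a ([:0, 1:] \<odot>\<^bsub>M\<^esub> (h \<odot>\<^bsub>M\<^esub> v)) =
        of_nat (p + d) \<odot>\<^bsub>M\<^esub> act (p + e) a (h \<odot>\<^bsub>M\<^esub> v)"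
      using act_D_right[OF a, of "h \<odot>\<^bsub>M\<^esub> v" "p + d"] z Suc cl by simp
    also have "act (p + e) a (h \<odot>\<^bsub>M\<^esub> v) =
        [:coeff h e * pochhammer (of_nat (Suc p)) e:] \<odot>\<^bsub>M\<^esub> act p a v"
      by (rule pCons.IH[OF deg])
    also have "of_nat (p + d) \<odot>\<^bsub>M\<^esub> \<dots> =
        [:coeff (pCons c h) d * pochhammer (of_nat (Suc p)) d:] \<odot>\<^bsub>M\<^esub> act p a v"
      using cl Suc by (simp flip: MH.smult_mult add: of_nat_poly pochhammer_Suc algebra_simps)
    finally show ?thesis using cl by simp
  qed
qed

text \<open>At the highest index \<open>p\<close> with \<open>act p a v\<close> nonzero, a relation
  h v = 0 yields by \<open>act_top\<close> that a scalar multiple of \<open>act p a v\<close>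
  vanishes. The scalar is the leading coefficient of h times a Pochhammer symbol, which is nonzero
  in characteristic 0.\<close>

lemma act_torsion:
  assumes a: "a \<in> carrier L" and v: "v \<in> carrier M" and t: "MH.torsion v"
  shows "act n a v = \<zero>\<^bsub>M\<^esub>"
proof (rule ccontr)
  assume n: "act n a v \<noteq> \<zero>\<^bsub>M\<^esub>"
  let ?S = "{n. act n a v \<noteq> \<zero>\<^bsub>M\<^esub>}"
  define p where "p = Max ?S"
  have fin: "finite ?S" using act_local[OF a v] .
  have p: "act p a v \<noteq> \<zero>\<^bsub>M\<^esub>" using Max_in[OF fin] n unfolding p_def by auto
  have z: "act m a v = \<zero>\<^bsub>M\<^esub>" if "m > p" for m
    using that Max_ge[OF fin, of m] unfolding p_def by force
  obtain h where h: "h \<noteq> 0" "h \<odot>\<^bsub>M\<^esub> v = \<zero>\<^bsub>M\<^esub>" using t unfolding MH.torsion_def by auto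
  define r where "r = coeff h (degree h) * pochhammer (of_nat (Suc p)) (degree h)"
  have "pochhammer (of_nat (Suc p) :: 'k) (degree h) \<noteq> 0"
    unfolding pochhammer_eq_0_iff eq_neg_iff_add_eq_0 of_nat_add[symmetric] of_nat_eq_0_iff by simp
  then have r: "r \<noteq> 0" unfolding r_def using h by simp
  have "[:r:] \<odot>\<^bsub>M\<^esub> act p a v = \<zero>\<^bsub>M\<^esub>"
    using act_top[OF a v z, where h = h and d = "degree h"] h a act_zero_right unfolding r_def by simp
  then have "([:inverse r:] * [:r:]) \<odot>\<^bsub>M\<^esub> act p a v = \<zero>\<^bsub>M\<^esub>"
    using act_closed[OF a v] by (simp only: MH.smult_mult MH.smult_zero)
  then show False using p r act_closed[OF a v] by (simp flip: one_pCons)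
qed

lemma act_tcong:
  assumes "a \<in> carrier L" "v \<in> carrier M" "w \<in> carrier M" "MH.tcong v w"
  shows "act n a v = act n a w"
proof -
  have "act n a (v \<ominus>\<^bsub>M\<^esub> w) = \<zero>\<^bsub>M\<^esub>"
    using assms by (intro act_torsion) (auto simp: MH.tcong_diff)
  then show ?thesis using assms act_closed by (simp add: act_diff_right MH.diff_eq_zero)
qed

text \<open>The action factors through the quotient by the torsion submodule, which is free.\<close>

theorem free_representation:
  assumes fg: "finitely_generated M"
    and faith: "\<And>a. a \<in> carrier L \<Longrightarrow> a \<noteq> \<zero>\<^bsub>L\<^esub> \<Longrightarrow>
      \<exists>n. \<exists>v\<in>carrier M. \<not> MH.torsion (act n a v)"
  shows "\<exists>(N :: ('k poly, nat \<Rightarrow> 'k poly) module) act'.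
    conformal_representation L N act' \<and> finitely_generated N \<and> free_module N \<and>
    faithful_action L N act'"
proof -
  obtain I and x :: "nat \<Rightarrow> 'm" and co where I: "finite I" "x \<in> I \<rightarrow> carrier M"
    and hom: "H_hom M (Hpow I) co"
    and co_cong: "\<And>m. m \<in> carrier M \<Longrightarrow> MH.tcong m (MH.lc I x (co m))"
    and co_tors: "\<And>m. m \<in> carrier M \<Longrightarrow> co m = (\<lambda>_. 0) \<longleftrightarrow> MH.torsion m"
    and co_lc: "\<And>f. f \<in> carrier (Hpow I) \<Longrightarrow> co (MH.lc I x f) = f"
    using MH.coordinates[OF fg] by blast
  interpret co: H_hom M "Hpow I" co by (rule hom)
  define act' where "act' n a f = co (act n a (MH.lc I x f))" for n a f
  \<comment> \<open>Independence of the lift: congruent vectors are acted on equally by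
    \<open>act_tcong\<close>, so any preimage under \<open>co\<close> may be used. Each axiom then
    descends from \<open>M\<close> by lifting its vectors.\<close>
  have act_co: "act' n a (co m) = co (act n a m)" if "a \<in> carrier L" "m \<in> carrier M" for n a m
    using act_tcong[OF that(1,2) _ co_cong[OF that(2)], of n] I unfolding act'_def by simp
  have lift: "\<exists>m\<in>carrier M. f = co m" if "f \<in> carrier (Hpow I)" for f
    using co_lc[OF that] I by (intro bexI[of _ "MH.lc I x f"]) auto
  note cl = act_closed L.smultH_closed L.nprod_closed
  let ?N = "Hpow I :: ('k poly, nat \<Rightarrow> 'k poly) module"
  have "conformal_representation L ?N act'"
  proof (unfold_locales, goal_cases)
    case (1 a f n)
    then show ?case using lift[OF 1(2)] act_co cl by (metis co.closed)
  next
    case (2 a a' f n)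
    then obtain m where m: "m \<in> carrier M" "f = co m" using lift by blast
    then show ?case using 2 cl by (simp only: act_co act_add_left co.add L.M.a_closed)
  next
    case (3 a f f' n)
    then obtain m m' where m: "m \<in> carrier M" "f = co m" "m' \<in> carrier M" "f' = co m'"
      using lift by meson
    then show ?case using 3 cl by (simp only: act_co act_add_right co.add[symmetric] M.M.a_closed)
  next
    case (4 a f n c)
    then obtain m where m: "m \<in> carrier M" "f = co m" using lift by blast
    then show ?case using 4 cl by (simp only: act_co act_scalar_left co.smult)
  next
    case (5 a f n c)
    then obtain m where m: "m \<in> carrier M" "f = co m" using lift by blast
    then show ?case using 5 cl by (simp only: act_co act_scalar_right co.smult[symmetric] MH.smultH)
  next
    case (6 a f)
    then obtain m where m: "m \<in> carrier M" "f = co m" using lift by blast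
    have "{n. act' n a f \<noteq> \<zero>\<^bsub>?N\<^esub>} \<subseteq> {n. act n a m \<noteq> \<zero>\<^bsub>M\<^esub>}"
      using m 6 act_co co.zero by auto
    then show ?case using act_local[OF 6(1) m(1)] finite_subset by blast
  next
    case (7 a f n)
    then obtain m where m: "m \<in> carrier M" "f = co m" using lift by blast
    then show ?case using 7 cl by (simp only: act_co act_D_left co.smult)
  next
    case (8 a f n)
    then obtain m where m: "m \<in> carrier M" "f = co m" using lift by blast
    then show ?case using 8 cl
      by (simp only: act_co act_D_right co.smult[symmetric] co.add[symmetric] MH.smultH)
  next
    case (9 a b f n m)
    then obtain v where v: "v \<in> carrier M" "f = co v" using lift by blast
    have fs: "(\<lambda>s. of_nat (n choose s) \<odot>\<^bsub>M\<^esub> act (m + s) (nprod L (n - s) a b) v) \<in> {..n} \<rightarrow> carrier M"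
      using 9 v cl by auto
    have "act' n a (act' m b f) \<ominus>\<^bsub>?N\<^esub> act' m b (act' n a f) =
        co (act n a (act m b v) \<ominus>\<^bsub>M\<^esub> act m b (act n a v))"
      using 9 v cl by (simp only: act_co co.diff)
    also have "\<dots> = (\<Oplus>\<^bsub>?N\<^esub> s\<in>{..n}. of_nat (n choose s) \<odot>\<^bsub>?N\<^esub> act' (m + s) (nprod L (n - s) a b) f)"
      unfolding act_commutator[OF 9(1,2) v(1)] co.finsum[OF fs]
      using 9 v cl by (intro Hpow.M.finsum_cong') (auto simp: act_co co.smult simp del: Hpow_simps)
    finally show ?case .
  qed
  moreover have "faithful_action L ?N act'"
    unfolding faithful_action_def
  proof (intro ballI impI)
    fix a assume a: "a \<in> carrier L" and z: "\<forall>n. \<forall>v\<in>carrier ?N. act' n a v = \<zero>\<^bsub>?N\<^esub>"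
    show "a = \<zero>\<^bsub>L\<^esub>"
    proof (rule ccontr)
      assume "a \<noteq> \<zero>\<^bsub>L\<^esub>"
      from faith[OF a this] obtain n v where v: "v \<in> carrier M" "\<not> MH.torsion (act n a v)" by auto
      have "co (act n a v) = \<zero>\<^bsub>?N\<^esub>" using z act_co[OF a v(1), of n] co.closed[OF v(1)] by metis
      then show False using co_tors v act_closed[OF a v(1)] by simp
    qed
  qed
  ultimately show ?thesis using I Hpow_free Hpow_fg by blast
qed

end

section \<open>Identities in associative conformal algebras\<close>

text \<open>Trinomial revision extracts the factor \<open>m choose j\<close> and leaves an
  alternating row sum of binomial coefficients. This inverts the associativity formula in
  \<open>nprod_assoc_right\<close>.\<close>

lemma sum_alternating_choose_mult:
  assumes "j \<le> m"
  shows "(\<Sum>i\<le>m. if i \<le> j then (-1) ^ i * of_nat (m choose i) * of_nat ((m - i) choose (j - i)) else 0) =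
    (if j = 0 then 1 else 0 :: 'a::comm_ring_1)"
proof -
  have "(\<Sum>i\<le>m. if i \<le> j then (-1) ^ i * of_nat (m choose i) * of_nat ((m - i) choose (j - i)) else 0) =
      (\<Sum>i\<le>j. (-1) ^ i * of_nat (m choose i) * of_nat ((m - i) choose (j - i)) :: 'a)"
    using assms by (intro sum.mono_neutral_cong_right) auto
  also have "\<dots> = (\<Sum>i\<le>j. of_nat (m choose j) * ((-1) ^ i * of_nat (j choose i)))"
  proof (rule sum.cong[OF refl])
    fix i assume "i \<in> {..j}"
    then have "(m choose j) * (j choose i) = (m choose i) * ((m - i) choose (j - i))"
      using assms by (intro choose_mult) auto
    then have "of_nat (m choose j) * of_nat (j choose i) =
        (of_nat (m choose i) * of_nat ((m - i) choose (j - i)) :: 'a)"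
      by (metis of_nat_mult)
    then show "(-1) ^ i * of_nat (m choose i) * of_nat ((m - i) choose (j - i)) =
        of_nat (m choose j) * ((-1) ^ i * of_nat (j choose i) :: 'a)"
      by (metis mult.assoc mult.left_commute)
  qed
  also have "\<dots> = of_nat (m choose j) * (\<Sum>i\<le>j. (-1) ^ i * of_nat (j choose i))"
    by (simp add: sum_distrib_left)
  also have "\<dots> = (if j = 0 then 1 else 0)"
    using choose_alternating_sum[of j, where ?'a = 'a] by auto
  finally show ?thesis .
qed

text \<open>Coefficients of the identity
  \<open>(1 + x)\<^sup>m ((1 + x) - x)\<^sup>n = (1 + x)\<^sup>m\<close>.\<close>

lemma sum_choose_difference:
  "(\<Sum>s\<le>n. if n - s \<le> j then of_nat (n choose s) * (-1) ^ (n - s) * of_nat ((m + s) choose (j + s - n)) else 0) =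
    (of_nat (m choose j) :: 'a::comm_ring_1)"
proof -
  have co: "coeff ([:1, 1:] ^ N) i = (of_nat (N choose i) :: 'a)" for N i
  proof (cases "i \<le> N")
    case False
    moreover have "degree ([:1, 1:] ^ N :: 'a poly) = N" by (rule degree_linear_power)
    ultimately have "degree ([:1, 1:] ^ N :: 'a poly) < i" by linarith
    then show ?thesis using False by (simp add: coeff_eq_0 binomial_eq_0)
  qed (simp add: coeff_linear_poly_power)
  have "(\<Sum>s\<le>n. of_nat (n choose s) * [:1, 1:] ^ s * (monom (-1) 1) ^ (n - s)) = ([:1, 1:] + monom (-1) 1 :: 'a poly) ^ n"
    by (rule binomial_ring[symmetric])
  also have "[:1, 1:] + monom (-1) 1 = (1 :: 'a poly)" by (simp add: monom_altdef)
  finally have "[:1, 1:] ^ m = [:1, 1:] ^ m * (\<Sum>s\<le>n. of_nat (n choose s) * [:1, 1:] ^ s * (monom (-1) 1 :: 'a poly) ^ (n - s))"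
    by simp
  also have "\<dots> = (\<Sum>s\<le>n. monom (of_nat (n choose s) * (-1) ^ (n - s)) (n - s) * [:1, 1:] ^ (m + s))"
    unfolding sum_distrib_left
  proof (rule sum.cong[OF refl])
    fix s
    have m: "monom (of_nat c * r) k = of_nat c * monom r k" for c k and r :: 'a
      by (simp add: of_nat_poly smult_monom)
    show "[:1, 1:] ^ m * (of_nat (n choose s) * [:1, 1:] ^ s * monom (-1) 1 ^ (n - s)) =
        monom (of_nat (n choose s) * (-1) ^ (n - s)) (n - s) * ([:1, 1:] ^ (m + s) :: 'a poly)"
      unfolding monom_power power_add mult_1 m by (simp only: mult_ac)
  qed
  finally have "coeff ([:1, 1:] ^ m) j =
      coeff (\<Sum>s\<le>n. monom (of_nat (n choose s) * (-1) ^ (n - s)) (n - s) * [:1, 1:] ^ (m + s) :: 'a poly) j"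
    by (rule arg_cong)
  then show ?thesis
    unfolding coeff_sum co coeff_monom_mult by (auto intro!: sum.cong)
qed

context H_module
begin

lemma lc_zero_fun: "x \<in> J \<rightarrow> carrier M \<Longrightarrow> lc J x (\<lambda>_. 0) = \<zero>"
  by (rule lc_zero) auto

lemma lc_cong_nonzero:
  assumes "x \<in> J \<rightarrow> carrier M" "\<And>j. j \<in> J \<Longrightarrow> x j \<noteq> \<zero> \<Longrightarrow> c j = d j"
  shows "lc J x c = lc J x d"
  unfolding lc_def
proof (rule M.finsum_cong')
  show "c j \<odot>\<^bsub>M\<^esub> x j = d j \<odot>\<^bsub>M\<^esub> x j" if "j \<in> J" for j
    using assms(2)[OF that] by (cases "x j = \<zero>") auto
qed (use assms in auto)

text \<open>Identities between iterated products are proved below by writing both sides over one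
  family \<open>x\<close> on a common index set; then only sums of coefficients in \<open>H\<close>
  have to be compared.\<close>

lemma finsum_collect:
  assumes "finite A" "finite J" "x \<in> J \<rightarrow> carrier M" "\<And>i. i \<in> A \<Longrightarrow> g i \<in> J"
  shows "(\<Oplus>i\<in>A. d i \<odot>\<^bsub>M\<^esub> x (g i)) = lc J x (\<lambda>j. \<Sum>i\<in>A. if g i = j then d i else 0)"
  using assms(1,4)
proof (induction A rule: finite_induct)
  case empty
  then show ?case using lc_zero_fun[OF assms(3)] by simp
next
  case (insert a A)
  have xg: "x (g i) \<in> carrier M" if "i \<in> insert a A" for i using assms(3) insert.prems that by blast
  have "(\<Oplus>i\<in>insert a A. d i \<odot>\<^bsub>M\<^esub> x (g i)) =
      d a \<odot>\<^bsub>M\<^esub> x (g a) \<oplus> (\<Oplus>i\<in>A. d i \<odot>\<^bsub>M\<^esub> x (g i))"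
    using insert.hyps xg by (intro M.finsum_insert) auto
  also have "d a \<odot>\<^bsub>M\<^esub> x (g a) = lc J x (\<lambda>j. if g a = j then d a else 0)"
    using lc_unit[OF assms(2) _ assms(3), of "g a" "d a"] insert.prems by (simp add: eq_commute)
  also have "(\<Oplus>i\<in>A. d i \<odot>\<^bsub>M\<^esub> x (g i)) = lc J x (\<lambda>j. \<Sum>i\<in>A. if g i = j then d i else 0)"
    using insert by simp
  finally show ?case
    using insert.hyps by (simp add: lc_add[OF assms(3), symmetric])
qed

lemma lc_sum:
  assumes "finite A" "x \<in> J \<rightarrow> carrier M"
  shows "(\<Oplus>s\<in>A. lc J x (c s)) = lc J x (\<lambda>j. \<Sum>s\<in>A. c s j)"
  using assms(1)
proof (induction A rule: finite_induct)
  case empty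
  then show ?case using lc_zero_fun[OF assms(2)] by simp
next
  case (insert a A)
  then show ?case
    using assms(2) by (simp add: lc_add[symmetric])
qed

lemma finsum_collect2:
  assumes "finite A" "\<And>s. s \<in> A \<Longrightarrow> finite (B s)" "finite J" "x \<in> J \<rightarrow> carrier M"
    "\<And>s i. s \<in> A \<Longrightarrow> i \<in> B s \<Longrightarrow> g s i \<in> J"
  shows "(\<Oplus>s\<in>A. h s \<odot>\<^bsub>M\<^esub> (\<Oplus>i\<in>B s. d s i \<odot>\<^bsub>M\<^esub> x (g s i))) =
    lc J x (\<lambda>j. \<Sum>s\<in>A. \<Sum>i\<in>B s. if g s i = j then h s * d s i else 0)"
proof -
  have "(\<Oplus>s\<in>A. h s \<odot>\<^bsub>M\<^esub> (\<Oplus>i\<in>B s. d s i \<odot>\<^bsub>M\<^esub> x (g s i))) =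
      (\<Oplus>s\<in>A. lc J x (\<lambda>j. h s * (\<Sum>i\<in>B s. if g s i = j then d s i else 0)))"
  proof (rule M.finsum_cong')
    fix s assume s: "s \<in> A"
    show "h s \<odot>\<^bsub>M\<^esub> (\<Oplus>i\<in>B s. d s i \<odot>\<^bsub>M\<^esub> x (g s i)) =
        lc J x (\<lambda>j. h s * (\<Sum>i\<in>B s. if g s i = j then d s i else 0))"
      by (subst finsum_collect[of "B s" J]) (use assms s in \<open>auto simp: lc_smult\<close>)
  qed (use assms in auto)
  also have "\<dots> = lc J x (\<lambda>j. \<Sum>s\<in>A. h s * (\<Sum>i\<in>B s. if g s i = j then d s i else 0))"
    by (rule lc_sum) (use assms in auto)
  also have "(\<lambda>j. \<Sum>s\<in>A. h s * (\<Sum>i\<in>B s. if g s i = j then d s i else 0)) =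
      (\<lambda>j. \<Sum>s\<in>A. \<Sum>i\<in>B s. if g s i = j then h s * d s i else 0)"
    by (simp add: sum_distrib_left if_distrib cong: if_cong)
  finally show ?thesis .
qed

end

text \<open>The falling factorial s(s-1)...(s-i+1) in the field. The explicit 0 for
  \<open>i > s\<close> matters: truncated subtraction would turn the quotient into
  \<open>fact s\<close>.\<close>

definition ffact :: "nat \<Rightarrow> nat \<Rightarrow> 'a::field_char_0" where
  "ffact s i = (if i \<le> s then fact s / fact (s - i) else 0)"

lemma ffact_eq_choose: "ffact s i = (fact i * of_nat (s choose i) :: 'a::field_char_0)"
  by (auto simp: ffact_def binomial_fact)

lemma ffact_0 [simp]: "ffact s 0 = 1"
  by (simp add: ffact_def)

lemma minus_one_pCons: "[:- 1:] = (- 1 :: 'a::comm_ring_1 poly)"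
  by (simp add: one_pCons)

section \<open>Products with powers of D, and the brace\<close>

context conformal_algebra
begin

lemma nprod_zero_left [simp]: "b \<in> carrier C \<Longrightarrow> nprod C n \<zero> b = \<zero>"
  using nprod_scalar_left[of \<zero> b n 0] by simp

lemma nprod_zero_right [simp]: "a \<in> carrier C \<Longrightarrow> nprod C n a \<zero> = \<zero>"
  using nprod_scalar_right[of a \<zero> n 0] by simp

lemma nprod_neg_left:
  "a \<in> carrier C \<Longrightarrow> b \<in> carrier C \<Longrightarrow> nprod C n (\<ominus> a) b = \<ominus> nprod C n a b"
  using nprod_scalar_left[of a b n "-1"] smult_uminus[of a 1] smult_uminus[of "nprod C n a b" 1]
  by (simp add: minus_one_pCons)

lemma nprod_neg_right:
  "a \<in> carrier C \<Longrightarrow> b \<in> carrier C \<Longrightarrow> nprod C n a (\<ominus> b) = \<ominus> nprod C n a b"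
  using nprod_scalar_right[of a b n "-1"] smult_uminus[of b 1] smult_uminus[of "nprod C n a b" 1]
  by (simp add: minus_one_pCons)

lemma nprod_diff_left:
  "a \<in> carrier C \<Longrightarrow> a' \<in> carrier C \<Longrightarrow> b \<in> carrier C \<Longrightarrow>
    nprod C n (a \<ominus> a') b = nprod C n a b \<ominus> nprod C n a' b"
  by (simp add: a_minus_def nprod_add_left nprod_neg_left)

lemma nprod_diff_right:
  "a \<in> carrier C \<Longrightarrow> b \<in> carrier C \<Longrightarrow> b' \<in> carrier C \<Longrightarrow>
    nprod C n a (b \<ominus> b') = nprod C n a b \<ominus> nprod C n a b'"
  by (simp add: a_minus_def nprod_add_right nprod_neg_right)

lemma nprod_finsum_left:
  "f \<in> A \<rightarrow> carrier C \<Longrightarrow> b \<in> carrier C \<Longrightarrow>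
    nprod C n (finsum C f A) b = (\<Oplus>i\<in>A. nprod C n (f i) b)"
  by (induction A rule: infinite_finite_induct) (auto simp: nprod_add_left Pi_iff)

lemma nprod_finsum_right:
  "f \<in> A \<rightarrow> carrier C \<Longrightarrow> a \<in> carrier C \<Longrightarrow>
    nprod C n a (finsum C f A) = (\<Oplus>i\<in>A. nprod C n a (f i))"
  by (induction A rule: infinite_finite_induct) (auto simp: nprod_add_right Pi_iff)

lemma smult_monom_Suc:
  "x \<in> carrier C \<Longrightarrow> monom c (Suc s) \<odot>\<^bsub>C\<^esub> x = [:0, 1:] \<odot>\<^bsub>C\<^esub> (monom c s \<odot>\<^bsub>C\<^esub> x)"
  by (simp flip: smult_mult add: monom_Suc)

text \<open>In generating functions this is (D^s a)_\<lambda> b = (-\<lambda>)^s a_\<lambda> b. For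
  \<open>s > n\<close> the falling factorial vanishes, so the truncated index \<open>n - s\<close>
  is harmless.\<close>

lemma nprod_monom_left:
  assumes "a \<in> carrier C" "b \<in> carrier C"
  shows "nprod C n (monom c s \<odot>\<^bsub>C\<^esub> a) b = [:c * (-1) ^ s * ffact n s:] \<odot>\<^bsub>C\<^esub> nprod C (n - s) a b"
proof (induction s arbitrary: n)
  case 0
  then show ?case using assms by (simp add: monom_0 nprod_scalar_left ffact_def)
next
  case (Suc s)
  have "nprod C n (monom c (Suc s) \<odot>\<^bsub>C\<^esub> a) b = (- of_nat n) \<odot>\<^bsub>C\<^esub> nprod C (n - 1) (monom c s \<odot>\<^bsub>C\<^esub> a) b"
    using assms by (simp only: smult_monom_Suc nprod_D_left smultH)
  also have "\<dots> = (- of_nat n * [:c * (-1) ^ s * ffact (n - 1) s:]) \<odot>\<^bsub>C\<^esub> nprod C (n - Suc s) a b"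
    unfolding Suc.IH using assms by (subst smult_mult) auto
  also have "- of_nat n * [:c * (-1) ^ s * ffact (n - 1) s:] = [:c * (-1) ^ Suc s * ffact n (Suc s):]"
  proof (cases n)
    case (Suc k)
    then have e: "ffact n (Suc s) = (of_nat n * ffact (n - 1) s :: 'k)"
      by (auto simp: ffact_def)
    have "c * (-1) ^ Suc s * ffact n (Suc s) = - (of_nat n * (c * (-1) ^ s * ffact (n - 1) s))"
      unfolding e by (simp add: mult_ac)
    moreover have "- of_nat n * [:r:] = [:- (of_nat n * r):]" for r :: 'k
      by (simp add: of_nat_poly)
    ultimately show ?thesis by (simp only:)
  qed (simp add: ffact_def)
  finally show ?case .
qed

text \<open>The coefficient form of a_\<lambda>(D^s b) = (D + \<lambda>)^s a_\<lambda> b with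
  respect to \<lambda>^n / n!.\<close>

lemma nprod_monom_right:
  assumes "a \<in> carrier C" "b \<in> carrier C"
  shows "nprod C n a (monom c s \<odot>\<^bsub>C\<^esub> b) =
    (\<Oplus>i\<in>{..n}. monom (c * of_nat (n choose i) * ffact s i) (s - i) \<odot>\<^bsub>C\<^esub> nprod C (n - i) a b)"
proof (induction s arbitrary: n)
  case 0
  have "(\<Oplus>i\<in>{..n}. monom (c * of_nat (n choose i) * ffact 0 i) (0 - i) \<odot>\<^bsub>C\<^esub> nprod C (n - i) a b) =
      lc {..n} (\<lambda>i. nprod C (n - i) a b) (\<lambda>i. if i = 0 then [:c:] else 0)"
    unfolding lc_def by (rule M.finsum_cong') (use assms in \<open>auto simp: ffact_def monom_0\<close>)
  also have "\<dots> = [:c:] \<odot>\<^bsub>C\<^esub> nprod C n a b"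
    by (subst lc_unit) (use assms in auto)
  finally show ?case using assms by (simp add: monom_0 nprod_scalar_right)
next
  case (Suc s)
  let ?x = "\<lambda>i. nprod C (n - i) a b"
  have x: "?x \<in> {..n} \<rightarrow> carrier C" using assms by auto
  have 1: "[:0, 1:] \<odot>\<^bsub>C\<^esub> nprod C n a (monom c s \<odot>\<^bsub>C\<^esub> b) =
      lc {..n} ?x (\<lambda>i. [:0, 1:] * monom (c * of_nat (n choose i) * ffact s i) (s - i))"
    unfolding Suc.IH lc_smult[OF x] by (simp add: lc_def)
  have 2: "of_nat n \<odot>\<^bsub>C\<^esub> nprod C (n - 1) a (monom c s \<odot>\<^bsub>C\<^esub> b) =
      lc {..n} ?x (\<lambda>i. if i = 0 then 0 else
        of_nat n * monom (c * of_nat ((n - 1) choose (i - 1)) * ffact s (i - 1)) (s - (i - 1)))"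
  proof (cases n)
    case 0
    then show ?thesis using assms by (simp add: lc_def)
  next
    case (Suc k)
    have "of_nat n \<odot>\<^bsub>C\<^esub> nprod C (n - 1) a (monom c s \<odot>\<^bsub>C\<^esub> b) =
        lc {..k} (\<lambda>i. ?x (Suc i)) (\<lambda>i. of_nat n * monom (c * of_nat (k choose i) * ffact s i) (s - i))"
      unfolding Suc.IH
      by (subst lc_smult) (use assms Suc in \<open>auto simp: lc_def\<close>)
    also have "\<dots> = lc {..n} ?x (\<lambda>j. \<Sum>i\<le>k. if Suc i = j then
        of_nat n * monom (c * of_nat (k choose i) * ffact s i) (s - i) else 0)"
      unfolding lc_def[of "{..k}"] by (rule finsum_collect) (use x Suc in auto)
    also have "\<dots> = lc {..n} ?x (\<lambda>i. if i = 0 then 0 else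
        of_nat n * monom (c * of_nat ((n - 1) choose (i - 1)) * ffact s (i - 1)) (s - (i - 1)))"
    proof (rule lc_cong[OF x])
      fix j assume "j \<in> {..n}"
      then show "(\<Sum>i\<le>k. if Suc i = j then
          of_nat n * monom (c * of_nat (k choose i) * ffact s i) (s - i) else 0) =
        (if j = 0 then 0 else
        of_nat n * monom (c * of_nat ((n - 1) choose (j - 1)) * ffact s (j - 1)) (s - (j - 1)))"
        using Suc by (cases j) auto
    qed simp
    finally show ?thesis .
  qed
  have "nprod C n a (monom c (Suc s) \<odot>\<^bsub>C\<^esub> b) =
      [:0, 1:] \<odot>\<^bsub>C\<^esub> nprod C n a (monom c s \<odot>\<^bsub>C\<^esub> b) \<oplus> of_nat n \<odot>\<^bsub>C\<^esub> nprod C (n - 1) a (monom c s \<odot>\<^bsub>C\<^esub> b)"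
    using assms by (simp only: smult_monom_Suc nprod_D_right smultH)
  also have "\<dots> = lc {..n} ?x (\<lambda>i. [:0, 1:] * monom (c * of_nat (n choose i) * ffact s i) (s - i) +
      (if i = 0 then 0 else
        of_nat n * monom (c * of_nat ((n - 1) choose (i - 1)) * ffact s (i - 1)) (s - (i - 1))))"
    unfolding 1 2 lc_add[OF x] ..
  also have "\<dots> = lc {..n} ?x (\<lambda>i. monom (c * of_nat (n choose i) * ffact (Suc s) i) (Suc s - i))"
  proof (rule lc_cong[OF x])
    fix i assume i: "i \<in> {..n}"
    have D: "[:0, 1:] * monom r t = monom r (Suc t)" for r :: 'k and t
      by (simp add: monom_Suc)
    have n: "of_nat n * monom r t = monom (of_nat n * r) t" for r :: 'k and t
      by (simp add: of_nat_poly smult_monom)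
    show "[:0, 1:] * monom (c * of_nat (n choose i) * ffact s i) (s - i) + (if i = 0 then 0 else
        of_nat n * monom (c * of_nat ((n - 1) choose (i - 1)) * ffact s (i - 1)) (s - (i - 1))) =
      monom (c * of_nat (n choose i) * ffact (Suc s) i) (Suc s - i)"
    proof (cases i)
      case 0
      then show ?thesis by (simp add: monom_Suc)
    next
      case (Suc j)
      \<comment> \<open>Absorption brings both contributions to the factor
        \<open>n choose i\<close>; what remains is the recursion
        \<open>ffact s i + of_nat i * ffact s j = ffact (Suc s) i\<close>.\<close>
      have ab: "of_nat (Suc j) * of_nat (n choose Suc j) = (of_nat n * of_nat ((n - 1) choose j) :: 'k)"
        using Suc i times_binomial_minus1_eq[of "Suc j" n] by (metis diff_Suc_1 of_nat_mult zero_less_Suc)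
      show ?thesis
      proof (cases "i \<le> s")
        case True
        have f: "ffact s i + of_nat i * ffact s j = (ffact (Suc s) i :: 'k)"
        proof -
          have "ffact s i = (of_nat (s - j) * ffact s j :: 'k)"
          proof -
            obtain t where t: "s = Suc j + t" using True Suc le_Suc_ex by blast
            have "r / fact t = (of_nat (Suc t) * (r / fact (Suc t)) :: 'k)" for r
              by (simp add: fact_Suc del: of_nat_Suc)
            from this[of "fact s"] show ?thesis unfolding ffact_def Suc using t by (simp del: fact_Suc of_nat_Suc)
          qed
          moreover have "ffact (Suc s) i = (of_nat (Suc s) * ffact s j :: 'k)"
            using True Suc by (simp add: ffact_def)
          moreover have "of_nat (Suc s) = (of_nat (s - j) + of_nat i :: 'k)"
            using True Suc by (simp flip: of_nat_add)
          ultimately show ?thesis by (simp only: distrib_right)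
        qed
        have "c * of_nat (n choose i) * ffact s i + of_nat n * (c * of_nat ((n - 1) choose j) * ffact s j) =
            c * of_nat (n choose i) * (ffact s i + of_nat i * ffact s j)"
        proof -
          have "of_nat n * (c * of_nat ((n - 1) choose j) * ffact s j) =
              c * (of_nat (Suc j) * of_nat (n choose Suc j)) * ffact s j"
            unfolding ab by (simp add: algebra_simps)
          then show ?thesis unfolding Suc by (simp only: distrib_left mult_ac)
        qed
        moreover have "Suc (s - i) = Suc s - i" "s - (i - 1) = Suc s - i" "i \<noteq> 0" "i - 1 = j"
          using True Suc by auto
        ultimately show ?thesis by (simp only: D n if_False add_monom f)
      next
        case False
        have "of_nat n * (c * of_nat ((n - 1) choose j) * ffact s j) =
            c * (of_nat (Suc j) * of_nat (n choose Suc j)) * ffact s j"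
          unfolding ab by (simp add: algebra_simps)
        moreover have "of_nat (Suc j) * ffact s j = (ffact (Suc s) i :: 'k)"
          using False Suc by (cases "j = s") (auto simp: ffact_def)
        ultimately have "of_nat n * (c * of_nat ((n - 1) choose j) * ffact s j) =
            c * of_nat (n choose i) * ffact (Suc s) i"
          using Suc by (metis mult.assoc mult.commute)
        moreover have "ffact s i = (0 :: 'k)" using False by (simp add: ffact_def)
        ultimately show ?thesis using False Suc by (simp add: n)
      qed
    qed
  qed simp
  finally show ?case by (simp add: lc_def)
qed

abbreviation "brace \<equiv> nprod_brace C"

lemma eventually_zero:
  assumes "a \<in> carrier C" "b \<in> carrier C"
  shows "\<exists>K. \<forall>k>K. nprod C k a b = \<zero>"
proof -
  have "finite {n. nprod C n a b \<noteq> \<zero>}" using assms by (rule nprod_local)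
  then obtain K where "\<forall>k\<in>{n. nprod C n a b \<noteq> \<zero>}. k \<le> K"
    using finite_nat_set_iff_bounded_le by blast
  then show ?thesis by (intro exI[of _ K]) force
qed

text \<open>Replaces the support of the brace by an interval, so that braces of different arguments
  can be summed over the same index set.\<close>

lemma brace_eq:
  assumes "a \<in> carrier C" "b \<in> carrier C" "\<And>k. k > n + K \<Longrightarrow> nprod C k a b = \<zero>"
  shows "brace n a b = (\<Oplus>s\<in>{..K}. monom ((-1) ^ (n + s) / fact s) s \<odot>\<^bsub>C\<^esub> nprod C (n + s) a b)"
  unfolding nprod_brace_def
proof (rule M.add.finprod_mono_neutral_cong_left)
  show "{s. nprod C (n + s) a b \<noteq> \<zero>} \<subseteq> {..K}"
    using assms(3)[of "n + _"] by (auto simp flip: not_less)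
qed (use assms in auto)

lemma brace_closed [simp, intro]: "a \<in> carrier C \<Longrightarrow> b \<in> carrier C \<Longrightarrow> brace n a b \<in> carrier C"
  unfolding nprod_brace_def by (rule M.finsum_closed) auto

lemma brace_eventually_zero:
  assumes "a \<in> carrier C" "b \<in> carrier C" "\<And>k. k > K \<Longrightarrow> nprod C k a b = \<zero>" "n > K"
  shows "brace n a b = \<zero>"
  using assms brace_eq[of a b n 0] by simp

lemma brace_additive:
  assumes "a \<in> carrier C" "a' \<in> carrier C" "b \<in> carrier C" "b' \<in> carrier C" "a'' \<in> carrier C" "b'' \<in> carrier C"
    "\<And>k. nprod C k a'' b'' = nprod C k a b \<oplus> nprod C k a' b'"
  shows "brace n a'' b'' = brace n a b \<oplus> brace n a' b'"
proof -
  obtain K K' where K: "\<forall>k>K. nprod C k a b = \<zero>" "\<forall>k>K'. nprod C k a' b' = \<zero>"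
    using eventually_zero assms by metis
  define N where "N = max K K'"
  have b: "brace n a b = (\<Oplus>s\<in>{..N}. monom ((-1) ^ (n + s) / fact s) s \<odot>\<^bsub>C\<^esub> nprod C (n + s) a b)"
    "brace n a' b' = (\<Oplus>s\<in>{..N}. monom ((-1) ^ (n + s) / fact s) s \<odot>\<^bsub>C\<^esub> nprod C (n + s) a' b')"
    "brace n a'' b'' = (\<Oplus>s\<in>{..N}. monom ((-1) ^ (n + s) / fact s) s \<odot>\<^bsub>C\<^esub> nprod C (n + s) a'' b'')"
    by (rule brace_eq; use assms K in \<open>simp add: N_def\<close>)+
  show ?thesis unfolding b assms(7) using assms
    by (subst M.finsum_addf[symmetric]) (auto intro!: M.finsum_cong' simp: smult_add_right simp del: M.finsum_addf)
qed

lemma brace_add_left: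
  "a \<in> carrier C \<Longrightarrow> a' \<in> carrier C \<Longrightarrow> b \<in> carrier C \<Longrightarrow>
    brace n (a \<oplus> a') b = brace n a b \<oplus> brace n a' b"
  by (rule brace_additive) (auto simp: nprod_add_left)

lemma brace_add_right:
  "a \<in> carrier C \<Longrightarrow> b \<in> carrier C \<Longrightarrow> b' \<in> carrier C \<Longrightarrow>
    brace n a (b \<oplus> b') = brace n a b \<oplus> brace n a b'"
  by (rule brace_additive) (auto simp: nprod_add_right)

lemma brace_scaled:
  assumes "a \<in> carrier C" "b \<in> carrier C" "a' \<in> carrier C" "b' \<in> carrier C"
    "\<And>k. nprod C k a' b' = [:c:] \<odot>\<^bsub>C\<^esub> nprod C k a b"
  shows "brace n a' b' = [:c:] \<odot>\<^bsub>C\<^esub> brace n a b"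
proof -
  obtain K where K: "\<forall>k>K. nprod C k a b = \<zero>"
    using eventually_zero assms by metis
  have b: "brace n a b = (\<Oplus>s\<in>{..K}. monom ((-1) ^ (n + s) / fact s) s \<odot>\<^bsub>C\<^esub> nprod C (n + s) a b)"
    "brace n a' b' = (\<Oplus>s\<in>{..K}. monom ((-1) ^ (n + s) / fact s) s \<odot>\<^bsub>C\<^esub> nprod C (n + s) a' b')"
    by (rule brace_eq; use assms K in simp)+
  show ?thesis unfolding b assms(5) using assms
    by (subst smult_finsum) (auto intro!: M.finsum_cong' smult_commute)
qed

lemma brace_scalar_left:
  "a \<in> carrier C \<Longrightarrow> b \<in> carrier C \<Longrightarrow> brace n ([:c:] \<odot>\<^bsub>C\<^esub> a) b = [:c:] \<odot>\<^bsub>C\<^esub> brace n a b"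
  by (rule brace_scaled) (auto simp: nprod_scalar_left)

lemma brace_scalar_right:
  "a \<in> carrier C \<Longrightarrow> b \<in> carrier C \<Longrightarrow> brace n a ([:c:] \<odot>\<^bsub>C\<^esub> b) = [:c:] \<odot>\<^bsub>C\<^esub> brace n a b"
  by (rule brace_scaled) (auto simp: nprod_scalar_right)

text \<open>On the left of a product D^t merely lowers the index, with factor (-1)^t q!/(q - t)!.
  Together with 1/t! from the brace this is a binomial coefficient up to sign, and no power of D
  survives.\<close>

lemma nprod_brace_left:
  assumes "a \<in> carrier C" "b \<in> carrier C" "c \<in> carrier C"
  shows "nprod C q (brace p b a) c =
    (\<Oplus>t\<in>{..q}. ((-1) ^ p * of_nat (q choose t)) \<odot>\<^bsub>C\<^esub> nprod C (q - t) (nprod C (p + t) b a) c)"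
proof -
  obtain K where K: "\<forall>k>K. nprod C k b a = \<zero>" using eventually_zero assms by metis
  define N where "N = max K q"
  have "brace p b a = (\<Oplus>t\<in>{..N}. monom ((-1) ^ (p + t) / fact t) t \<odot>\<^bsub>C\<^esub> nprod C (p + t) b a)"
    by (rule brace_eq; use assms K in \<open>simp add: N_def\<close>)
  then have "nprod C q (brace p b a) c =
      (\<Oplus>t\<in>{..N}. nprod C q (monom ((-1) ^ (p + t) / fact t) t \<odot>\<^bsub>C\<^esub> nprod C (p + t) b a) c)"
    using assms by (simp add: nprod_finsum_left)
  also have "\<dots> = (\<Oplus>t\<in>{..N}. ((-1) ^ p * of_nat (q choose t)) \<odot>\<^bsub>C\<^esub> nprod C (q - t) (nprod C (p + t) b a) c)"
  proof (rule M.finsum_cong')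
    fix t
    have "(-1) ^ (p + t) / fact t * (-1) ^ t * ffact q t = ((-1) ^ p * of_nat (q choose t) :: 'k)"
      by (simp add: ffact_eq_choose power_add mult.assoc flip: power_mult_distrib)
    moreover have "[:(-1) ^ p * of_nat (q choose t):] = ((-1) ^ p * of_nat (q choose t) :: 'k poly)"
      by (cases "even p") (simp_all add: of_nat_poly)
    ultimately show "nprod C q (monom ((-1) ^ (p + t) / fact t) t \<odot>\<^bsub>C\<^esub> nprod C (p + t) b a) c =
        ((-1) ^ p * of_nat (q choose t)) \<odot>\<^bsub>C\<^esub> nprod C (q - t) (nprod C (p + t) b a) c"
      using assms by (simp only: nprod_monom_left nprod_closed)
  qed (use assms in auto)
  also have "\<dots> = (\<Oplus>t\<in>{..q}. ((-1) ^ p * of_nat (q choose t)) \<odot>\<^bsub>C\<^esub> nprod C (q - t) (nprod C (p + t) b a) c)"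
    by (rule M.add.finprod_mono_neutral_cong_right) (use assms in \<open>auto simp: N_def binomial_eq_0\<close>)
  finally show ?thesis .
qed

end

section \<open>Left and right multiplications in an associative conformal algebra\<close>

context assoc_conformal_algebra
begin

text \<open>Associativity reads a_\<lambda>(b_\<mu> c) = (a_\<lambda> b)_{\<lambda>+\<mu>} c in
  generating functions, hence (b_\<lambda> c)_\<mu> a = b_\<lambda>(c_{\<mu>-\<lambda>} a); this is
  the coefficient form of the latter.\<close>

lemma nprod_assoc_right:
  assumes "a \<in> carrier C" "b \<in> carrier C" "c \<in> carrier C"
  shows "nprod C k (nprod C m b c) a =
    (\<Oplus>i\<in>{..m}. ((-1) ^ i * of_nat (m choose i)) \<odot>\<^bsub>C\<^esub> nprod C (m - i) b (nprod C (k + i) c a))"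
proof -
  let ?x = "\<lambda>j. nprod C (k + j) (nprod C (m - j) b c) a"
  have x: "?x \<in> {..m} \<rightarrow> carrier C" using assms by auto
  have "(\<Oplus>i\<in>{..m}. ((-1) ^ i * of_nat (m choose i)) \<odot>\<^bsub>C\<^esub> nprod C (m - i) b (nprod C (k + i) c a)) =
      (\<Oplus>i\<in>{..m}. ((-1) ^ i * of_nat (m choose i)) \<odot>\<^bsub>C\<^esub>
        (\<Oplus>s\<in>{..m - i}. of_nat ((m - i) choose s) \<odot>\<^bsub>C\<^esub> ?x (i + s)))"
    using assms by (intro M.finsum_cong') (auto simp: nprod_assoc add.assoc)
  also have "\<dots> = lc {..m} ?x (\<lambda>j. \<Sum>i\<le>m. \<Sum>s\<le>m - i. if i + s = j then
      (-1) ^ i * of_nat (m choose i) * of_nat ((m - i) choose s) else 0)"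
    by (rule finsum_collect2) (use x in auto)
  also have "\<dots> = lc {..m} ?x (\<lambda>j. if j = 0 then 1 else 0)"
  proof (rule lc_cong[OF x])
    fix j assume j: "j \<in> {..m}"
    have "(\<Sum>s\<le>m - i. if i + s = j then
        (-1) ^ i * of_nat (m choose i) * of_nat ((m - i) choose s) else 0 :: 'k poly) =
      (if i \<le> j then (-1) ^ i * of_nat (m choose i) * of_nat ((m - i) choose (j - i)) else 0)" for i
    proof -
      have "i + s = j \<longleftrightarrow> i \<le> j \<and> s = j - i" for s by auto
      moreover have "j - i \<le> m - i" using j by auto
      ultimately show ?thesis by (cases "i \<le> j") simp_all
    qed
    then show "(\<Sum>i\<le>m. \<Sum>s\<le>m - i. if i + s = j then
        (-1) ^ i * of_nat (m choose i) * of_nat ((m - i) choose s) else 0 :: 'k poly) = (if j = 0 then 1 else 0)"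
      using sum_alternating_choose_mult[of j m, where ?'a = "'k poly"] j by simp
  qed simp
  also have "\<dots> = nprod C k (nprod C m b c) a"
    by (subst lc_unit) (use x assms in auto)
  finally show ?thesis ..
qed

text \<open>The map \<open>c \<mapsto> {c\<^sub>(\<^sub>n\<^sub>)a}\<close> is the right multiplication by \<open>a\<close>.\<close>

lemma brace_nprod:
  assumes a: "a \<in> carrier C" and b: "b \<in> carrier C" and c: "c \<in> carrier C"
  shows "brace n (nprod C m b c) a = nprod C m b (brace n c a)"
proof -
  obtain K where K: "\<And>k. k > K \<Longrightarrow> nprod C k c a = \<zero>" using eventually_zero[OF c a] by blast
  \<comment> \<open>Both sides are expanded in the products b_(m-i)(c_(k)a);
    \<open>n + K + m\<close> bounds all the indices \<open>n + s + i\<close> and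
    \<open>n + s\<close> that occur.\<close>
  define J where "J = {..m} \<times> {..n + K + m}"
  define x where "x = (\<lambda>(i, k). nprod C (m - i) b (nprod C k c a))"
  have x: "x \<in> J \<rightarrow> carrier C" unfolding x_def using assms by auto
  have J: "finite J" unfolding J_def by simp
  let ?\<epsilon> = "\<lambda>s. (-1) ^ (n + s) / fact s :: 'k"
  have left_zero: "nprod C k (nprod C m b c) a = \<zero>" if "k > K" for k
    unfolding nprod_assoc_right[OF assms] using K that b by (intro M.add.finprod_one_eqI) simp
  have "brace n (nprod C m b c) a = (\<Oplus>s\<in>{..K}. monom (?\<epsilon> s) s \<odot>\<^bsub>C\<^esub> nprod C (n + s) (nprod C m b c) a)"
    by (rule brace_eq) (use assms left_zero in auto)
  also have "\<dots> = (\<Oplus>s\<in>{..K}. monom (?\<epsilon> s) s \<odot>\<^bsub>C\<^esub>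
      (\<Oplus>i\<in>{..m}. ((-1) ^ i * of_nat (m choose i)) \<odot>\<^bsub>C\<^esub> x (i, n + s + i)))"
    using assms by (intro M.finsum_cong') (auto simp: nprod_assoc_right x_def add.assoc)
  also have "\<dots> = lc J x (\<lambda>j. \<Sum>s\<le>K. \<Sum>i\<le>m. if (i, n + s + i) = j then
      monom (?\<epsilon> s) s * ((-1) ^ i * of_nat (m choose i)) else 0)"
    by (rule finsum_collect2) (use x J in \<open>auto simp: J_def\<close>)
  finally have L: "brace n (nprod C m b c) a = \<dots>" .
  have "brace n c a = (\<Oplus>s\<in>{..K + m}. monom (?\<epsilon> s) s \<odot>\<^bsub>C\<^esub> nprod C (n + s) c a)"
    by (rule brace_eq) (use assms K in auto)
  then have "nprod C m b (brace n c a) =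
      (\<Oplus>s\<in>{..K + m}. nprod C m b (monom (?\<epsilon> s) s \<odot>\<^bsub>C\<^esub> nprod C (n + s) c a))"
    using assms by (simp add: nprod_finsum_right)
  also have "\<dots> = (\<Oplus>s\<in>{..K + m}. 1 \<odot>\<^bsub>C\<^esub>
      (\<Oplus>i\<in>{..m}. monom (?\<epsilon> s * of_nat (m choose i) * ffact s i) (s - i) \<odot>\<^bsub>C\<^esub> x (i, n + s)))"
    using assms by (intro M.finsum_cong') (auto simp: nprod_monom_right x_def)
  also have "\<dots> = lc J x (\<lambda>j. \<Sum>s\<le>K + m. \<Sum>i\<le>m. if (i, n + s) = j then
      1 * monom (?\<epsilon> s * of_nat (m choose i) * ffact s i) (s - i) else 0)"
    by (rule finsum_collect2) (use x J in \<open>auto simp: J_def\<close>)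
  finally have R: "nprod C m b (brace n c a) = \<dots>" .
  show ?thesis unfolding L R
  proof (rule lc_cong_nonzero[OF x])
    fix j assume j: "j \<in> J" "x j \<noteq> \<zero>"
    obtain i k where ik: "j = (i, k)" "i \<le> m" using j by (auto simp: J_def)
    \<comment> \<open>Beyond \<open>K\<close> the members of the family vanish. For
      \<open>k \<le> K\<close> neither of the truncated sums has lost a term.\<close>
    have k: "k \<le> K" using K[of k] j(2) b unfolding ik x_def by (cases "k \<le> K") auto
    \<comment> \<open>For a given pair \<open>(i, k)\<close> a single \<open>s\<close> contributes:
      \<open>k - n - i\<close> here and \<open>k - n\<close> on the other side. The accompanying
      inequalities guard the truncated subtractions.\<close>
    have "(\<Sum>s\<le>K. \<Sum>i'\<le>m. if (i', n + s + i') = j then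
        monom (?\<epsilon> s) s * ((-1) ^ i' * of_nat (m choose i')) else 0) =
      (\<Sum>s\<le>K. if s = k - n - i \<and> n + i \<le> k then monom (?\<epsilon> s) s * ((-1) ^ i * of_nat (m choose i)) else 0)"
    proof (rule sum.cong[OF refl])
      fix s
      have "(i', n + s + i') = j \<longleftrightarrow> i' = i \<and> (s = k - n - i \<and> n + i \<le> k)" for i'
        unfolding ik by auto
      then show "(\<Sum>i'\<le>m. if (i', n + s + i') = j then
          monom (?\<epsilon> s) s * ((-1) ^ i' * of_nat (m choose i')) else 0) =
        (if s = k - n - i \<and> n + i \<le> k then monom (?\<epsilon> s) s * ((-1) ^ i * of_nat (m choose i)) else 0)"
        using ik(2) by (cases "s = k - n - i \<and> n + i \<le> k") auto
    qed
    also have "\<dots> = (if n + i \<le> k then monom (?\<epsilon> (k - n - i)) (k - n - i) * ((-1) ^ i * of_nat (m choose i)) else 0)"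
      using k by (cases "n + i \<le> k") auto
    also have "\<dots> = (if n \<le> k then monom (?\<epsilon> (k - n) * of_nat (m choose i) * ffact (k - n) i) (k - n - i) else 0)"
    proof (cases "n + i \<le> k")
      case True
      have "?\<epsilon> (k - n) * of_nat (m choose i) * ffact (k - n) i =
          ?\<epsilon> (k - n - i) * ((-1) ^ i * of_nat (m choose i))"
      proof -
        have "(-1) ^ (n + (k - n)) = ((-1) ^ (n + (k - n - i)) * (-1) ^ i :: 'k)"
          using True by (simp flip: power_add)
        moreover have "i \<le> k - n" using True by arith
        ultimately show ?thesis by (simp add: ffact_def)
      qed
      moreover have "monom r t * ((-1) ^ i * of_nat (m choose i)) = monom (r * ((-1) ^ i * of_nat (m choose i))) t" for r :: 'k and t
        by (cases "even i") (simp_all add: of_nat_poly mult.commute smult_monom minus_monom)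
      ultimately show ?thesis using True by simp
    qed (auto simp: ffact_def)
    also have "\<dots> = (\<Sum>s\<le>K + m. if s = k - n \<and> n \<le> k then monom (?\<epsilon> s * of_nat (m choose i) * ffact s i) (s - i) else 0)"
      using k by (cases "n \<le> k") auto
    also have "\<dots> = (\<Sum>s\<le>K + m. \<Sum>i'\<le>m. if (i', n + s) = j then
        1 * monom (?\<epsilon> s * of_nat (m choose i') * ffact s i') (s - i') else 0)"
    proof (rule sum.cong[OF refl])
      fix s
      have "(i', n + s) = j \<longleftrightarrow> i' = i \<and> (s = k - n \<and> n \<le> k)" for i'
        unfolding ik by auto
      then show "(if s = k - n \<and> n \<le> k then monom (?\<epsilon> s * of_nat (m choose i) * ffact s i) (s - i) else 0) =
        (\<Sum>i'\<le>m. if (i', n + s) = j then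
          1 * monom (?\<epsilon> s * of_nat (m choose i') * ffact s i') (s - i') else 0)"
        using ik(2) by (cases "s = k - n \<and> n \<le> k") auto
    qed
    finally show "(\<Sum>s\<le>K. \<Sum>i'\<le>m. if (i', n + s + i') = j then
        monom (?\<epsilon> s) s * ((-1) ^ i' * of_nat (m choose i')) else 0) =
      (\<Sum>s\<le>K + m. \<Sum>i'\<le>m. if (i', n + s) = j then
        1 * monom (?\<epsilon> s * of_nat (m choose i') * ffact s i') (s - i') else 0)" .
  qed
qed

text \<open>The generating function of the brace is b_{-D-\<lambda>} a, and D acts as
  -(\<lambda>+\<mu>) on the left of a product with parameter \<lambda>+\<mu>. So the sum is a
  coefficient of (b_\<mu> a)_{\<lambda>+\<mu>} c = b_\<mu>(a_\<lambda> c). Numerically this is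
  \<open>sum_choose_difference\<close>.\<close>

lemma brace_left_mult:
  assumes a: "a \<in> carrier C" and b: "b \<in> carrier C" and c: "c \<in> carrier C"
  shows "(\<Oplus>s\<in>{..n}. of_nat (n choose s) \<odot>\<^bsub>C\<^esub> nprod C (m + s) (brace (n - s) b a) c) =
    nprod C m b (nprod C n a c)"
proof -
  let ?x = "\<lambda>j. nprod C (m + n - j) (nprod C j b a) c"
  have x: "?x \<in> {..m + n} \<rightarrow> carrier C" using assms by auto
  have "(\<Oplus>s\<in>{..n}. of_nat (n choose s) \<odot>\<^bsub>C\<^esub> nprod C (m + s) (brace (n - s) b a) c) =
      (\<Oplus>s\<in>{..n}. of_nat (n choose s) \<odot>\<^bsub>C\<^esub>
        (\<Oplus>t\<in>{..m + s}. ((-1) ^ (n - s) * of_nat ((m + s) choose t)) \<odot>\<^bsub>C\<^esub> ?x (n - s + t)))"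
    using assms by (intro M.finsum_cong') (auto simp: nprod_brace_left)
  also have "\<dots> = lc {..m + n} ?x (\<lambda>j. \<Sum>s\<le>n. \<Sum>t\<le>m + s. if n - s + t = j then
      of_nat (n choose s) * ((-1) ^ (n - s) * of_nat ((m + s) choose t)) else 0)"
    by (rule finsum_collect2) (use x in auto)
  also have "\<dots> = lc {..m + n} ?x (\<lambda>j. \<Sum>s\<le>m. if m - s = j then of_nat (m choose s) else 0)"
  proof (rule lc_cong[OF x])
    fix j assume j: "j \<in> {..m + n}"
    have "(\<Sum>s\<le>n. \<Sum>t\<le>m + s. if n - s + t = j then
        of_nat (n choose s) * ((-1) ^ (n - s) * of_nat ((m + s) choose t)) else 0 :: 'k poly) =
      (\<Sum>s\<le>n. if n - s \<le> j then of_nat (n choose s) * (-1) ^ (n - s) * of_nat ((m + s) choose (j + s - n)) else 0)"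
    proof (rule sum.cong[OF refl])
      fix s assume s: "s \<in> {..n}"
      then have "n - s + t = j \<longleftrightarrow> n - s \<le> j \<and> t = j + s - n" for t by auto
      moreover have "j + s - n \<le> m + s" using j s by auto
      ultimately show "(\<Sum>t\<le>m + s. if n - s + t = j then
          of_nat (n choose s) * ((-1) ^ (n - s) * of_nat ((m + s) choose t)) else 0 :: 'k poly) =
        (if n - s \<le> j then of_nat (n choose s) * (-1) ^ (n - s) * of_nat ((m + s) choose (j + s - n)) else 0)"
        by (cases "n - s \<le> j") (simp_all add: mult.assoc)
    qed
    also have "\<dots> = of_nat (m choose j)" by (rule sum_choose_difference)
    also have "\<dots> = (\<Sum>s\<le>m. if m - s = j then of_nat (m choose s) else 0)"
    proof (cases "j \<le> m")
      case True
      have "(\<Sum>s\<le>m. if m - s = j then of_nat (m choose s) else 0 :: 'k poly) =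
          (\<Sum>s\<le>m. if s = m - j then of_nat (m choose s) else 0)"
        by (rule sum.cong) (use True in auto)
      also have "\<dots> = of_nat (m choose (m - j))" by simp
      finally show ?thesis using binomial_symmetric[OF True] by simp
    next
      case False
      then have "m - s \<noteq> j" for s by auto
      then show ?thesis using False by (simp add: binomial_eq_0)
    qed
    finally show "(\<Sum>s\<le>n. \<Sum>t\<le>m + s. if n - s + t = j then
        of_nat (n choose s) * ((-1) ^ (n - s) * of_nat ((m + s) choose t)) else 0 :: 'k poly) =
      (\<Sum>s\<le>m. if m - s = j then of_nat (m choose s) else 0)" .
  qed simp
  also have "\<dots> = (\<Oplus>s\<in>{..m}. of_nat (m choose s) \<odot>\<^bsub>C\<^esub> ?x (m - s))"
    by (rule finsum_collect[symmetric]) (use x in auto)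
  also have "\<dots> = nprod C m b (nprod C n a c)"
    unfolding nprod_assoc[OF b a c] using assms by (intro M.finsum_cong') (auto simp: add.commute)
  finally show ?thesis .
qed

text \<open>Associativity minus \<open>brace_left_mult\<close>. It says that left multiplication
  obeys the commutator formula of a representation of the commutator algebra.\<close>

lemma left_mult_commutator:
  assumes a: "a \<in> carrier C" and b: "b \<in> carrier C" and c: "c \<in> carrier C"
  shows "nprod C n a (nprod C m b c) \<ominus> nprod C m b (nprod C n a c) =
    (\<Oplus>s\<in>{..n}. of_nat (n choose s) \<odot>\<^bsub>C\<^esub>
      nprod C (m + s) (nprod C (n - s) a b \<ominus> brace (n - s) b a) c)"
proof -
  let ?f = "\<lambda>s. of_nat (n choose s) \<odot>\<^bsub>C\<^esub> nprod C (m + s) (nprod C (n - s) a b \<ominus> brace (n - s) b a) c"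
  let ?g = "\<lambda>s. of_nat (n choose s) \<odot>\<^bsub>C\<^esub> nprod C (m + s) (brace (n - s) b a) c"
  let ?h = "\<lambda>s. of_nat (n choose s) \<odot>\<^bsub>C\<^esub> nprod C (m + s) (nprod C (n - s) a b) c"
  have "finsum C ?f {..n} \<oplus> finsum C ?g {..n} = (\<Oplus>s\<in>{..n}. ?f s \<oplus> ?g s)"
    using assms by (intro M.finsum_addf[symmetric]) auto
  also have "\<dots> = finsum C ?h {..n}"
    using assms by (intro M.finsum_cong')
      (auto simp: smult_add_right[symmetric] nprod_add_left[symmetric] a_minus_def M.a_assoc M.l_neg)
  finally have "finsum C ?f {..n} \<oplus> nprod C m b (nprod C n a c) = nprod C n a (nprod C m b c)"
    unfolding brace_left_mult[OF assms] nprod_assoc[OF assms] .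
  then show ?thesis
    using assms M.add.inv_solve_right[of "finsum C ?f {..n}" "nprod C n a (nprod C m b c)" "nprod C m b (nprod C n a c)"]
    by (auto simp: a_minus_def)
qed

end

section \<open>The representation on \<open>L \<oplus> U\<^sub>2\<close>\<close>

context conformal_algebra
begin

lemma nprod_span_left:
  assumes S: "LinearCombinations.submodule H S C" and X: "X \<subseteq> carrier C" and y: "y \<in> carrier C"
    and XY: "\<And>n x. x \<in> X \<Longrightarrow> nprod C n x y \<in> S" and x: "x \<in> span X"
  shows "nprod C n x y \<in> S"
proof -
  note S' = submoduleD[OF S]
  \<comment> \<open>All indices at once, since a factor D in a multiple of \<open>x\<close> leads
    from \<open>n\<close> to \<open>n - 1\<close>.\<close>
  have "\<forall>n. nprod C n x y \<in> S" using x X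
  proof (induction rule: span_induct)
    case (smult h x)
    show ?case
    proof (induction h)
      case (pCons c h)
      have "nprod C n (pCons c h \<odot>\<^bsub>C\<^esub> x) y =
          [:c:] \<odot>\<^bsub>C\<^esub> nprod C n x y \<oplus> (- of_nat n) \<odot>\<^bsub>C\<^esub> nprod C (n - 1) (h \<odot>\<^bsub>C\<^esub> x) y" for n
        unfolding smult_pCons[OF smult(1), of c h] using smult y
        by (simp add: nprod_add_left nprod_scalar_left nprod_D_left)
      then show ?case using pCons smult S' by simp
    qed (use smult y S' in simp)
  qed (use XY y S' in \<open>auto simp: nprod_add_left\<close>)
  then show ?thesis by blast
qed

lemma nprod_span_right:
  assumes S: "LinearCombinations.submodule H S C" and Y: "Y \<subseteq> carrier C" and x: "x \<in> carrier C"
    and XY: "\<And>n y. y \<in> Y \<Longrightarrow> nprod C n x y \<in> S" and y: "y \<in> span Y"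
  shows "nprod C n x y \<in> S"
proof -
  note S' = submoduleD[OF S]
  have "\<forall>n. nprod C n x y \<in> S" using y Y
  proof (induction rule: span_induct)
    case (smult h y)
    show ?case
    proof (induction h)
      case (pCons c h)
      have "nprod C n x (pCons c h \<odot>\<^bsub>C\<^esub> y) = [:c:] \<odot>\<^bsub>C\<^esub> nprod C n x y \<oplus>
          ([:0, 1:] \<odot>\<^bsub>C\<^esub> nprod C n x (h \<odot>\<^bsub>C\<^esub> y) \<oplus> of_nat n \<odot>\<^bsub>C\<^esub> nprod C (n - 1) x (h \<odot>\<^bsub>C\<^esub> y))" for n
        unfolding smult_pCons[OF smult(1), of c h] using smult x
        by (simp add: nprod_add_right nprod_scalar_right nprod_D_right)
      then show ?case using pCons smult S' by simp
    qed (use smult x S' in simp)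
  qed (use XY x S' in \<open>auto simp: nprod_add_right\<close>)
  then show ?thesis by blast
qed

lemma nprod_span:
  assumes "LinearCombinations.submodule H S C" "X \<subseteq> carrier C" "Y \<subseteq> carrier C"
    "\<And>n x y. x \<in> X \<Longrightarrow> y \<in> Y \<Longrightarrow> nprod C n x y \<in> S" "x \<in> span X" "y \<in> span Y"
  shows "nprod C n x y \<in> S"
proof (rule nprod_span_left[OF assms(1,2) _ _ assms(5)])
  show "y \<in> carrier C" using span_in_carrier[OF assms(3)] assms(6) by blast
  show "nprod C n x y \<in> S" if "x \<in> X" for n x
    by (rule nprod_span_right[OF assms(1,3) _ _ assms(6)]) (use that assms in auto)
qed

text \<open>The two D-rules contribute the product of index \<open>n - 1\<close> with opposite
  signs.\<close>

lemma D_derivation: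
  assumes "a \<in> carrier C" "b \<in> carrier C"
  shows "[:0, 1:] \<odot>\<^bsub>C\<^esub> nprod C n a b =
    nprod C n ([:0, 1:] \<odot>\<^bsub>C\<^esub> a) b \<oplus> nprod C n a ([:0, 1:] \<odot>\<^bsub>C\<^esub> b)"
proof -
  let ?D = "[:0, 1:] \<odot>\<^bsub>C\<^esub> nprod C n a b" and ?n = "of_nat n \<odot>\<^bsub>C\<^esub> nprod C (n - 1) a b"
  have "\<ominus> ?n \<oplus> (?D \<oplus> ?n) = ?D"
    using assms by (simp add: M.a_lcomm M.l_neg)
  then show ?thesis using assms by (simp add: nprod_D_left nprod_D_right smult_uminus)
qed

end

context H_module
begin

lemma diff_cancel_iff:
  assumes "x \<in> carrier M" "y \<in> carrier M" "z \<in> carrier M"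
  shows "x \<ominus> y = z \<longleftrightarrow> x = z \<oplus> y"
  using assms M.add.inv_solve_right[of z x y] by (auto simp: a_minus_def)

lemma diff_add_diff:
  assumes "x \<in> carrier M" "y \<in> carrier M" "z \<in> carrier M" "w \<in> carrier M"
  shows "(x \<oplus> y) \<ominus> (z \<oplus> w) = (x \<ominus> z) \<oplus> (y \<ominus> w)"
  using assms by (simp add: a_minus_def M.minus_add M.a_ac)

lemma diff_diff_diff:
  assumes "x \<in> carrier M" "y \<in> carrier M" "z \<in> carrier M" "w \<in> carrier M"
  shows "(x \<ominus> y) \<ominus> (z \<ominus> w) = (x \<ominus> z) \<ominus> (y \<ominus> w)"
  using assms by (simp add: a_minus_def M.minus_add M.a_ac)

lemma diff_diff_swap:
  assumes "x \<in> carrier M" "y \<in> carrier M" "z \<in> carrier M" "w \<in> carrier M"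
  shows "(x \<ominus> y) \<ominus> (z \<ominus> w) = (x \<oplus> w) \<ominus> (y \<oplus> z)"
  using assms by (simp add: a_minus_def M.minus_add M.a_ac)

lemma diff_left_cancel:
  assumes "x \<in> carrier M" "y \<in> carrier M" "z \<in> carrier M"
  shows "x \<ominus> y = x \<ominus> z \<longleftrightarrow> y = z"
proof -
  have "\<ominus> (x \<ominus> v) \<oplus> x = v" if v: "v \<in> carrier M" for v
  proof -
    have "\<ominus> (x \<ominus> v) \<oplus> x = v \<oplus> (\<ominus> x \<oplus> x)"
      using assms v by (simp add: a_minus_def M.minus_add M.a_ac)
    then show ?thesis using assms v by (simp add: M.l_neg)
  qed
  from this[OF assms(2)] this[OF assms(3)] show ?thesis by metis
qed

lemma finsum_diff:
  "f \<in> A \<rightarrow> carrier M \<Longrightarrow> g \<in> A \<rightarrow> carrier M \<Longrightarrow>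
    finsum M f A \<ominus> finsum M g A = (\<Oplus>i\<in>A. f i \<ominus> g i)"
  by (induction A rule: infinite_finite_induct) (auto simp: diff_add_diff Pi_iff)

end

locale lie_envelope =
  L: lie_conformal_algebra L + U: assoc_conformal_algebra U
  for L :: "('k::field_char_0 poly, 'l) conf_alg" and U :: "('k poly, 'u) conf_alg" +
  fixes \<iota> :: "'l \<Rightarrow> 'u"
  assumes \<iota>_hom: "\<iota> \<in> conf_hom L (commutator_alg U)"
begin

abbreviation "D\<^sub>L x \<equiv> [:0, 1:] \<odot>\<^bsub>L\<^esub> x"
abbreviation "D\<^sub>U x \<equiv> [:0, 1:] \<odot>\<^bsub>U\<^esub> x"
abbreviation "lm n a t \<equiv> nprod U n (\<iota> a) t"
abbreviation "rm n a t \<equiv> nprod_brace U n t (\<iota> a)"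

sublocale \<iota>: H_hom L U \<iota>
  by unfold_locales (use \<iota>_hom in \<open>auto simp: conf_hom_def commutator_alg_def LinearCombinations.module_hom_def\<close>)

definition ad :: "nat \<Rightarrow> 'l \<Rightarrow> 'u \<Rightarrow> 'u" where
  "ad n a t = lm n a t \<ominus>\<^bsub>U\<^esub> rm n a t"

lemma \<iota>_nprod:
  "a \<in> carrier L \<Longrightarrow> b \<in> carrier L \<Longrightarrow> \<iota> (nprod L n a b) = ad n a (\<iota> b)"
  using \<iota>_hom by (auto simp: conf_hom_def commutator_alg_def ad_def a_minus_def)

lemma \<iota>_D: "a \<in> carrier L \<Longrightarrow> \<iota> (D\<^sub>L a) = D\<^sub>U (\<iota> a)"
  by (rule \<iota>.smult)

lemma ad_closed [simp, intro]: "a \<in> carrier L \<Longrightarrow> t \<in> carrier U \<Longrightarrow> ad n a t \<in> carrier U"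
  unfolding ad_def by auto

lemma ad_add_left:
  "a \<in> carrier L \<Longrightarrow> a' \<in> carrier L \<Longrightarrow> t \<in> carrier U \<Longrightarrow>
    ad n (a \<oplus>\<^bsub>L\<^esub> a') t = ad n a t \<oplus>\<^bsub>U\<^esub> ad n a' t"
  by (simp add: ad_def \<iota>.add U.nprod_add_left U.brace_add_right U.diff_add_diff)

lemma ad_add_right:
  "a \<in> carrier L \<Longrightarrow> t \<in> carrier U \<Longrightarrow> t' \<in> carrier U \<Longrightarrow>
    ad n a (t \<oplus>\<^bsub>U\<^esub> t') = ad n a t \<oplus>\<^bsub>U\<^esub> ad n a t'"
  by (simp add: ad_def U.nprod_add_right U.brace_add_left U.diff_add_diff)

lemma ad_scalar_left:
  "a \<in> carrier L \<Longrightarrow> t \<in> carrier U \<Longrightarrow> ad n ([:c:] \<odot>\<^bsub>L\<^esub> a) t = [:c:] \<odot>\<^bsub>U\<^esub> ad n a t"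
  by (simp add: ad_def \<iota>.smult U.nprod_scalar_left U.brace_scalar_right U.smult_diff_right)

lemma ad_scalar_right:
  "a \<in> carrier L \<Longrightarrow> t \<in> carrier U \<Longrightarrow> ad n a ([:c:] \<odot>\<^bsub>U\<^esub> t) = [:c:] \<odot>\<^bsub>U\<^esub> ad n a t"
  by (simp add: ad_def U.nprod_scalar_right U.brace_scalar_left U.smult_diff_right)

lemma ad_zero_right: "a \<in> carrier L \<Longrightarrow> ad n a \<zero>\<^bsub>U\<^esub> = \<zero>\<^bsub>U\<^esub>"
  using ad_scalar_right[of a "\<zero>\<^bsub>U\<^esub>" n 0] by simp

lemma ad_local:
  assumes "a \<in> carrier L" "t \<in> carrier U"
  shows "finite {n. ad n a t \<noteq> \<zero>\<^bsub>U\<^esub>}"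
proof -
  obtain K where K: "\<And>k. k > K \<Longrightarrow> lm k a t = \<zero>\<^bsub>U\<^esub>" using U.eventually_zero assms by blast
  obtain K' where K': "\<And>k. k > K' \<Longrightarrow> nprod U k t (\<iota> a) = \<zero>\<^bsub>U\<^esub>" using U.eventually_zero assms by blast
  have "{n. ad n a t \<noteq> \<zero>\<^bsub>U\<^esub>} \<subseteq> {..max K K'}"
  proof
    fix n assume n: "n \<in> {n. ad n a t \<noteq> \<zero>\<^bsub>U\<^esub>}"
    have "ad n a t = \<zero>\<^bsub>U\<^esub>" if "n > max K K'"
      unfolding ad_def using that K U.brace_eventually_zero[of t "\<iota> a" K' n] K' assms
      by (simp add: a_minus_def)
    then show "n \<in> {..max K K'}" using n by (force simp: not_le)
  qed
  then show ?thesis using finite_subset by blast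
qed

text \<open>\<open>\<iota>(L)\<close> and the products of pairs of elements of \<open>\<iota>(L)\<close> span \<open>U\<^sub>2\<close> even additively,
  because \<open>D\<close> is a derivation.\<close>

inductive_set U2 :: "'u set" where
  zero: "\<zero>\<^bsub>U\<^esub> \<in> U2"
| gen: "x \<in> carrier L \<Longrightarrow> \<iota> x \<in> U2"
| prod: "x \<in> carrier L \<Longrightarrow> y \<in> carrier L \<Longrightarrow> lm k x (\<iota> y) \<in> U2"
| add: "s \<in> U2 \<Longrightarrow> t \<in> U2 \<Longrightarrow> s \<oplus>\<^bsub>U\<^esub> t \<in> U2"

lemma U2_carrier: "t \<in> U2 \<Longrightarrow> t \<in> carrier U"
  by (induction rule: U2.induct) auto

lemma U2_scalar: "t \<in> U2 \<Longrightarrow> [:c:] \<odot>\<^bsub>U\<^esub> t \<in> U2"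
proof (induction rule: U2.induct)
  case (gen x)
  then show ?case using U2.gen[of "[:c:] \<odot>\<^bsub>L\<^esub> x"] by (simp add: \<iota>.smult)
next
  case (prod x y k)
  then show ?case using U2.prod[of "[:c:] \<odot>\<^bsub>L\<^esub> x" y k] by (simp add: \<iota>.smult U.nprod_scalar_left)
qed (auto simp: U.smult_add_right U2_carrier intro: U2.intros)

lemma U2_D: "t \<in> U2 \<Longrightarrow> D\<^sub>U t \<in> U2"
proof (induction rule: U2.induct)
  case (gen x)
  then show ?case using U2.gen[of "D\<^sub>L x"] by (simp add: \<iota>.smult)
next
  case (prod x y k)
  then show ?case using U2.prod[of "D\<^sub>L x" y k] U2.prod[of x "D\<^sub>L y" k]
    by (simp add: \<iota>.smult U.D_derivation U2.add)
qed (auto simp: U.smult_add_right U2_carrier intro: U2.intros)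

lemma U2_submodule: "LinearCombinations.submodule H U2 U"
proof (rule U.submoduleI')
  fix h t assume t: "t \<in> U2"
  show "h \<odot>\<^bsub>U\<^esub> t \<in> U2"
  proof (induction h)
    case (pCons c h)
    then show ?case
      unfolding U.smult_pCons[OF U2_carrier[OF t], of c h] using t U2_scalar U2_D U2.add by blast
  qed (use t U2_carrier U2.zero in simp)
qed (auto simp: U2_carrier intro: U2.intros)

section \<open>The adjoint action on \<open>U2\<close>\<close>

lemma left_commutator:
  assumes "a \<in> carrier L" "b \<in> carrier L" "t \<in> carrier U"
  shows "lm n a (lm m b t) \<ominus>\<^bsub>U\<^esub> lm m b (lm n a t) =
    (\<Oplus>\<^bsub>U\<^esub>s\<in>{..n}. of_nat (n choose s) \<odot>\<^bsub>U\<^esub> lm (m + s) (nprod L (n - s) a b) t)"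
  unfolding U.left_mult_commutator[OF \<iota>.closed[OF assms(1)] \<iota>.closed[OF assms(2)] assms(3)]
  using assms by (simp add: \<iota>_nprod ad_def)

text \<open>Right multiplication by \<iota>(a) acts on the factor \<iota>(y) alone, where it is left
  multiplication minus the bracket. This puts the Leibniz rule into a form with a commutator of left
  multiplications, to which \<open>left_commutator\<close> applies.\<close>

lemma ad_prod:
  assumes "a \<in> carrier L" "x \<in> carrier L" "y \<in> carrier L"
  shows "ad n a (lm k x (\<iota> y)) =
    (lm n a (lm k x (\<iota> y)) \<ominus>\<^bsub>U\<^esub> lm k x (lm n a (\<iota> y))) \<oplus>\<^bsub>U\<^esub> lm k x (\<iota> (nprod L n a y))"
proof -
  have "lm k x (\<iota> (nprod L n a y)) = lm k x (lm n a (\<iota> y)) \<ominus>\<^bsub>U\<^esub> rm n a (lm k x (\<iota> y))"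
    using assms by (simp add: \<iota>_nprod ad_def U.nprod_diff_right U.brace_nprod)
  then show ?thesis unfolding ad_def using assms
    by (simp add: a_minus_def U.M.a_assoc U.M.r_neg1)
qed

text \<open>By \<open>left_commutator\<close> the commutator in \<open>ad_prod\<close> is again a
  combination of products of two elements of \<iota>(L), so the degree does not rise.\<close>

lemma ad_U2: "t \<in> U2 \<Longrightarrow> a \<in> carrier L \<Longrightarrow> ad n a t \<in> U2"
proof (induction rule: U2.induct)
  case (gen x)
  then show ?case using U2.gen[of "nprod L n a x"] by (simp add: \<iota>_nprod)
next
  case (prod x y k)
  note S = U.submoduleD[OF U2_submodule]
  have "finsum U f A \<in> U2" if "\<And>s. s \<in> A \<Longrightarrow> f s \<in> U2" for f and A :: "nat set"
    using that
  proof (induction A rule: infinite_finite_induct)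
    case (insert s A)
    then show ?case using S(1,3) by (subst U.M.finsum_insert) auto
  qed (auto simp: U.M.finsum_infinite U2.zero)
  then have "(\<Oplus>\<^bsub>U\<^esub>s\<in>{..n}. of_nat (n choose s) \<odot>\<^bsub>U\<^esub> lm (k + s) (nprod L (n - s) a x) (\<iota> y)) \<in> U2"
    using prod S(4) U2.prod by simp
  then show ?case
    using prod by (simp add: ad_prod left_commutator U2.add U2.prod)
qed (auto simp: ad_zero_right ad_add_right U2_carrier intro: U2.intros)

text \<open>On \<iota>(L) right multiplications are thus governed by left multiplications and the
  bracket of \<open>L\<close>, from which they inherit the rules below.\<close>

lemma rm_gen:
  assumes "a \<in> carrier L" "x \<in> carrier L"
  shows "rm n a (\<iota> x) = lm n a (\<iota> x) \<ominus>\<^bsub>U\<^esub> \<iota> (nprod L n a x)"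
proof -
  have "lm n a (\<iota> x) \<ominus>\<^bsub>U\<^esub> rm n a (\<iota> x) = \<iota> (nprod L n a x)" using assms by (simp add: \<iota>_nprod ad_def)
  then show ?thesis using assms U.diff_cancel_iff
    by (metis L.nprod_closed U.M.add.m_comm U.brace_closed U.nprod_closed \<iota>.closed)
qed

text \<open>On \<iota>(L) the rule comes by \<open>rm_gen\<close> from those for left multiplication
  and for \<open>L\<close>; on products it follows because \<open>brace_nprod\<close> moves the
  right multiplication to the second factor.\<close>

lemma rm_D_left:
  assumes "t \<in> U2" "a \<in> carrier L"
  shows "rm n (D\<^sub>L a) t = (- of_nat n) \<odot>\<^bsub>U\<^esub> rm (n - 1) a t"
  using assms
proof (induction rule: U2.induct)
  case zero
  then show ?case using U.brace_scalar_left[of "\<zero>\<^bsub>U\<^esub>" _ _ 0] by simp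
next
  case (gen x)
  then show ?case
    using rm_gen[of "D\<^sub>L a" x n] rm_gen[of a x "n - 1"]
    by (simp add: \<iota>_D U.nprod_D_left L.nprod_D_left \<iota>.smult U.smult_diff_right)
next
  case (prod x y k)
  have "rm n (D\<^sub>L a) (\<iota> y) = (- of_nat n) \<odot>\<^bsub>U\<^esub> rm (n - 1) a (\<iota> y)"
    using prod rm_gen[of "D\<^sub>L a" y n] rm_gen[of a y "n - 1"]
    by (simp add: \<iota>_D U.nprod_D_left L.nprod_D_left \<iota>.smult U.smult_diff_right)
  moreover have "nprod U k x' (of_nat n \<odot>\<^bsub>U\<^esub> y') = of_nat n \<odot>\<^bsub>U\<^esub> nprod U k x' y'"
    if "x' \<in> carrier U" "y' \<in> carrier U" for x' y'
    using that by (simp add: of_nat_poly U.nprod_scalar_right)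
  ultimately show ?case using prod
    by (simp add: U.brace_nprod U.smult_uminus U.nprod_neg_right)
next
  case (add s t)
  then show ?case by (simp add: U2_carrier U.brace_add_left U.smult_add_right)
qed

lemma rm_D_right:
  assumes "t \<in> U2" "a \<in> carrier L"
  shows "rm n a (D\<^sub>U t) = D\<^sub>U (rm n a t) \<oplus>\<^bsub>U\<^esub> of_nat n \<odot>\<^bsub>U\<^esub> rm (n - 1) a t"
  using assms
proof (induction rule: U2.induct)
  case zero
  then show ?case using U.brace_scalar_left[of "\<zero>\<^bsub>U\<^esub>" _ _ 0] by simp
next
  case (gen x)
  then show ?case
    using rm_gen[of a "D\<^sub>L x" n] rm_gen[of a x n] rm_gen[of a x "n - 1"]
    by (simp add: \<iota>_D U.nprod_D_right L.nprod_D_right \<iota>.smult \<iota>.add U.smult_diff_right U.diff_add_diff)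
next
  case (prod x y k)
  have y: "rm n a (D\<^sub>U (\<iota> y)) = D\<^sub>U (rm n a (\<iota> y)) \<oplus>\<^bsub>U\<^esub> of_nat n \<odot>\<^bsub>U\<^esub> rm (n - 1) a (\<iota> y)"
    using prod rm_gen[of a "D\<^sub>L y" n] rm_gen[of a y n] rm_gen[of a y "n - 1"]
    by (simp add: \<iota>_D U.nprod_D_right L.nprod_D_right \<iota>.smult \<iota>.add U.smult_diff_right U.diff_add_diff)
  have n: "nprod U k x' (of_nat n \<odot>\<^bsub>U\<^esub> y') = of_nat n \<odot>\<^bsub>U\<^esub> nprod U k x' y'"
    if "x' \<in> carrier U" "y' \<in> carrier U" for x' y'
    using that by (simp add: of_nat_poly U.nprod_scalar_right)
  have "rm n a (D\<^sub>U (lm k x (\<iota> y))) =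
      nprod U k (D\<^sub>U (\<iota> x)) (rm n a (\<iota> y)) \<oplus>\<^bsub>U\<^esub> lm k x (rm n a (D\<^sub>U (\<iota> y)))"
    using prod by (simp add: U.D_derivation U.brace_add_left U.brace_nprod)
  also have "\<dots> = D\<^sub>U (lm k x (rm n a (\<iota> y))) \<oplus>\<^bsub>U\<^esub> of_nat n \<odot>\<^bsub>U\<^esub> lm k x (rm (n - 1) a (\<iota> y))"
    unfolding y using prod by (simp add: U.nprod_add_right U.D_derivation n U.M.a_assoc)
  finally show ?case using prod by (simp add: U.brace_nprod)
next
  case (add s t)
  then show ?case by (simp add: U2_carrier U.brace_add_left U.smult_add_right U.M.a_ac)
qed

lemma ad_D_left:
  "t \<in> U2 \<Longrightarrow> a \<in> carrier L \<Longrightarrow> ad n (D\<^sub>L a) t = (- of_nat n) \<odot>\<^bsub>U\<^esub> ad (n - 1) a t"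
  unfolding ad_def rm_D_left using U2_carrier[of t]
  by (simp add: \<iota>_D U.nprod_D_left U.smult_diff_right)

lemma ad_D_right:
  "t \<in> U2 \<Longrightarrow> a \<in> carrier L \<Longrightarrow>
    ad n a (D\<^sub>U t) = D\<^sub>U (ad n a t) \<oplus>\<^bsub>U\<^esub> of_nat n \<odot>\<^bsub>U\<^esub> ad (n - 1) a t"
  unfolding ad_def rm_D_right using U2_carrier[of t]
  by (simp add: U.nprod_D_right U.smult_diff_right U.diff_add_diff)

text \<open>Since left and right multiplications commute, the commutator formula for \<open>ad\<close> amounts to one
  for right multiplications. The latter holds on \<open>\<iota>(L)\<close> by the Jacobi identity, and carries over
  to products because right multiplications act on the right factor only.\<close>

lemma ad_commutator_iff:
  assumes a: "a \<in> carrier L" and b: "b \<in> carrier L" and t: "t \<in> carrier U"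
  shows "ad n a (ad m b t) \<ominus>\<^bsub>U\<^esub> ad m b (ad n a t) =
      (\<Oplus>\<^bsub>U\<^esub>s\<in>{..n}. of_nat (n choose s) \<odot>\<^bsub>U\<^esub> ad (m + s) (nprod L (n - s) a b) t) \<longleftrightarrow>
    rm m b (rm n a t) \<ominus>\<^bsub>U\<^esub> rm n a (rm m b t) =
      (\<Oplus>\<^bsub>U\<^esub>s\<in>{..n}. of_nat (n choose s) \<odot>\<^bsub>U\<^esub> rm (m + s) (nprod L (n - s) a b) t)"
proof -
  let ?l = "lm n a (lm m b t) \<ominus>\<^bsub>U\<^esub> lm m b (lm n a t)"
  \<comment> \<open>Right multiplications compose in the opposite order, whence the interchanged
    roles of \<open>a\<close> and \<open>b\<close> and the minus sign before \<open>?r\<close> and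
    \<open>?S\<close> below.\<close>
  let ?r = "rm m b (rm n a t) \<ominus>\<^bsub>U\<^esub> rm n a (rm m b t)"
  let ?S = "\<Oplus>\<^bsub>U\<^esub>s\<in>{..n}. of_nat (n choose s) \<odot>\<^bsub>U\<^esub> rm (m + s) (nprod L (n - s) a b) t"
  have [simp]: "nprod_brace U k (x \<ominus>\<^bsub>U\<^esub> y) z = nprod_brace U k x z \<ominus>\<^bsub>U\<^esub> nprod_brace U k y z"
    if "x \<in> carrier U" "y \<in> carrier U" "z \<in> carrier U" for k x y z
    using that U.brace_add_left[of x "\<ominus>\<^bsub>U\<^esub> y" z k] U.brace_scalar_left[of y z k "-1"]
    by (simp add: a_minus_def minus_one_pCons U.smult_uminus)
  have ad2: "ad k x (ad j y t) =
      (lm k x (lm j y t) \<oplus>\<^bsub>U\<^esub> rm k x (rm j y t)) \<ominus>\<^bsub>U\<^esub> (lm k x (rm j y t) \<oplus>\<^bsub>U\<^esub> lm j y (rm k x t))"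
    if "x \<in> carrier L" "y \<in> carrier L" for k j x y
    unfolding ad_def using that t
    by (simp add: U.nprod_diff_right U.brace_nprod U.diff_diff_swap)
  have "ad n a (ad m b t) \<ominus>\<^bsub>U\<^esub> ad m b (ad n a t) = ?l \<ominus>\<^bsub>U\<^esub> ?r"
  proof -
    have "lm m b (rm n a t) \<oplus>\<^bsub>U\<^esub> lm n a (rm m b t) = lm n a (rm m b t) \<oplus>\<^bsub>U\<^esub> lm m b (rm n a t)"
      using assms by (simp add: U.M.a_comm)
    then have "ad n a (ad m b t) \<ominus>\<^bsub>U\<^esub> ad m b (ad n a t) =
        (lm n a (lm m b t) \<oplus>\<^bsub>U\<^esub> rm n a (rm m b t)) \<ominus>\<^bsub>U\<^esub> (lm m b (lm n a t) \<oplus>\<^bsub>U\<^esub> rm m b (rm n a t))"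
      unfolding ad2[OF a b] ad2[OF b a] using assms
      by (simp add: U.diff_diff_diff U.diff_eq_zero[THEN iffD2] a_minus_def[of U _ "\<zero>\<^bsub>U\<^esub>"])
    then show ?thesis using assms by (simp add: U.diff_add_diff a_minus_def U.M.minus_add U.M.a_ac)
  qed
  moreover have "(\<Oplus>\<^bsub>U\<^esub>s\<in>{..n}. of_nat (n choose s) \<odot>\<^bsub>U\<^esub> ad (m + s) (nprod L (n - s) a b) t) = ?l \<ominus>\<^bsub>U\<^esub> ?S"
    unfolding left_commutator[OF assms] using assms
    by (subst U.finsum_diff) (auto simp: ad_def U.smult_diff_right intro!: U.M.finsum_cong')
  moreover have "?l \<ominus>\<^bsub>U\<^esub> x = ?l \<ominus>\<^bsub>U\<^esub> y \<longleftrightarrow> x = y" if "x \<in> carrier U" "y \<in> carrier U" for x y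
    using that assms by (simp add: U.diff_left_cancel)
  ultimately show ?thesis using assms by simp
qed

lemma rm_commutator:
  assumes a: "a \<in> carrier L" and b: "b \<in> carrier L" and t: "t \<in> U2"
  shows "rm m b (rm n a t) \<ominus>\<^bsub>U\<^esub> rm n a (rm m b t) =
    (\<Oplus>\<^bsub>U\<^esub>s\<in>{..n}. of_nat (n choose s) \<odot>\<^bsub>U\<^esub> rm (m + s) (nprod L (n - s) a b) t)"
proof -
  have L: "rm m b (rm n a (\<iota> x)) \<ominus>\<^bsub>U\<^esub> rm n a (rm m b (\<iota> x)) =
      (\<Oplus>\<^bsub>U\<^esub>s\<in>{..n}. of_nat (n choose s) \<odot>\<^bsub>U\<^esub> rm (m + s) (nprod L (n - s) a b) (\<iota> x))"
    if x: "x \<in> carrier L" for x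
  proof -
    \<comment> \<open>On \<iota>(L) the operators \<open>ad\<close> are the bracket of
      \<open>L\<close>, so the Jacobi identity gives the formula for \<open>ad\<close>;
      \<open>ad_commutator_iff\<close> turns it into the one for right multiplications.\<close>
    have "ad n a (ad m b (\<iota> x)) \<ominus>\<^bsub>U\<^esub> ad m b (ad n a (\<iota> x)) =
        \<iota> (nprod L n a (nprod L m b x) \<ominus>\<^bsub>L\<^esub> nprod L m b (nprod L n a x))"
      using a b x by (simp add: \<iota>.diff \<iota>_nprod)
    also have "\<dots> = (\<Oplus>\<^bsub>U\<^esub>s\<in>{..n}. of_nat (n choose s) \<odot>\<^bsub>U\<^esub> ad (m + s) (nprod L (n - s) a b) (\<iota> x))"
      unfolding L.nprod_jacobi[OF a b x] using a b x
      by (subst \<iota>.finsum) (auto simp: \<iota>.smult \<iota>_nprod)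
    finally show ?thesis using ad_commutator_iff[OF a b, of "\<iota> x" n m] x by simp
  qed
  have z: "nprod_brace U k \<zero>\<^bsub>U\<^esub> z = \<zero>\<^bsub>U\<^esub>" if "z \<in> carrier U" for k z
    using U.brace_scalar_left[of "\<zero>\<^bsub>U\<^esub>" z k 0] that by simp
  show ?thesis using t
  proof (induction rule: U2.induct)
    case zero
    then show ?case using a b by (simp add: z a_minus_def)
  next
    case (gen x)
    then show ?case by (rule L)
  next
    case (prod x y k)
    have "nprod U k x' (of_nat i \<odot>\<^bsub>U\<^esub> y') = of_nat i \<odot>\<^bsub>U\<^esub> nprod U k x' y'"
      if "x' \<in> carrier U" "y' \<in> carrier U" for x' y' i
      using that by (simp add: of_nat_poly U.nprod_scalar_right)
    then show ?case using prod a b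
      by (simp add: U.brace_nprod U.nprod_diff_right[symmetric] L U.nprod_finsum_right Pi_iff
          cong: U.M.finsum_cong)
  next
    case (add s t)
    have st: "s \<in> carrier U" "t \<in> carrier U" using add U2_carrier by auto
    show ?case using add.IH st a b
      by (simp add: U.brace_add_left U.diff_add_diff U.smult_add_right U.M.finsum_addf Pi_iff)
  qed
qed

lemma ad_commutator:
  assumes "a \<in> carrier L" "b \<in> carrier L" "t \<in> U2"
  shows "ad n a (ad m b t) \<ominus>\<^bsub>U\<^esub> ad m b (ad n a t) =
    (\<Oplus>\<^bsub>U\<^esub>s\<in>{..n}. of_nat (n choose s) \<odot>\<^bsub>U\<^esub> ad (m + s) (nprod L (n - s) a b) t)"
  using ad_commutator_iff rm_commutator U2_carrier assms by simp

definition coc :: "nat \<Rightarrow> 'l \<Rightarrow> 'l \<Rightarrow> 'u" where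
  "coc n a y = lm n (D\<^sub>L a) (\<iota> y)"

lemma coc_closed [simp, intro]: "a \<in> carrier L \<Longrightarrow> y \<in> carrier L \<Longrightarrow> coc n a y \<in> carrier U"
  unfolding coc_def by auto

lemma coc_U2: "a \<in> carrier L \<Longrightarrow> y \<in> carrier L \<Longrightarrow> coc n a y \<in> U2"
  unfolding coc_def by (rule U2.prod) auto

text \<open>The cocycle condition holds because \<open>D\<close> is a derivation of \<open>L\<close>.\<close>

lemma cocycle:
  assumes a: "a \<in> carrier L" and b: "b \<in> carrier L" and y: "y \<in> carrier L"
  shows "(ad n a (coc m b y) \<oplus>\<^bsub>U\<^esub> coc n a (nprod L m b y)) \<ominus>\<^bsub>U\<^esub>
      (ad m b (coc n a y) \<oplus>\<^bsub>U\<^esub> coc m b (nprod L n a y)) =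
    (\<Oplus>\<^bsub>U\<^esub>s\<in>{..n}. of_nat (n choose s) \<odot>\<^bsub>U\<^esub> coc (m + s) (nprod L (n - s) a b) y)"
proof -
  let ?X = "lm n a (lm m (D\<^sub>L b) (\<iota> y)) \<ominus>\<^bsub>U\<^esub> lm m (D\<^sub>L b) (lm n a (\<iota> y))"
  let ?Y = "lm n (D\<^sub>L a) (lm m b (\<iota> y)) \<ominus>\<^bsub>U\<^esub> lm m b (lm n (D\<^sub>L a) (\<iota> y))"
  let ?p = "coc m b (nprod L n a y)" and ?q = "coc n a (nprod L m b y)"
  have "ad n a (coc m b y) = ?X \<oplus>\<^bsub>U\<^esub> ?p"
    unfolding coc_def using assms by (intro ad_prod) auto
  moreover have "ad m b (coc n a y) = \<ominus>\<^bsub>U\<^esub> ?Y \<oplus>\<^bsub>U\<^esub> ?q"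
    unfolding coc_def using assms by (subst ad_prod) (auto simp: a_minus_def U.M.minus_add U.M.a_comm)
  \<comment> \<open>Both \<open>?p\<close> and \<open>?q\<close> occur in each argument of the
    coboundary and cancel. The commutators remain, \<open>?X\<close> with D on \<open>b\<close> and
    \<open>?Y\<close> with D on \<open>a\<close>, both with a plus sign.\<close>
  moreover have "(X \<oplus>\<^bsub>U\<^esub> p \<oplus>\<^bsub>U\<^esub> q) \<ominus>\<^bsub>U\<^esub> (\<ominus>\<^bsub>U\<^esub> Y \<oplus>\<^bsub>U\<^esub> q \<oplus>\<^bsub>U\<^esub> p) = X \<oplus>\<^bsub>U\<^esub> Y"
    if "X \<in> carrier U" "Y \<in> carrier U" "p \<in> carrier U" "q \<in> carrier U" for X Y p q
  proof -
    have "(X \<oplus>\<^bsub>U\<^esub> p \<oplus>\<^bsub>U\<^esub> q) \<ominus>\<^bsub>U\<^esub> (\<ominus>\<^bsub>U\<^esub> Y \<oplus>\<^bsub>U\<^esub> q \<oplus>\<^bsub>U\<^esub> p) =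
        (X \<oplus>\<^bsub>U\<^esub> (p \<oplus>\<^bsub>U\<^esub> q)) \<ominus>\<^bsub>U\<^esub> (\<ominus>\<^bsub>U\<^esub> Y \<oplus>\<^bsub>U\<^esub> (p \<oplus>\<^bsub>U\<^esub> q))"
      using that by (simp add: U.M.a_ac)
    also have "\<dots> = (X \<ominus>\<^bsub>U\<^esub> \<ominus>\<^bsub>U\<^esub> Y) \<oplus>\<^bsub>U\<^esub> ((p \<oplus>\<^bsub>U\<^esub> q) \<ominus>\<^bsub>U\<^esub> (p \<oplus>\<^bsub>U\<^esub> q))"
      using that by (intro U.diff_add_diff) auto
    also have "\<dots> = X \<oplus>\<^bsub>U\<^esub> Y" using that by (simp add: a_minus_def U.M.r_neg)
    finally show ?thesis .
  qed
  ultimately have "(ad n a (coc m b y) \<oplus>\<^bsub>U\<^esub> ?q) \<ominus>\<^bsub>U\<^esub> (ad m b (coc n a y) \<oplus>\<^bsub>U\<^esub> ?p) = ?X \<oplus>\<^bsub>U\<^esub> ?Y"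
    using assms by simp
  also have "\<dots> = (\<Oplus>\<^bsub>U\<^esub>s\<in>{..n}. of_nat (n choose s) \<odot>\<^bsub>U\<^esub> lm (m + s) (nprod L (n - s) a (D\<^sub>L b)) (\<iota> y) \<oplus>\<^bsub>U\<^esub>
      of_nat (n choose s) \<odot>\<^bsub>U\<^esub> lm (m + s) (nprod L (n - s) (D\<^sub>L a) b) (\<iota> y))"
    using assms by (subst left_commutator, auto)+
  also have "\<dots> = (\<Oplus>\<^bsub>U\<^esub>s\<in>{..n}. of_nat (n choose s) \<odot>\<^bsub>U\<^esub> coc (m + s) (nprod L (n - s) a b) y)"
    using assms by (intro U.M.finsum_cong')
      (auto simp: coc_def L.D_derivation \<iota>.add U.nprod_add_left U.smult_add_right U.M.a_comm)
  finally show ?thesis .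
qed

section \<open>The extension of \<open>L\<close> by \<open>U2\<close>\<close>

definition pairs :: "('k poly, 'l \<times> 'u) module" where
  "pairs = \<lparr>carrier = carrier L \<times> U2, mult = undefined, one = undefined,
    zero = (\<zero>\<^bsub>L\<^esub>, \<zero>\<^bsub>U\<^esub>), add = \<lambda>v w. (fst v \<oplus>\<^bsub>L\<^esub> fst w, snd v \<oplus>\<^bsub>U\<^esub> snd w),
    smult = \<lambda>h v. (h \<odot>\<^bsub>L\<^esub> fst v, h \<odot>\<^bsub>U\<^esub> snd v)\<rparr>"

lemma pairs_simps [simp]:
  "v \<in> carrier pairs \<longleftrightarrow> fst v \<in> carrier L \<and> snd v \<in> U2"
  "\<zero>\<^bsub>pairs\<^esub> = (\<zero>\<^bsub>L\<^esub>, \<zero>\<^bsub>U\<^esub>)" "v \<oplus>\<^bsub>pairs\<^esub> w = (fst v \<oplus>\<^bsub>L\<^esub> fst w, snd v \<oplus>\<^bsub>U\<^esub> snd w)"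
  "h \<odot>\<^bsub>pairs\<^esub> v = (h \<odot>\<^bsub>L\<^esub> fst v, h \<odot>\<^bsub>U\<^esub> snd v)"
  by (auto simp: pairs_def mem_Times_iff)

lemma U2_smult: "t \<in> U2 \<Longrightarrow> h \<odot>\<^bsub>U\<^esub> t \<in> U2"
  by (rule U.submoduleD(4)[OF U2_submodule])

lemma U2_neg: "t \<in> U2 \<Longrightarrow> \<ominus>\<^bsub>U\<^esub> t \<in> U2"
  using U2_smult[of t "-1"] U.smult_uminus[of t 1] U2_carrier[of t] by simp

lemma H_module_pairs: "H_module pairs"
  unfolding H_module_def
proof (rule moduleI)
  show "cring (H :: 'k poly ring)" ..
  show "abelian_group pairs"
  proof (rule abelian_groupI)
    fix v assume "v \<in> carrier pairs"
    then show "\<exists>w\<in>carrier pairs. w \<oplus>\<^bsub>pairs\<^esub> v = \<zero>\<^bsub>pairs\<^esub>"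
      by (intro bexI[of _ "(\<ominus>\<^bsub>L\<^esub> fst v, \<ominus>\<^bsub>U\<^esub> snd v)"]) (auto simp: U2_neg U2_carrier L.M.l_neg U.M.l_neg)
  qed (auto simp: U2_carrier L.M.a_ac U.M.a_ac intro: U2.zero U2.add)
qed (auto simp: U2_carrier U2_smult L.smult_add_left L.smult_add_right L.smult_mult
    U.smult_add_left U.smult_add_right U.smult_mult)

sublocale pairs: H_module pairs by (rule H_module_pairs)

sublocale fst: H_hom pairs L fst
  by unfold_locales (rule module_homI, auto)

sublocale snd: H_hom pairs U snd
  by unfold_locales (rule module_homI, auto simp: U2_carrier)

text \<open>A triangular action: \<open>U2\<close> is a subrepresentation, the quotient is the
  adjoint representation of \<open>L\<close>, and \<open>coc\<close> is the off-diagonal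
  block.\<close>

definition pact :: "nat \<Rightarrow> 'l \<Rightarrow> 'l \<times> 'u \<Rightarrow> 'l \<times> 'u" where
  "pact n a v = (nprod L n a (fst v), ad n a (snd v) \<oplus>\<^bsub>U\<^esub> coc n a (fst v))"

lemma pact_representation: "conformal_representation L pairs pact"
proof (unfold_locales, goal_cases)
  case (1 a v n)
  then show ?case by (auto simp: pact_def intro!: U2.add ad_U2 coc_U2)
next
  case (2 a a' v n)
  then show ?case
    by (simp add: pact_def U2_carrier L.nprod_add_left ad_add_left coc_def \<iota>.add L.smult_add_right
        U.nprod_add_left U.M.a_ac)
next
  case (3 a v v' n)
  then show ?case
    by (simp add: pact_def U2_carrier L.nprod_add_right ad_add_right coc_def \<iota>.add
        U.nprod_add_right U.M.a_ac)
next
  case (4 a v n c)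
  then show ?case
    by (simp add: pact_def U2_carrier L.nprod_scalar_left ad_scalar_left coc_def \<iota>.smult
        L.smult_commute[of a "[:0, 1:]"] U.nprod_scalar_left U.smult_add_right
        U.smult_commute[of _ "[:0, 1:]" "[:c:]"])
next
  case (5 a v n c)
  then show ?case
    by (simp add: pact_def U2_carrier L.nprod_scalar_right ad_scalar_right coc_def \<iota>.smult
        U.nprod_scalar_right U.smult_add_right)
next
  case (6 a v)
  have "{n. pact n a v \<noteq> \<zero>\<^bsub>pairs\<^esub>} \<subseteq> {n. nprod L n a (fst v) \<noteq> \<zero>\<^bsub>L\<^esub>} \<union>
      {n. ad n a (snd v) \<noteq> \<zero>\<^bsub>U\<^esub>} \<union> {n. coc n a (fst v) \<noteq> \<zero>\<^bsub>U\<^esub>}"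
    by (auto simp: pact_def)
  moreover have "finite {n. coc n a (fst v) \<noteq> \<zero>\<^bsub>U\<^esub>}"
    unfolding coc_def using 6 by (intro U.nprod_local) auto
  ultimately show ?case using 6 L.nprod_local[of a "fst v"] ad_local[of a "snd v"] U2_carrier
    by (auto intro: finite_subset)
next
  case (7 a v n)
  then show ?case
    by (simp add: pact_def U2_carrier L.nprod_D_left ad_D_left coc_def \<iota>.smult
        U.nprod_D_left U.smult_add_right)
next
  case (8 a v n)
  then show ?case
    by (simp add: pact_def U2_carrier L.nprod_D_right ad_D_right coc_def \<iota>.smult
        U.nprod_D_right U.smult_add_right U.M.a_ac)
next
  case (9 a b v n m)
  then have v: "fst v \<in> carrier L" "snd v \<in> U2" "snd v \<in> carrier U" by (auto simp: U2_carrier)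
  let ?f = "\<lambda>s. of_nat (n choose s) \<odot>\<^bsub>pairs\<^esub> pact (m + s) (nprod L (n - s) a b) v"
  have f: "?f \<in> {..n} \<rightarrow> carrier pairs"
    using 9 v by (auto simp: pact_def intro!: U2.add ad_U2 coc_U2 U2_smult)
  have cl: "pact k x w \<in> carrier pairs" if "x \<in> carrier L" "w \<in> carrier pairs" for k x w
    using that by (auto simp: pact_def intro!: U2.add ad_U2 coc_U2)
  show ?case
  proof (rule prod_eqI)
    have "fst (pact n a (pact m b v) \<ominus>\<^bsub>pairs\<^esub> pact m b (pact n a v)) =
        nprod L n a (nprod L m b (fst v)) \<ominus>\<^bsub>L\<^esub> nprod L m b (nprod L n a (fst v))"
      using 9 cl by (subst fst.diff) (auto simp del: pairs_simps simp: pact_def)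
    also have "\<dots> = fst (finsum pairs ?f {..n})"
      unfolding L.nprod_jacobi[OF 9(1,2) v(1)] fst.finsum[OF f] by (simp add: pact_def)
    finally show "fst (pact n a (pact m b v) \<ominus>\<^bsub>pairs\<^esub> pact m b (pact n a v)) = fst (finsum pairs ?f {..n})" .
    have "snd (pact n a (pact m b v) \<ominus>\<^bsub>pairs\<^esub> pact m b (pact n a v)) =
        snd (pact n a (pact m b v)) \<ominus>\<^bsub>U\<^esub> snd (pact m b (pact n a v))"
      using 9 cl by (subst snd.diff) (auto simp del: pairs_simps)
    also have "\<dots> = (ad n a (ad m b (snd v)) \<oplus>\<^bsub>U\<^esub> (ad n a (coc m b (fst v)) \<oplus>\<^bsub>U\<^esub> coc n a (nprod L m b (fst v)))) \<ominus>\<^bsub>U\<^esub>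
        (ad m b (ad n a (snd v)) \<oplus>\<^bsub>U\<^esub> (ad m b (coc n a (fst v)) \<oplus>\<^bsub>U\<^esub> coc m b (nprod L n a (fst v))))"
      using 9 v by (simp add: pact_def ad_add_right U.M.a_assoc)
    \<comment> \<open>Separated into the part in \<open>snd v\<close>, governed by
      \<open>ad_commutator\<close>, and the part in \<open>fst v\<close>, which is the cocycle
      condition.\<close>
    also have "\<dots> = (ad n a (ad m b (snd v)) \<ominus>\<^bsub>U\<^esub> ad m b (ad n a (snd v))) \<oplus>\<^bsub>U\<^esub>
        ((ad n a (coc m b (fst v)) \<oplus>\<^bsub>U\<^esub> coc n a (nprod L m b (fst v))) \<ominus>\<^bsub>U\<^esub>
         (ad m b (coc n a (fst v)) \<oplus>\<^bsub>U\<^esub> coc m b (nprod L n a (fst v))))"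
      using 9 v by (intro U.diff_add_diff) auto
    also have "\<dots> = (\<Oplus>\<^bsub>U\<^esub>s\<in>{..n}. of_nat (n choose s) \<odot>\<^bsub>U\<^esub> ad (m + s) (nprod L (n - s) a b) (snd v)) \<oplus>\<^bsub>U\<^esub>
        (\<Oplus>\<^bsub>U\<^esub>s\<in>{..n}. of_nat (n choose s) \<odot>\<^bsub>U\<^esub> coc (m + s) (nprod L (n - s) a b) (fst v))"
      using 9 v by (simp only: ad_commutator cocycle)
    also have "\<dots> = snd (finsum pairs ?f {..n})"
      unfolding snd.finsum[OF f] using 9 v
      by (subst U.M.finsum_addf[symmetric])
        (auto simp: pact_def U.smult_add_right simp del: U.M.finsum_addf intro!: U.M.finsum_cong')
    finally show "snd (pact n a (pact m b v) \<ominus>\<^bsub>pairs\<^esub> pact m b (pact n a v)) = snd (finsum pairs ?f {..n})" .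
  qed
qed

text \<open>Locality leaves finitely many nonzero products of two generators, and by the D-rules the
  products of all pairs lie in the \<open>H\<close>-span of these.\<close>

lemma U2_generated:
  assumes S: "finite S" "S \<subseteq> carrier L" "L.span S = carrier L"
  shows "\<exists>T. finite T \<and> T \<subseteq> U2 \<and> U.span T = U2"
proof -
  have "\<exists>K. \<forall>k>K. lm k x (\<iota> y) = \<zero>\<^bsub>U\<^esub>" if "x \<in> S" "y \<in> S" for x y
    using that S by (intro U.eventually_zero) auto
  then obtain K where K: "\<And>x y k. x \<in> S \<Longrightarrow> y \<in> S \<Longrightarrow> k > K x y \<Longrightarrow> lm k x (\<iota> y) = \<zero>\<^bsub>U\<^esub>"
    by metis
  define T where "T = \<iota> ` S \<union> (\<Union>x\<in>S. \<Union>y\<in>S. (\<lambda>k. lm k x (\<iota> y)) ` {..K x y})"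
  have finT: "finite T" unfolding T_def using S by auto
  have TU: "T \<subseteq> U2" unfolding T_def using S by (auto intro!: U2.gen U2.prod)
  have TC: "T \<subseteq> carrier U" using TU U2_carrier by auto
  have sub: "LinearCombinations.submodule H (U.span T) U" using U.span_is_submodule[OF TC] .
  note sub' = U.submoduleD[OF sub]
  have \<iota>S: "\<iota> ` S \<subseteq> carrier U" using S by auto
  have gen: "\<iota> x \<in> U.span (\<iota> ` S)" if "x \<in> carrier L" for x
  proof -
    have "x \<in> L.span S" using that S by simp
    then show ?thesis using S(2)
    proof (induction rule: L.span_induct)
      case (base x)
      then show ?case using U.span_incl[OF \<iota>S] by auto
    qed (use U.submoduleD[OF U.span_is_submodule[OF \<iota>S]] in \<open>auto simp: \<iota>.add \<iota>.smult\<close>)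
  qed
  have prod: "lm k x (\<iota> y) \<in> U.span T" if "x \<in> carrier L" "y \<in> carrier L" for k x y
  proof (rule U.nprod_span[OF sub \<iota>S \<iota>S _ gen[OF that(1)] gen[OF that(2)]])
    fix n u v assume "u \<in> \<iota> ` S" "v \<in> \<iota> ` S"
    then obtain p q where pq: "p \<in> S" "q \<in> S" "u = \<iota> p" "v = \<iota> q" by blast
    show "nprod U n u v \<in> U.span T"
    proof (cases "n \<le> K p q")
      case True
      then have "nprod U n u v \<in> T" unfolding T_def pq using pq by blast
      then show ?thesis using U.span_incl[OF TC] by blast
    next
      case False
      then show ?thesis using K[of p q n] pq sub' by simp
    qed
  qed
  have "U2 \<subseteq> U.span T"
  proof
    fix t assume "t \<in> U2"
    then show "t \<in> U.span T"
    proof (induction rule: U2.induct)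
      case (gen x)
      have "U.span (\<iota> ` S) \<subseteq> U.span T" by (rule U.span_is_monotone) (auto simp: T_def)
      then show ?case using \<open>x \<in> carrier L \<Longrightarrow> \<iota> x \<in> U.span (\<iota> ` S)\<close> gen by blast
    qed (use prod sub' in auto)
  qed
  then show ?thesis using finT TU U.span_least[OF U2_submodule TU] by blast
qed

lemma pairs_finitely_generated:
  assumes "finitely_generated L"
  shows "finitely_generated pairs"
proof -
  obtain S where S: "finite S" "S \<subseteq> carrier L" "L.span S = carrier L"
    using assms unfolding finitely_generated_def by auto
  obtain T where T: "finite T" "T \<subseteq> U2" "U.span T = U2" using U2_generated[OF S] by blast
  define W where "W = (\<lambda>x. (x, \<zero>\<^bsub>U\<^esub>)) ` S \<union> (\<lambda>t. (\<zero>\<^bsub>L\<^esub>, t)) ` T"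
  have WC: "W \<subseteq> carrier pairs" unfolding W_def using S T U2.zero by auto
  note sub = pairs.submoduleD[OF pairs.span_is_submodule[OF WC]]
  have W: "W \<subseteq> pairs.span W" by (rule pairs.span_incl[OF WC])
  have "(x, \<zero>\<^bsub>U\<^esub>) \<in> pairs.span W" if "x \<in> carrier L" for x
  proof -
    have "x \<in> L.span S" using that S by simp
    then show ?thesis using S(2)
    proof (induction rule: L.span_induct)
      case (base x)
      then show ?case using W unfolding W_def by blast
    next
      case (add x y)
      then show ?case using sub(3)[of "(x, \<zero>\<^bsub>U\<^esub>)" "(y, \<zero>\<^bsub>U\<^esub>)"] by simp
    next
      case (smult h x)
      then show ?case using sub(4)[of "(x, \<zero>\<^bsub>U\<^esub>)" h] by simp
    qed (use sub(2) in simp)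
  qed
  moreover have "(\<zero>\<^bsub>L\<^esub>, t) \<in> pairs.span W" if "t \<in> U2" for t
  proof -
    have "t \<in> U.span T" "T \<subseteq> carrier U" using that T U2_carrier by auto
    then show ?thesis
    proof (induction rule: U.span_induct)
      case (base x)
      then show ?case using W unfolding W_def by blast
    next
      case (add x y)
      then show ?case using sub(3)[of "(\<zero>\<^bsub>L\<^esub>, x)" "(\<zero>\<^bsub>L\<^esub>, y)"] by simp
    next
      case (smult h x)
      then show ?case using sub(4)[of "(\<zero>\<^bsub>L\<^esub>, x)" h] by simp
    qed (use sub(2) in simp)
  qed
  ultimately have "carrier pairs \<subseteq> pairs.span W"
    using sub(3)[of "(_, \<zero>\<^bsub>U\<^esub>)" "(\<zero>\<^bsub>L\<^esub>, _)"] by (force simp: U2_carrier)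
  then have "pairs.span W = carrier pairs" using pairs.span_in_carrier[OF WC] by blast
  moreover have "finite W" unfolding W_def using S T by simp
  ultimately show ?thesis unfolding finitely_generated_def using WC by blast
qed

theorem finite_faithful_representation:
  assumes "finitely_generated L"
    and nontorsion: "\<And>a. a \<in> carrier L \<Longrightarrow> a \<noteq> \<zero>\<^bsub>L\<^esub> \<Longrightarrow>
      \<exists>n. \<exists>b\<in>carrier L. \<not> U.torsion (nprod U n (\<iota> a) (\<iota> b))"
  shows "\<exists>(M :: ('k poly, nat \<Rightarrow> 'k poly) module) act.
    conformal_representation L M act \<and> finitely_generated M \<and> free_module M \<and>
    faithful_action L M act"
proof (rule conformal_representation.free_representation[OF pact_representation
      pairs_finitely_generated[OF assms(1)]])
  fix a assume a: "a \<in> carrier L" "a \<noteq> \<zero>\<^bsub>L\<^esub>"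
  from nontorsion[OF this] obtain n b where b: "b \<in> carrier L" "\<not> U.torsion (lm n a (\<iota> b))" by blast
  have "\<not> pairs.torsion (pact (Suc n) a (b, \<zero>\<^bsub>U\<^esub>))"
  proof
    assume "pairs.torsion (pact (Suc n) a (b, \<zero>\<^bsub>U\<^esub>))"
    then obtain h where h: "h \<noteq> 0" "h \<odot>\<^bsub>U\<^esub> coc (Suc n) a b = \<zero>\<^bsub>U\<^esub>"
      unfolding pairs.torsion_def pact_def using a b by (auto simp: ad_zero_right)
    have "coc (Suc n) a b = (- of_nat (Suc n)) \<odot>\<^bsub>U\<^esub> lm n a (\<iota> b)"
      unfolding coc_def using a b by (simp add: \<iota>_D U.nprod_D_left del: of_nat_Suc)
    then have "(h * (- of_nat (Suc n))) \<odot>\<^bsub>U\<^esub> lm n a (\<iota> b) = \<zero>\<^bsub>U\<^esub>"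
      using h a b by (simp only: U.smult_mult U.nprod_closed \<iota>.closed)
    moreover have "h * (- of_nat (Suc n)) \<noteq> 0" using h by (simp del: of_nat_Suc)
    ultimately show False using b unfolding U.torsion_def by blast
  qed
  then show "\<exists>n. \<exists>v\<in>carrier pairs. \<not> pairs.torsion (pact n a v)"
    using b by (intro exI[of _ "Suc n"] bexI[of _ "(b, \<zero>\<^bsub>U\<^esub>)"]) (auto intro: U2.zero)
qed

end

section \<open>The commutative conformal algebra \<open>H t \<oplus> H t\<^sup>2\<close>\<close>

text \<open>In the nested polynomials the inner variable is D and the outer one \<lambda>.
  Coefficients become constants in D, and the outer variable is free for the substitution of
  -\<lambda> or D + \<lambda>.\<close>

definition lift_poly :: "'k::comm_ring_1 poly \<Rightarrow> 'k poly poly" where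
  "lift_poly p = map_poly (\<lambda>c. [:c:]) p"

lemma coeff_lift_poly [simp]: "coeff (lift_poly p) n = [:coeff p n:]"
  unfolding lift_poly_def by (rule coeff_map_poly) simp

lemma lift_poly_add: "lift_poly (p + q) = lift_poly p + lift_poly q"
  and lift_poly_scalar: "lift_poly ([:c:] * p) = [:[:c:]:] * lift_poly p"
  and lift_poly_pCons: "lift_poly (pCons c p) = pCons [:c:] (lift_poly p)"
  and lift_poly_0 [simp]: "lift_poly 0 = 0"
  and lift_poly_1 [simp]: "lift_poly 1 = 1"
  by (rule poly_eqI; simp add: coeff_pCons coeff_1 one_pCons split: nat.split)+

text \<open>The product \<open>p(-\<lambda>) q(D + \<lambda>)\<close>, a polynomial in \<open>\<lambda>\<close> with coefficients in \<open>k[D]\<close>. It is the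
  \<open>\<lambda>\<close>-product of \<open>p t\<close> and \<open>q t\<close> if that of \<open>t\<close> and \<open>t\<close> is \<open>t\<^sup>2\<close>.\<close>

definition lam_prod :: "'k::field_char_0 poly \<Rightarrow> 'k poly \<Rightarrow> 'k poly poly" where
  "lam_prod p q = pcompose (lift_poly p) [:0, - 1:] * pcompose (lift_poly q) [:[:0, 1:], 1:]"

text \<open>The factorial appears because n-th products are the coefficients of a \<lambda>-product
  with respect to \<lambda>^n / n!.\<close>

definition test_prod :: "nat \<Rightarrow> 'k::field_char_0 poly \<Rightarrow> 'k poly \<Rightarrow> 'k poly" where
  "test_prod n p q = fact n * coeff (lam_prod p q) n"

definition test_alg :: "('k::field_char_0 poly, 'k poly \<times> 'k poly) conf_alg" where
  "test_alg = \<lparr>carrier = UNIV, mult = undefined, one = undefined, zero = (0, 0),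
    add = \<lambda>x y. (fst x + fst y, snd x + snd y), smult = \<lambda>h x. (h * fst x, h * snd x),
    nprod = \<lambda>n x y. (0, test_prod n (fst x) (fst y))\<rparr>"

lemma test_alg_simps [simp]:
  "x \<in> carrier test_alg" "\<zero>\<^bsub>test_alg\<^esub> = (0, 0)"
  "x \<oplus>\<^bsub>test_alg\<^esub> y = (fst x + fst y, snd x + snd y)"
  "h \<odot>\<^bsub>test_alg\<^esub> x = (h * fst x, h * snd x)"
  "nprod test_alg n x y = (0, test_prod n (fst x) (fst y))"
  by (simp_all add: test_alg_def)

lemma test_prod_add_left: "test_prod n (p + p') q = test_prod n p q + test_prod n p' q"
  by (simp add: test_prod_def lam_prod_def lift_poly_add pcompose_add algebra_simps)

lemma test_prod_add_right: "test_prod n p (q + q') = test_prod n p q + test_prod n p q'"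
  by (simp add: test_prod_def lam_prod_def lift_poly_add pcompose_add algebra_simps)

lemma lam_prod_scalar_left: "lam_prod ([:c:] * p) q = Polynomial.smult [:c:] (lam_prod p q)"
  unfolding lam_prod_def lift_poly_scalar pcompose_mult pcompose_const by simp

lemma lam_prod_scalar_right: "lam_prod p ([:c:] * q) = Polynomial.smult [:c:] (lam_prod p q)"
  unfolding lam_prod_def lift_poly_scalar pcompose_mult pcompose_const by simp

lemma test_prod_scalar_left: "test_prod n ([:c:] * p) q = [:c:] * test_prod n p q"
  unfolding test_prod_def lam_prod_scalar_left coeff_smult by (rule mult.left_commute)

lemma test_prod_scalar_right: "test_prod n p ([:c:] * q) = [:c:] * test_prod n p q"
  unfolding test_prod_def lam_prod_scalar_right coeff_smult by (rule mult.left_commute)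

lemma test_prod_zero [simp]: "test_prod n 0 q = 0" "test_prod n p 0 = 0"
  by (simp_all add: test_prod_def lam_prod_def)

lemma fact_coeff_pCons: "fact n * coeff (pCons 0 g) n = of_nat n * (fact (n - 1) * coeff g (n - 1))"
  for g :: "'a::{comm_ring_1,semiring_char_0} poly"
  by (cases n) (simp_all add: algebra_simps)

text \<open>Multiplying p by D multiplies p(-\<lambda>) by -\<lambda>, and a factor \<lambda> shifts
  the index by \<open>fact_coeff_pCons\<close>.\<close>

lemma test_prod_D_left: "test_prod n ([:0, 1:] * p) q = - of_nat n * test_prod (n - 1) p q"
proof -
  have "lam_prod ([:0, 1:] * p) q = pCons 0 (- lam_prod p q)"
    by (simp add: lam_prod_def lift_poly_pCons pcompose_pCons)
  then show ?thesis
    unfolding test_prod_def fact_coeff_pCons by (simp add: fact_coeff_pCons)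
qed

lemma test_prod_D_right:
  "test_prod n p ([:0, 1:] * q) = [:0, 1:] * test_prod n p q + of_nat n * test_prod (n - 1) p q"
proof -
  have "lam_prod p ([:0, 1:] * q) = Polynomial.smult [:0, 1:] (lam_prod p q) + pCons 0 (lam_prod p q)"
    by (simp add: lam_prod_def lift_poly_pCons pcompose_pCons algebra_simps)
  then show ?thesis
    unfolding test_prod_def by (simp only: coeff_add coeff_smult distrib_left fact_coeff_pCons mult.left_commute)
qed

lemma test_prod_local: "finite {n. test_prod n p q \<noteq> 0}"
proof (rule finite_subset)
  show "{n. test_prod n p q \<noteq> 0} \<subseteq> {..degree (lam_prod p q)}"
    by (auto simp: test_prod_def intro: le_degree)
qed simp

lemma coeff_linear_power_all: "coeff ([:a, b:] ^ N) i = of_nat (N choose i) * b ^ i * a ^ (N - i)"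
  for a b :: "'a::comm_semiring_1"
proof (cases "i \<le> N")
  case False
  have "degree ([:a, b:] ^ N) \<le> degree [:a, b:] * N" by (rule degree_power_le)
  also have "\<dots> \<le> N" by simp
  finally show ?thesis using False by (simp add: coeff_eq_0 binomial_eq_0)
qed (rule coeff_linear_poly_power)

text \<open>Substituting -D - \<lambda> for \<lambda> turns \<open>lam_prod q p\<close> into
  \<open>lam_prod p q\<close>. The binomial expansion of the powers of -D - \<lambda> then produces
  the sum that defines the brace.\<close>

lemma test_prod_commute:
  assumes "\<And>k. k > n + K \<Longrightarrow> coeff (lam_prod q p) k = 0"
  shows "test_prod n p q = (\<Sum>s\<le>K. monom ((-1) ^ (n + s) / fact s) s * test_prod (n + s) q p)"
proof -
  let ?G = "lam_prod q p"
  have c: "pcompose (pcompose g r) t = pcompose g (pcompose r t)" for g r t :: "'a poly poly"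
    by (simp add: pcompose_assoc)
  have "lam_prod p q = pcompose ?G [:- [:0, 1:], - 1:]"
    by (simp add: lam_prod_def pcompose_mult c pcompose_pCons mult.commute)
  also have "coeff \<dots> n = (\<Sum>k\<le>degree ?G. coeff ?G k * coeff ([:- [:0, 1:], - 1:] ^ k) n)"
    unfolding pcompose_altdef poly_altdef
    by (simp add: degree_map_poly coeff_map_poly coeff_sum)
  also have "\<dots> = (\<Sum>k\<le>n + K. coeff ?G k * coeff ([:- [:0, 1:], - 1:] ^ k) n)"
    by (rule sum.mono_neutral_cong) (use assms in \<open>auto simp: coeff_eq_0 not_le\<close>)
  also have "\<dots> = (\<Sum>k\<in>{n..n + K}. coeff ?G k * coeff ([:- [:0, 1:], - 1:] ^ k) n)"
    by (rule sum.mono_neutral_right) (auto simp: coeff_linear_power_all binomial_eq_0)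
  also have "\<dots> = (\<Sum>s\<le>K. coeff ?G (n + s) * coeff ([:- [:0, 1:], - 1:] ^ (n + s)) n)"
    by (rule sum.reindex_bij_witness[of _ "\<lambda>s. n + s" "\<lambda>k. k - n"]) auto
  finally have "test_prod n p q =
      (\<Sum>s\<le>K. fact n * (coeff ?G (n + s) * coeff ([:- [:0, 1:], - 1:] ^ (n + s)) n))"
    by (simp add: test_prod_def sum_distrib_left)
  also have "\<dots> = (\<Sum>s\<le>K. monom ((-1) ^ (n + s) / fact s) s * test_prod (n + s) q p)"
  proof (rule sum.cong[OF refl])
    fix s
    have fp: "fact i = [:fact i :: 'a:]" for i
      using of_nat_poly[of "fact i", where ?'a = 'a] by simp
    have "fact n * of_nat ((n + s) choose n) = (fact (n + s) / fact s :: 'a)"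
      by (simp add: binomial_fact)
    then have f: "fact n * of_nat ((n + s) choose n) = [:fact (n + s) / fact s :: 'a:]"
      by (simp add: of_nat_poly fp[of n] mult.commute)
    have m: "(-1) ^ n * (- [:0, 1:]) ^ s = monom ((-1) ^ (n + s) :: 'a) s"
    proof -
      have "- [:0, 1:] = monom (- 1 :: 'a) 1" by (simp add: monom_altdef)
      moreover have "- 1 = monom (- 1 :: 'a) 0" by (simp add: monom_0 one_pCons)
      ultimately show ?thesis
        by (simp only: monom_power mult_monom power_add mult_1 mult_zero_left add_0)
    qed
    have "fact n * (coeff ?G (n + s) * coeff ([:- [:0, 1:], - 1:] ^ (n + s)) n) =
        (fact n * of_nat ((n + s) choose n)) * ((-1) ^ n * (- [:0, 1:]) ^ s) * coeff ?G (n + s)"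
      unfolding coeff_linear_power_all by (simp only: mult_ac diff_add_inverse)
    also have "\<dots> = [:fact (n + s) / fact s :: 'a:] * monom ((-1) ^ (n + s)) s * coeff ?G (n + s)"
      unfolding f m ..
    also have "[:fact (n + s) / fact s :: 'a:] * monom ((-1) ^ (n + s)) s =
        monom ((-1) ^ (n + s) / fact s) s * fact (n + s)"
      by (simp add: fp[of "n + s"] smult_monom mult.commute)
    finally show "fact n * (coeff ?G (n + s) * coeff ([:- [:0, 1:], - 1:] ^ (n + s)) n) =
        monom ((-1) ^ (n + s) / fact s) s * test_prod (n + s) q p"
      by (simp only: test_prod_def mult.assoc)
  qed
  finally show ?thesis .
qed

lemma test_alg_conformal: "conformal_algebra (test_alg :: ('k::field_char_0 poly, _) conf_alg)"
proof -
  have "Module.module (H :: 'k poly ring) test_alg"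
  proof (rule moduleI)
    show "cring (H :: 'k poly ring)" ..
    show "abelian_group (test_alg :: ('k poly, _) conf_alg)"
    proof (rule abelian_groupI)
      fix x :: "'k poly \<times> 'k poly"
      show "\<exists>y\<in>carrier test_alg. y \<oplus>\<^bsub>test_alg\<^esub> x = \<zero>\<^bsub>test_alg\<^esub>"
        by (intro bexI[of _ "(- fst x, - snd x)"]) auto
    qed (auto simp: add_ac)
  qed (auto simp: algebra_simps)
  then interpret Module.module "H :: 'k poly ring" "test_alg" .
  show ?thesis
    by unfold_locales
      (simp_all add: test_prod_add_left test_prod_add_right test_prod_scalar_left
        test_prod_scalar_right test_prod_D_left test_prod_D_right test_prod_local
        del: mult_pCons_left mult_pCons_right)
qed

lemma test_alg_comm: "comm_conformal_algebra (test_alg :: ('k::field_char_0 poly, _) conf_alg)"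
proof -
  interpret conformal_algebra "test_alg :: ('k poly, _) conf_alg" by (rule test_alg_conformal)
  have fs: "finsum test_alg f A = (\<Sum>s\<in>A. fst (f s), \<Sum>s\<in>A. snd (f s))" for f :: "nat \<Rightarrow> 'k poly \<times> 'k poly" and A
    by (induction A rule: infinite_finite_induct) (simp_all add: M.finsum_infinite M.finsum_insert)
  show ?thesis
  proof unfold_locales
    fix x y :: "'k poly \<times> 'k poly" and n
    define K where "K = degree (lam_prod (fst y) (fst x))"
    have K: "coeff (lam_prod (fst y) (fst x)) k = 0" if "k > n + K" for k
      using that by (simp add: K_def coeff_eq_0)
    have "nprod_brace test_alg n y x =
        (\<Oplus>\<^bsub>test_alg\<^esub>s\<in>{..K}. monom ((-1) ^ (n + s) / fact s) s \<odot>\<^bsub>test_alg\<^esub> nprod test_alg (n + s) y x)"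
      by (rule brace_eq) (simp_all add: test_prod_def K)
    also have "\<dots> = nprod test_alg n x y"
      unfolding fs using test_prod_commute[of n K "fst y" "fst x", OF K] by simp
    finally show "nprod test_alg n x y = nprod_brace test_alg n y x" ..
  \<comment> \<open>Associativity: every product has first component 0, so both sides
    vanish.\<close>
  qed (simp_all add: fs)
qed

text \<open>With the constant 1 on the right the second factor of \<open>lam_prod\<close> is 1, and
  only p(-\<lambda>) is left.\<close>

lemma coeff_lam_prod_1: "coeff (lam_prod p 1) n = [:(-1) ^ n * coeff p n:]"
proof -
  have "coeff (pcompose (lift_poly p) [:0, -1:]) n = [:(-1) ^ n * coeff p n:]"
  proof (induction p arbitrary: n)
    case (pCons c p)
    then show ?case by (cases n) (simp_all add: lift_poly_pCons pcompose_pCons)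
  qed simp
  then show ?thesis by (simp add: lam_prod_def pcompose_1)
qed

lemma test_prod_nonzero: "p \<noteq> 0 \<Longrightarrow> test_prod (degree p) p 1 \<noteq> 0"
  by (simp add: test_prod_def coeff_lam_prod_1)

section \<open>The associated graded algebra\<close>

context H_module
begin

lemma mem_coset:
  assumes "K \<subseteq> carrier M" "x \<in> carrier M"
  shows "y \<in> K +> x \<longleftrightarrow> y \<in> carrier M \<and> y \<ominus> x \<in> K"
proof
  assume "y \<in> K +> x"
  then obtain h where h: "h \<in> K" "y = h \<oplus> x" unfolding a_r_coset_def' by blast
  then have "h \<in> carrier M" using assms by blast
  then show "y \<in> carrier M \<and> y \<ominus> x \<in> K"
    using h assms by (simp add: a_minus_def M.a_assoc M.r_neg)
next
  assume y: "y \<in> carrier M \<and> y \<ominus> x \<in> K"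
  then have "y = (y \<ominus> x) \<oplus> x" using assms by (simp add: a_minus_def M.a_assoc M.l_neg)
  then show "y \<in> K +> x" unfolding a_r_coset_def' using y by blast
qed

context
  fixes K assumes K: "LinearCombinations.submodule H K M"
begin

lemma K_carrier: "K \<subseteq> carrier M"
  using submoduleD(1)[OF K] .

lemma K_neg: "x \<in> K \<Longrightarrow> \<ominus> x \<in> K"
  using submoduleD(1)[OF K] submoduleD(4)[OF K, of x "-1"] smult_uminus[of x 1] by auto

lemma K_diff: "x \<in> K \<Longrightarrow> y \<in> K \<Longrightarrow> x \<ominus> y \<in> K"
  unfolding a_minus_def using K_neg submoduleD(3)[OF K] by blast

lemma coset_self: "x \<in> carrier M \<Longrightarrow> x \<in> K +> x"
  using submoduleD(2)[OF K] K_carrier by (simp add: mem_coset a_minus_def M.r_neg)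

lemma coset_mem_eq:
  assumes "x \<in> carrier M" "y \<in> K +> x"
  shows "K +> y = K +> x"
proof -
  have y: "y \<in> carrier M" "y \<ominus> x \<in> K" using assms K_carrier by (auto simp: mem_coset)
  have tr: "z \<ominus> y = (z \<ominus> x) \<ominus> (y \<ominus> x)" if "z \<in> carrier M" for z
  proof -
    have "(z \<ominus> x) \<ominus> (y \<ominus> x) = (z \<ominus> y) \<ominus> (x \<ominus> x)"
      using that y assms by (intro diff_diff_diff) auto
    also have "x \<ominus> x = \<zero>" using assms by (simp add: a_minus_def M.r_neg)
    finally show ?thesis using that y by (simp add: a_minus_def)
  qed
  have tr': "z \<ominus> x = (z \<ominus> y) \<oplus> (y \<ominus> x)" if "z \<in> carrier M" for z
    using that y assms by (simp add: a_minus_def M.a_assoc M.r_neg1 M.r_neg2)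
  have "z \<ominus> y \<in> K \<longleftrightarrow> z \<ominus> x \<in> K" if z: "z \<in> carrier M" for z
  proof
    assume "z \<ominus> y \<in> K"
    then show "z \<ominus> x \<in> K" unfolding tr'[OF z] using y(2) by (rule submoduleD(3)[OF K])
  next
    assume "z \<ominus> x \<in> K"
    then show "z \<ominus> y \<in> K" unfolding tr[OF z] using y(2) by (rule K_diff)
  qed
  then show ?thesis
    by (auto simp: mem_coset[OF K_carrier y(1)] mem_coset[OF K_carrier assms(1)])
qed

lemma coset_zero: "x \<in> K \<Longrightarrow> K +> x = K"
proof -
  assume x: "x \<in> K"
  have "x \<in> K +> \<zero>" using x K_carrier by (auto simp: mem_coset a_minus_def)
  then have "K +> x = K +> \<zero>" by (rule coset_mem_eq[rotated]) simp
  also have "K +> \<zero> = K" using K_carrier by (auto simp: mem_coset a_minus_def)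
  finally show ?thesis .
qed

text \<open>This makes the multiples and products in \<open>gr_alg\<close> computable: a nonempty
  set of results inside one coset of \<open>K\<close> becomes that whole coset when \<open>K\<close>
  is added.\<close>

lemma set_add_coset:
  assumes w: "w \<in> carrier M" and Z: "Z \<noteq> {}" "Z \<subseteq> K +> w"
  shows "K <+>\<^bsub>M\<^esub> Z = K +> w"
proof (intro equalityI subsetI)
  fix v assume "v \<in> K <+>\<^bsub>M\<^esub> Z"
  then obtain k z where kz: "k \<in> K" "z \<in> Z" "v = k \<oplus> z" unfolding set_add_def' by blast
  then have z: "z \<in> carrier M" "z \<ominus> w \<in> K" "k \<in> carrier M" using Z w K_carrier by (auto simp: mem_coset)
  then have "v \<ominus> w = k \<oplus> (z \<ominus> w)" using kz w by (simp add: a_minus_def M.a_assoc)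
  then show "v \<in> K +> w" using kz z w K_carrier submoduleD(3)[OF K] by (simp add: mem_coset)
next
  fix v assume v: "v \<in> K +> w"
  obtain z where z: "z \<in> Z" using Z by blast
  then have "K +> z = K +> w" using coset_mem_eq[OF w] Z by blast
  then have "v \<in> K +> z" using v by simp
  then show "v \<in> K <+>\<^bsub>M\<^esub> Z" using z unfolding a_r_coset_def' set_add_def' by blast
qed

lemma coset_add:
  assumes x: "x \<in> carrier M" and y: "y \<in> carrier M"
  shows "(K +> x) <+>\<^bsub>M\<^esub> (K +> y) = K +> (x \<oplus> y)"
proof (intro equalityI subsetI)
  fix v assume "v \<in> (K +> x) <+>\<^bsub>M\<^esub> (K +> y)"
  then obtain a b where ab: "a \<in> K +> x" "b \<in> K +> y" "v = a \<oplus> b" unfolding set_add_def' by blast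
  then have *: "a \<in> carrier M" "b \<in> carrier M" "a \<ominus> x \<in> K" "b \<ominus> y \<in> K"
    using x y K_carrier by (auto simp: mem_coset)
  then have "v \<ominus> (x \<oplus> y) = (a \<ominus> x) \<oplus> (b \<ominus> y)" using ab x y diff_add_diff by simp
  then show "v \<in> K +> (x \<oplus> y)" using * ab x y K_carrier submoduleD(3)[OF K] by (simp add: mem_coset)
next
  fix v assume "v \<in> K +> (x \<oplus> y)"
  then obtain k where k: "k \<in> K" "v = k \<oplus> (x \<oplus> y)" unfolding a_r_coset_def' by blast
  moreover have "k \<in> carrier M" using k K_carrier by blast
  ultimately have "v = (k \<oplus> x) \<oplus> y" using x y by (simp add: M.a_assoc)
  moreover have "k \<oplus> x \<in> K +> x" using k unfolding a_r_coset_def' by blast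
  moreover have "y \<in> K +> y" using y by (rule coset_self)
  ultimately show "v \<in> (K +> x) <+>\<^bsub>M\<^esub> (K +> y)" unfolding set_add_def' by blast
qed

lemma coset_smult:
  assumes x: "x \<in> carrier M"
  shows "K <+>\<^bsub>M\<^esub> (\<lambda>y. h \<odot>\<^bsub>M\<^esub> y) ` (K +> x) = K +> (h \<odot>\<^bsub>M\<^esub> x)"
proof (rule set_add_coset)
  show "(\<lambda>y. h \<odot>\<^bsub>M\<^esub> y) ` (K +> x) \<noteq> {}" using coset_self[OF x] by blast
  show "(\<lambda>y. h \<odot>\<^bsub>M\<^esub> y) ` (K +> x) \<subseteq> K +> (h \<odot>\<^bsub>M\<^esub> x)"
    using x K_carrier submoduleD(4)[OF K] by (auto simp: mem_coset smult_diff_right[symmetric])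
qed (use x in auto)

lemma finsum_in_K: "(\<And>s. s \<in> A \<Longrightarrow> f s \<in> K) \<Longrightarrow> finsum M f A \<in> K"
proof (induction A rule: infinite_finite_induct)
  case (insert s A)
  then show ?case using K_carrier submoduleD(3)[OF K] by (subst M.finsum_insert) auto
qed (use submoduleD(2)[OF K] in \<open>auto simp: M.finsum_infinite\<close>)

end

end

section \<open>The filtration and homogeneous elements of the graded algebra\<close>

lemma conf_monomial_pos: "conf_monomial C X k x \<Longrightarrow> 1 \<le> k"
  by (induction rule: conf_monomial.induct) auto

locale filtered_algebra = assoc_conformal_algebra U
  for U :: "('k::field_char_0 poly, 'u) conf_alg" (structure) +
  fixes X :: "'u set"
  assumes X: "X \<subseteq> carrier U"
begin

abbreviation "Fil \<equiv> env_filtration U X"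
abbreviation "G \<equiv> gr_alg U X"

lemma monomial_carrier: "conf_monomial U X k x \<Longrightarrow> x \<in> carrier U"
  by (induction rule: conf_monomial.induct) (use X in auto)

lemma Fil_gens: "{x. \<exists>k\<in>{1..n}. conf_monomial U X k x} \<subseteq> carrier U"
  using monomial_carrier by auto

lemma Fil_submodule: "LinearCombinations.submodule H (Fil n) U"
  unfolding env_filtration_def by (rule span_is_submodule[OF Fil_gens])

lemmas Fil = submoduleD[OF Fil_submodule]

lemma Fil_carrier: "x \<in> Fil n \<Longrightarrow> x \<in> carrier U"
  using Fil(1) by blast

lemma Fil_mono: "m \<le> n \<Longrightarrow> Fil m \<subseteq> Fil n"
  unfolding env_filtration_def by (rule span_is_monotone) auto

lemma Fil_0: "Fil 0 = {\<zero>}"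
proof -
  have "Fil 0 = span {}" by (simp add: env_filtration_def)
  also have "span {} = {\<zero>}" by (auto simp: span_def lincomb_def)
  finally show ?thesis .
qed

lemma Fil_monomial: "conf_monomial U X k x \<Longrightarrow> x \<in> Fil k"
  unfolding env_filtration_def using span_incl[OF Fil_gens] conf_monomial_pos by fastforce

lemma Fil_nprod:
  assumes "x \<in> Fil k" "y \<in> Fil l"
  shows "nprod U j x y \<in> Fil (k + l)"
proof (rule nprod_span[OF Fil_submodule Fil_gens Fil_gens])
  show "x \<in> span {x. \<exists>i\<in>{1..k}. conf_monomial U X i x}" "y \<in> span {x. \<exists>i\<in>{1..l}. conf_monomial U X i x}"
    using assms by (simp_all add: env_filtration_def)
  fix n u v
  assume "u \<in> {x. \<exists>i\<in>{1..k}. conf_monomial U X i x}" "v \<in> {x. \<exists>i\<in>{1..l}. conf_monomial U X i x}"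
  then obtain i i' where i: "i \<le> k" "i' \<le> l" "conf_monomial U X i u" "conf_monomial U X i' v" by auto
  then have "nprod U n u v \<in> Fil (i + i')" by (intro Fil_monomial conf_monomial.intros)
  then show "nprod U n u v \<in> Fil (k + l)" using Fil_mono[of "i + i'" "k + l"] i by auto
qed

text \<open>The element of the graded algebra with representative \<open>r n\<close> in degree
  \<open>n\<close>. Operations on cosets are reduced to operations on such representatives.\<close>

definition cls :: "(nat \<Rightarrow> 'u) \<Rightarrow> nat \<Rightarrow> 'u set" where
  "cls r = (\<lambda>n. Fil (n - 1) +> r n)"

lemma G_simps:
  "carrier G = {f. (\<forall>n. \<exists>x\<in>Fil n. f n = Fil (n - 1) +> x) \<and> finite {n. f n \<noteq> Fil (n - 1)}}"
  "f \<oplus>\<^bsub>G\<^esub> g = (\<lambda>n. f n <+>\<^bsub>U\<^esub> g n)"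
  "h \<odot>\<^bsub>G\<^esub> f = (\<lambda>n. Fil (n - 1) <+>\<^bsub>U\<^esub> (\<lambda>x. h \<odot>\<^bsub>U\<^esub> x) ` f n)"
  "nprod G j f g = (\<lambda>n. Fil (n - 1) <+>\<^bsub>U\<^esub>
       {\<Oplus>k\<in>{..n}. nprod U j (x k) (y (n - k)) | x y. \<forall>k. x k \<in> f k \<and> y k \<in> g k})"
  by (simp_all add: gr_alg_def Let_def)

lemma cls_closed:
  assumes "\<And>n. r n \<in> Fil n" "finite {n. r n \<noteq> \<zero>}"
  shows "cls r \<in> carrier G"
proof -
  have "{n. cls r n \<noteq> Fil (n - 1)} \<subseteq> {n. r n \<noteq> \<zero>}"
    unfolding cls_def using coset_zero[OF Fil_submodule Fil(2)] by auto
  then show ?thesis unfolding G_simps using assms finite_subset by (auto simp: cls_def)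
qed

lemma cls_add:
  "(\<And>n. r n \<in> Fil n) \<Longrightarrow> (\<And>n. s n \<in> Fil n) \<Longrightarrow> cls r \<oplus>\<^bsub>G\<^esub> cls s = cls (\<lambda>n. r n \<oplus> s n)"
  unfolding G_simps cls_def using coset_add[OF Fil_submodule] Fil_carrier by blast

lemma cls_smult:
  "(\<And>n. r n \<in> Fil n) \<Longrightarrow> h \<odot>\<^bsub>G\<^esub> cls r = cls (\<lambda>n. h \<odot>\<^bsub>U\<^esub> r n)"
  unfolding G_simps cls_def using coset_smult[OF Fil_submodule] Fil_carrier by blast

text \<open>Lowering one factor lowers the product, so the graded product does not depend on
  representatives. Degree 0 is separate because of truncated subtraction: there a factor lies in
  \<open>Fil 0\<close> and is zero.\<close>

lemma Fil_nprod_pred: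
  assumes "(x \<in> Fil (k - 1) \<and> y \<in> Fil l) \<or> (x \<in> Fil k \<and> y \<in> Fil (l - 1))"
  shows "nprod U j x y \<in> Fil (k + l - 1)"
  using assms
proof (elim disjE conjE)
  assume xy: "x \<in> Fil (k - 1)" "y \<in> Fil l"
  show ?thesis
  proof (cases k)
    case 0
    then show ?thesis using xy Fil_0 Fil(2) Fil_carrier by auto
  next
    case (Suc k')
    then show ?thesis using Fil_nprod[OF xy, of j] by simp
  qed
next
  assume xy: "x \<in> Fil k" "y \<in> Fil (l - 1)"
  show ?thesis
  proof (cases l)
    case 0
    then show ?thesis using xy Fil_0 Fil(2) Fil_carrier by auto
  next
    case (Suc l')
    then show ?thesis using Fil_nprod[OF xy, of j] by simp
  qed
qed

lemma cls_nprod: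
  assumes r: "\<And>n. r n \<in> Fil n" and s: "\<And>n. s n \<in> Fil n"
  shows "nprod G j (cls r) (cls s) = cls (\<lambda>n. \<Oplus>k\<in>{..n}. nprod U j (r k) (s (n - k)))"
proof
  fix n
  let ?Z = "{\<Oplus>k\<in>{..n}. nprod U j (x k) (y (n - k)) | x y. \<forall>k. x k \<in> cls r k \<and> y k \<in> cls s k}"
  let ?w = "\<Oplus>k\<in>{..n}. nprod U j (r k) (s (n - k))"
  have rC: "r k \<in> carrier U" and sC: "s k \<in> carrier U" for k using r s Fil_carrier by blast+
  have "r k \<in> cls r k \<and> s k \<in> cls s k" for k
    unfolding cls_def using coset_self[OF Fil_submodule] rC sC by blast
  then have ne: "?Z \<noteq> {}" by blast
  have "?Z \<subseteq> Fil (n - 1) +> ?w"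
  proof
    fix z assume "z \<in> ?Z"
    then obtain x y where z: "z = (\<Oplus>k\<in>{..n}. nprod U j (x k) (y (n - k)))"
      and xy: "\<And>k. x k \<in> cls r k" "\<And>k. y k \<in> cls s k" by blast
    have x: "x k \<in> carrier U" "x k \<ominus> r k \<in> Fil (k - 1)" for k
      using xy(1)[of k] rC Fil(1) unfolding cls_def by (auto simp: mem_coset)
    have y: "y k \<in> carrier U" "y k \<ominus> s k \<in> Fil (k - 1)" for k
      using xy(2)[of k] sC Fil(1) unfolding cls_def by (auto simp: mem_coset)
    have yF: "y k \<in> Fil k" for k
    proof -
      have "y k = (y k \<ominus> s k) \<oplus> s k" using y(1) sC by (simp add: a_minus_def M.a_assoc M.l_neg)
      moreover have "y k \<ominus> s k \<in> Fil k" using y(2) Fil_mono[of "k - 1" k] by auto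
      ultimately show ?thesis using Fil(3) s by metis
    qed
    have "nprod U j (x k) (y (n - k)) \<ominus> nprod U j (r k) (s (n - k)) \<in> Fil (n - 1)" if k: "k \<in> {..n}" for k
    proof -
      \<comment> \<open>The difference telescopes through the mixed product \<open>?b\<close>,
        changing one factor at a time.\<close>
      let ?a = "nprod U j (x k) (y (n - k))" and ?b = "nprod U j (r k) (y (n - k))"
        and ?c = "nprod U j (r k) (s (n - k))"
      have "?a \<ominus> ?b = nprod U j (x k \<ominus> r k) (y (n - k))" "?b \<ominus> ?c = nprod U j (r k) (y (n - k) \<ominus> s (n - k))"
        using x y rC sC by (simp_all add: nprod_diff_left nprod_diff_right)
      moreover have "nprod U j (x k \<ominus> r k) (y (n - k)) \<in> Fil (k + (n - k) - 1)"
        by (rule Fil_nprod_pred, rule disjI1, rule conjI[OF x(2) yF])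
      moreover have "nprod U j (r k) (y (n - k) \<ominus> s (n - k)) \<in> Fil (k + (n - k) - 1)"
        by (rule Fil_nprod_pred, rule disjI2, rule conjI[OF r y(2)])
      ultimately have "?a \<ominus> ?b \<in> Fil (k + (n - k) - 1)" "?b \<ominus> ?c \<in> Fil (k + (n - k) - 1)"
        by simp_all
      then have "(?a \<ominus> ?b) \<oplus> (?b \<ominus> ?c) \<in> Fil (n - 1)" using Fil(3) k by simp
      moreover have "(?a \<ominus> ?b) \<oplus> (?b \<ominus> ?c) = ?a \<ominus> ?c"
        using x y rC sC by (simp add: a_minus_def M.a_assoc M.r_neg1 M.r_neg2)
      ultimately show ?thesis by simp
    qed
    then have "(\<Oplus>k\<in>{..n}. nprod U j (x k) (y (n - k)) \<ominus> nprod U j (r k) (s (n - k))) \<in> Fil (n - 1)"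
      by (rule finsum_in_K[OF Fil_submodule])
    then have "z \<ominus> ?w \<in> Fil (n - 1)"
      unfolding z using x y rC sC by (subst finsum_diff) auto
    moreover have "z \<in> carrier U" unfolding z using x y by auto
    ultimately show "z \<in> Fil (n - 1) +> ?w"
      using Fil(1) rC sC by (subst mem_coset) auto
  qed
  then have "Fil (n - 1) <+>\<^bsub>U\<^esub> ?Z = Fil (n - 1) +> ?w"
    using ne rC sC by (intro set_add_coset[OF Fil_submodule]) auto
  then show "nprod G j (cls r) (cls s) n = cls (\<lambda>n. \<Oplus>k\<in>{..n}. nprod U j (r k) (s (n - k))) n"
    unfolding G_simps cls_def .
qed

text \<open>The symbol of \<open>x\<close>: for \<open>x\<close> in \<open>Fil n\<close>, its class
  as a homogeneous element of degree \<open>n\<close>.\<close>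

definition symb :: "nat \<Rightarrow> 'u \<Rightarrow> nat \<Rightarrow> 'u set" where
  "symb n x = cls (\<lambda>m. if m = n then x else \<zero>)"

lemma symb_closed: "x \<in> Fil n \<Longrightarrow> symb n x \<in> carrier G"
  unfolding symb_def by (rule cls_closed) (auto simp: Fil(2))

lemma symb_add: "x \<in> Fil n \<Longrightarrow> y \<in> Fil n \<Longrightarrow> symb n (x \<oplus> y) = symb n x \<oplus>\<^bsub>G\<^esub> symb n y"
  unfolding symb_def by (subst cls_add) (auto simp: Fil(2) intro!: arg_cong[where f = cls])

lemma symb_smult: "x \<in> Fil n \<Longrightarrow> symb n (h \<odot>\<^bsub>U\<^esub> x) = h \<odot>\<^bsub>G\<^esub> symb n x"
  unfolding symb_def by (subst cls_smult) (auto simp: Fil(2) intro!: arg_cong[where f = cls])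

lemma symb_lower: "x \<in> Fil (n - 1) \<Longrightarrow> symb n x = symb n \<zero>"
  unfolding symb_def cls_def using coset_zero[OF Fil_submodule] Fil(2) by auto

lemma symb_nprod:
  assumes x: "x \<in> Fil k" and y: "y \<in> Fil l"
  shows "nprod G j (symb k x) (symb l y) = symb (k + l) (nprod U j x y)"
proof -
  have xy: "x \<in> carrier U" "y \<in> carrier U" using x y Fil_carrier by auto
  have "nprod G j (symb k x) (symb l y) =
      cls (\<lambda>n. \<Oplus>i\<in>{..n}. nprod U j (if i = k then x else \<zero>) (if n - i = l then y else \<zero>))"
    unfolding symb_def by (rule cls_nprod) (use x y Fil(2) in auto)
  also have "(\<lambda>n. \<Oplus>i\<in>{..n}. nprod U j (if i = k then x else \<zero>) (if n - i = l then y else \<zero>)) =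
      (\<lambda>n. if n = k + l then nprod U j x y else \<zero>)"
  proof
    fix n
    have "(\<Oplus>i\<in>{..n}. nprod U j (if i = k then x else \<zero>) (if n - i = l then y else \<zero>)) =
        lc {..n} (\<lambda>_. nprod U j x y) (\<lambda>i. if i = k then (if n = k + l then 1 else 0) else 0)"
      unfolding lc_def by (rule M.finsum_cong') (use xy in auto)
    also have "\<dots> = (if n = k + l then nprod U j x y else \<zero>)"
    proof (cases "k \<le> n")
      case True
      then show ?thesis using xy by (subst lc_unit) auto
    next
      case False
      then show ?thesis using xy by (subst lc_zero) auto
    qed
    finally show "(\<Oplus>i\<in>{..n}. nprod U j (if i = k then x else \<zero>) (if n - i = l then y else \<zero>)) =
        (if n = k + l then nprod U j x y else \<zero>)" .
  qed
  finally show ?thesis by (simp add: symb_def)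
qed

section \<open>Homomorphisms from the graded algebra to the test algebra\<close>

context
  fixes \<chi> assumes \<chi>: "\<chi> \<in> conf_hom G test_alg"
begin

lemma hom_add: "f \<in> carrier G \<Longrightarrow> g \<in> carrier G \<Longrightarrow> fst (\<chi> (f \<oplus>\<^bsub>G\<^esub> g)) = fst (\<chi> f) + fst (\<chi> g)"
  and hom_smult: "f \<in> carrier G \<Longrightarrow> \<chi> (h \<odot>\<^bsub>G\<^esub> f) = (h * fst (\<chi> f), h * snd (\<chi> f))"
  and hom_nprod: "f \<in> carrier G \<Longrightarrow> g \<in> carrier G \<Longrightarrow>
    \<chi> (nprod G j f g) = (0, test_prod j (fst (\<chi> f)) (fst (\<chi> g)))"
  using \<chi> by (auto simp: conf_hom_def LinearCombinations.module_hom_def)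

lemma hom_symb_zero: "\<chi> (symb n \<zero>) = (0, 0)"
proof -
  have "0 \<odot>\<^bsub>G\<^esub> symb n \<zero> = symb n \<zero>" using symb_smult[OF Fil(2), of n 0] by simp
  moreover have "\<chi> (0 \<odot>\<^bsub>G\<^esub> symb n \<zero>) = (0, 0)" using hom_smult[OF symb_closed[OF Fil(2)], of 0] by simp
  ultimately show ?thesis by (simp only:)
qed

text \<open>Products span \<open>gr U\<close> in degrees at least 2.\<close>

lemma hom_symb_decomposable:
  assumes n: "n \<ge> 2" and x: "x \<in> Fil n"
  shows "fst (\<chi> (symb n x)) = 0"
proof -
  let ?S = "{x \<in> Fil n. fst (\<chi> (symb n x)) = 0}"
  have "LinearCombinations.submodule H ?S U"
    by (intro submoduleI')
      (auto simp: Fil(2-) Fil_carrier hom_symb_zero symb_add symb_smult hom_add hom_smult symb_closed)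
  moreover have "{x. \<exists>k\<in>{1..n}. conf_monomial U X k x} \<subseteq> ?S"
  proof
    fix x assume "x \<in> {x. \<exists>k\<in>{1..n}. conf_monomial U X k x}"
    then obtain k where k: "k \<le> n" "conf_monomial U X k x" by auto
    have xn: "x \<in> Fil n" using Fil_monomial[OF k(2)] Fil_mono[OF k(1)] by blast
    have "fst (\<chi> (symb n x)) = 0"
    proof (cases "k = n")
      case False
      then have "k \<le> n - 1" using k(1) by linarith
      then have "x \<in> Fil (n - 1)" using Fil_monomial[OF k(2)] Fil_mono by blast
      then show ?thesis by (simp add: symb_lower hom_symb_zero)
    next
      case True
      with k(2) n show ?thesis
      proof (cases rule: conf_monomial.cases)
        \<comment> \<open>A monomial of degree at least 2 is a product, and a product of symbols is
          mapped into H t^2, where the coefficient of t is 0.\<close>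
        case (2 k' u l' v j)
        then have uv: "u \<in> Fil k'" "v \<in> Fil l'" by (auto intro: Fil_monomial)
        have "symb n x = nprod G j (symb k' u) (symb l' v)"
          unfolding symb_nprod[OF uv] using 2 True by simp
        then show ?thesis by (simp add: hom_nprod symb_closed uv)
      qed auto
    qed
    then show "x \<in> ?S" using xn by simp
  qed
  ultimately have "span {x. \<exists>k\<in>{1..n}. conf_monomial U X k x} \<subseteq> ?S" by (rule span_least)
  then show ?thesis using x by (auto simp: env_filtration_def)
qed

end

text \<open>\<open>x\<close> represents the component of \<open>f\<close> in degree 1: degree 0 is
  trivial, and higher degrees are killed by \<open>hom_symb_decomposable\<close>. It is chosen
  before \<open>\<chi>\<close>, so that one element serves the homomorphisms for all
  \<open>b \<in> B\<close>.\<close>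

lemma hom_degree_one:
  assumes f: "f \<in> carrier G"
  shows "\<exists>x\<in>Fil 1. \<forall>\<chi>\<in>conf_hom G test_alg. fst (\<chi> f) = fst (\<chi> (symb 1 x))"
proof -
  have main: "\<exists>x\<in>Fil 1. \<forall>\<chi>\<in>conf_hom G test_alg. fst (\<chi> (cls r)) = fst (\<chi> (symb 1 x))"
    if "finite N" "\<And>n. r n \<in> Fil n" "{n. r n \<noteq> \<zero>} \<subseteq> N" for N r
    using that
  proof (induction N arbitrary: r rule: finite_induct)
    case empty
    then have "cls r = symb 1 \<zero>" unfolding symb_def by (intro arg_cong[where f = cls]) auto
    then show ?case using Fil(2) by metis
  next
    case (insert n N)
    let ?r = "r(n := \<zero>)"
    have r': "?r m \<in> Fil m" for m using insert.prems Fil(2) by simp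
    have sub: "{m. ?r m \<noteq> \<zero>} \<subseteq> N" using insert.prems by auto
    from insert.IH[OF r' sub] obtain x where x: "x \<in> Fil 1"
      "\<And>\<chi>. \<chi> \<in> conf_hom G test_alg \<Longrightarrow> fst (\<chi> (cls ?r)) = fst (\<chi> (symb 1 x))" by blast
    have "cls r = cls ?r \<oplus>\<^bsub>G\<^esub> symb n (r n)"
      unfolding symb_def using insert.prems(1) Fil(2) Fil_carrier[OF insert.prems(1)]
      by (subst cls_add) (auto intro!: arg_cong[where f = cls])
    moreover have "cls ?r \<in> carrier G"
      using r' finite_subset[OF sub insert.hyps(1)] by (rule cls_closed)
    moreover have rn: "r n \<in> Fil n" using insert.prems by simp
    ultimately have eq: "fst (\<chi> (cls r)) = fst (\<chi> (symb 1 x)) + fst (\<chi> (symb n (r n)))"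
      if "\<chi> \<in> conf_hom G test_alg" for \<chi>
      using that x(2) hom_add symb_closed by metis
    consider "n = 0" | "n = 1" | "n \<ge> 2" by linarith
    then show ?case
    proof cases
      case 1
      then have "r n = \<zero>" using rn Fil_0 by simp
      then show ?thesis using eq x(1) hom_symb_zero by fastforce
    next
      case 2
      then have "fst (\<chi> (cls r)) = fst (\<chi> (symb 1 (x \<oplus> r n)))" if "\<chi> \<in> conf_hom G test_alg" for \<chi>
        using that eq x(1) rn by (simp add: symb_add hom_add symb_closed)
      then show ?thesis using Fil(3)[of x 1 "r n"] x(1) rn 2 by auto
    next
      case 3
      then have "fst (\<chi> (cls r)) = fst (\<chi> (symb 1 x))" if "\<chi> \<in> conf_hom G test_alg" for \<chi>
        using eq[OF that] hom_symb_decomposable[OF that 3 rn] by simp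
      then show ?thesis using x(1) by blast
    qed
  qed
  \<comment> \<open>Trivial cosets are represented by zero, so that the finite support of
    \<open>f\<close> passes to \<open>r\<close>.\<close>
  have "\<forall>n. \<exists>x. x \<in> Fil n \<and> f n = Fil (n - 1) +> x \<and> (f n = Fil (n - 1) \<longrightarrow> x = \<zero>)"
  proof
    fix n
    obtain x where x: "x \<in> Fil n" "f n = Fil (n - 1) +> x" using f unfolding G_simps by auto
    show "\<exists>x. x \<in> Fil n \<and> f n = Fil (n - 1) +> x \<and> (f n = Fil (n - 1) \<longrightarrow> x = \<zero>)"
      using x Fil(2) coset_zero[OF Fil_submodule, of "\<zero>" "n - 1"] by (cases "f n = Fil (n - 1)") auto
  qed
  then obtain r where r: "\<And>n. r n \<in> Fil n" "\<And>n. f n = Fil (n - 1) +> r n"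
    "\<And>n. f n = Fil (n - 1) \<Longrightarrow> r n = \<zero>" by metis
  have f_eq: "f = cls r" unfolding cls_def using r(2) by auto
  have fin: "finite {n. f n \<noteq> Fil (n - 1)}" using f unfolding G_simps by auto
  have "{n. r n \<noteq> \<zero>} \<subseteq> {n. f n \<noteq> Fil (n - 1)}" using r(3) by blast
  from main[OF fin r(1) this] show ?thesis unfolding f_eq .
qed

end

section \<open>Linear algebra over a domain\<close>

text \<open>The right inverse gives det P det c = 1, so det P is nonzero, and the adjugate turns P v
  = 0 into (det P) v = 0. This is the injectivity of a surjective endomorphism of a free module of
  finite rank.\<close>

lemma right_invertible_injective:
  fixes P :: "'b \<Rightarrow> 'b \<Rightarrow> 'a::idom"
  assumes B: "finite B"
    and inv: "\<And>a b. a \<in> B \<Longrightarrow> b \<in> B \<Longrightarrow> (\<Sum>k\<in>B. P a k * c k b) = (if a = b then 1 else 0)"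
    and v: "\<And>a. a \<in> B \<Longrightarrow> (\<Sum>k\<in>B. P a k * v k) = 0"
    and b: "b \<in> B"
  shows "v b = 0"
proof -
  define r where "r = card B"
  obtain e where e: "bij_betw e {0..<r} B" using ex_bij_betw_nat_finite[OF B] unfolding r_def by auto
  have eB: "e i \<in> B" if "i < r" for i using bij_betwE[OF e] that by auto
  have sum: "(\<Sum>i<r. g (e i)) = sum g B" for g :: "'b \<Rightarrow> 'a"
    using sum.reindex_bij_betw[OF e, of g] by (simp add: atLeast0LessThan)
  define A where "A = mat r r (\<lambda>(i, j). P (e i) (e j))"
  define C where "C = mat r r (\<lambda>(i, j). c (e i) (e j))"
  define w where "w = vec r (\<lambda>i. v (e i))"
  have dims: "A \<in> carrier_mat r r" "C \<in> carrier_mat r r" "w \<in> carrier_vec r"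
    by (simp_all add: A_def C_def w_def)
  have "A * C = 1\<^sub>m r"
  proof (rule eq_matI)
    fix i j assume "i < dim_row (1\<^sub>m r :: 'a mat)" "j < dim_col (1\<^sub>m r :: 'a mat)"
    then have ij: "i < r" "j < r" by auto
    have "(A * C) $$ (i, j) = (\<Sum>k<r. P (e i) (e k) * c (e k) (e j))"
      using ij by (simp add: A_def C_def scalar_prod_def atLeast0LessThan)
    also have "\<dots> = (if e i = e j then 1 else 0)"
      using sum[of "\<lambda>k. P (e i) k * c k (e j)"] inv[OF eB[OF ij(1)] eB[OF ij(2)]] by simp
    also have "e i = e j \<longleftrightarrow> i = j"
      using e ij by (auto simp: bij_betw_def inj_on_def)
    finally show "(A * C) $$ (i, j) = 1\<^sub>m r $$ (i, j)" using ij by simp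
  qed (auto simp: A_def C_def)
  then have "det A * det C = 1" using det_mult[OF dims(1,2)] by simp
  then have det: "det A \<noteq> 0" by auto
  have "A *\<^sub>v w = 0\<^sub>v r"
  proof (rule eq_vecI)
    fix i assume "i < dim_vec (0\<^sub>v r :: 'a vec)"
    then have i: "i < r" by simp
    have "(A *\<^sub>v w) $ i = (\<Sum>k<r. P (e i) (e k) * v (e k))"
      using i by (simp add: A_def w_def scalar_prod_def atLeast0LessThan)
    also have "\<dots> = 0" using sum[of "\<lambda>k. P (e i) k * v k"] v[OF eB[OF i]] by simp
    finally show "(A *\<^sub>v w) $ i = 0\<^sub>v r $ i" using i by simp
  qed (simp add: A_def)
  then have "(adj_mat A * A) *\<^sub>v w = adj_mat A *\<^sub>v 0\<^sub>v r"
    using assoc_mult_mat_vec[OF adj_mat(1)[OF dims(1)] dims(1,3)] by simp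
  also have "\<dots> = 0\<^sub>v r" using adj_mat(1)[OF dims(1)] by (intro eq_vecI) auto
  finally have z: "(det A \<cdot>\<^sub>m 1\<^sub>m r) *\<^sub>v w = 0\<^sub>v r" unfolding adj_mat(3)[OF dims(1)] .
  obtain i where i: "i < r" "e i = b" using bij_betw_imp_surj_on[OF e] b by auto
  have "((det A \<cdot>\<^sub>m 1\<^sub>m r) *\<^sub>v w) $ i = (\<Sum>k\<in>{0..<r}. (if k = i then det A else 0) * w $ k)"
    using i(1) dims(3) by (auto simp: scalar_prod_def intro!: sum.cong)
  also have "\<dots> = (\<Sum>k\<in>{0..<r}. if k = i then det A * w $ i else 0)"
    by (rule sum.cong) auto
  also have "\<dots> = det A * w $ i" using i by simp
  finally have "((det A \<cdot>\<^sub>m 1\<^sub>m r) *\<^sub>v w) $ i = det A * w $ i" .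
  then have "det A * w $ i = 0" using z i by simp
  then show ?thesis using det i by (simp add: w_def)
qed

text \<open>Finitely many generators involve finitely many basis elements, which then already span;
  a further basis element would depend on them.\<close>

lemma (in H_module) finite_basis:
  assumes "finitely_generated M" "H_basis M B"
  shows "finite B"
proof -
  obtain S where S: "finite S" "S \<subseteq> carrier M" "span S = carrier M"
    using assms unfolding finitely_generated_def by auto
  have B: "B \<subseteq> carrier M" "lin_indpt B" "span B = carrier M" using assms unfolding H_basis_def by auto
  have "\<exists>A. finite A \<and> A \<subseteq> B \<and> s \<in> span A" if "s \<in> S" for s
  proof -
    have "s \<in> span B" using that S B by blast
    then obtain a A where "s = lincomb a A" "finite A" "A \<subseteq> B" "a \<in> A \<rightarrow> carrier H" unfolding span_def by blast
    then show ?thesis unfolding span_def by blast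
  qed
  then obtain A where A: "\<And>s. s \<in> S \<Longrightarrow> finite (A s) \<and> A s \<subseteq> B \<and> s \<in> span (A s)" by metis
  define A' where "A' = (\<Union>s\<in>S. A s)"
  have A': "finite A'" "A' \<subseteq> B" using A S unfolding A'_def by auto
  then have "A' \<subseteq> carrier M" using B by blast
  note A' = A' this
  have "S \<subseteq> span A'"
  proof
    fix s assume s: "s \<in> S"
    then have "A s \<subseteq> A'" unfolding A'_def by blast
    then show "s \<in> span A'" using A[OF s] span_is_monotone by blast
  qed
  then have spanA: "carrier M \<subseteq> span A'"
    using span_least[OF span_is_submodule[OF A'(3)]] S by metis
  have "B \<subseteq> A'"
  proof (rule ccontr)
    assume "\<not> B \<subseteq> A'"
    then obtain b where b: "b \<in> B" "b \<notin> A'" by blast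
    then have bC: "b \<in> carrier M" using B by auto
    then obtain c where c: "lincomb c A' = b" using finite_in_span[OF A'(1,3), of b] spanA by auto
    let ?c = "c(b := - 1)"
    have "lincomb ?c (A' \<union> {b}) = (- 1) \<odot>\<^bsub>M\<^esub> b \<oplus> lincomb ?c A'"
      using A' b bC lincomb_insert[of A' ?c b] by simp
    also have "lincomb ?c A' = lincomb c A'"
      using A' b by (intro lincomb_cong) auto
    also have "(- 1) \<odot>\<^bsub>M\<^esub> b \<oplus> lincomb c A' = \<zero>"
      using bC c smult_uminus[of b 1] by (simp add: M.l_neg)
    finally have "lincomb ?c (A' \<union> {b}) = \<zero>" .
    then have "lin_dep B"
      by (rule lin_dep_crit[where v = b, rotated 5]) (use A' b in auto)
    then show False using B by blast
  qed
  then show ?thesis using A'(1) finite_subset by blast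
qed

section \<open>Products of degree two are not torsion\<close>

lemma test_prod_1_1: "n \<ge> 1 \<Longrightarrow> test_prod n 1 1 = 0"
  by (simp add: test_prod_def coeff_lam_prod_1 coeff_1)

text \<open>Since t_(0)t = t^2 is the only nonzero product of t with itself, locality 1 suffices for
  images that are t or 0. This is the origin of the condition \<open>N \<ge> 1\<close>.\<close>

lemma test_alg_locality:
  "locality_deg test_alg (if P then 1 else 0, 0) (if Q then 1 else 0, 0) \<le> 1"
  unfolding locality_deg_def
proof (rule Least_le, intro allI impI)
  fix n :: nat assume n: "n \<ge> 1"
  show "nprod test_alg n (if P then 1 else 0, 0) (if Q then 1 else 0, 0) = \<zero>\<^bsub>test_alg\<^esub>"
    using n by (simp add: test_prod_1_1)
qed

text \<open>The test algebra is not carried by terms, so the universal property enters in the form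
  \<open>free_comm_conformal_any\<close>.\<close>

lemma test_alg_hom:
  fixes B :: "'g set"
  assumes F: "free_comm_conformal TYPE(('k::field_char_0 poly, 'g) conf_term) B (\<lambda>_ _. N) F i"
    and N: "N \<ge> 1"
  shows "\<exists>\<phi>\<in>conf_hom F (test_alg :: ('k poly, _) conf_alg). \<forall>b\<in>B. \<phi> (i b) = (if b = b0 then 1 else 0, 0)"
proof -
  let ?\<alpha> = "\<lambda>b. (if b = b0 then 1 else 0, 0) :: 'k poly \<times> 'k poly"
  have "locality_bounded test_alg B (\<lambda>_ _. N) ?\<alpha>"
    unfolding locality_bounded_def using test_alg_locality N by (meson order_trans)
  moreover have "?\<alpha> ` B \<subseteq> carrier test_alg" by auto
  ultimately show ?thesis using free_comm_conformal_any[OF F test_alg_comm, of ?\<alpha>] by blast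
qed

locale pbw_envelope = lie_envelope L U \<iota>
  for L :: "('k::field_char_0 poly, 'l) conf_alg" and U :: "('k poly, 'u) conf_alg" and \<iota> +
  fixes B :: "'l set" and N :: nat and F :: "('k poly, 'f) conf_alg" and i \<psi>
  assumes basis: "H_basis L B" and fg: "finitely_generated L" and N: "N \<ge> 1"
    and free: "free_comm_conformal TYPE(('k poly, 'l) conf_term) B (\<lambda>_ _. N) F i"
    and \<psi>_hom: "\<psi> \<in> conf_hom (gr_alg U (\<iota> ` B)) F"
    and \<psi>_bij: "bij_betw \<psi> (carrier (gr_alg U (\<iota> ` B))) (carrier F)"
begin

lemma B: "B \<subseteq> carrier L" "L.span B = carrier L"
  using basis by (auto simp: H_basis_def)

lemma finite_B: "finite B"
  using L.finite_basis fg basis by blast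

sublocale fil: filtered_algebra U "\<iota> ` B"
  by unfold_locales (use B in auto)

lemma \<iota>_Fil: "x \<in> carrier L \<Longrightarrow> \<iota> x \<in> fil.Fil 1"
proof -
  assume "x \<in> carrier L"
  then have "x \<in> L.span B" using B by simp
  then show ?thesis using B(1)
  proof (induction rule: L.span_induct)
    case (base b)
    then show ?case by (intro fil.Fil_monomial conf_monomial.intros) auto
  qed (use fil.Fil in \<open>auto simp: \<iota>.add \<iota>.smult\<close>)
qed

text \<open>Both factors of a product have degree at least 1, so the monomials of degree 1 are the
  generators, and \<iota>(L) is a submodule that contains them.\<close>

lemma Fil_1:
  assumes "x \<in> fil.Fil 1"
  shows "\<exists>y\<in>carrier L. x = \<iota> y"
proof -
  have "LinearCombinations.submodule H (\<iota> ` carrier L) U"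
  proof (rule U.submoduleI')
    show "\<zero>\<^bsub>U\<^esub> \<in> \<iota> ` carrier L" by (rule image_eqI[of _ _ "\<zero>\<^bsub>L\<^esub>"]) auto
    show "x \<oplus>\<^bsub>U\<^esub> y \<in> \<iota> ` carrier L" if "x \<in> \<iota> ` carrier L" "y \<in> \<iota> ` carrier L" for x y
      using that by (auto simp flip: \<iota>.add)
    show "h \<odot>\<^bsub>U\<^esub> x \<in> \<iota> ` carrier L" if "x \<in> \<iota> ` carrier L" for h x
      using that by (auto simp flip: \<iota>.smult)
  qed auto
  moreover have "{x. \<exists>k\<in>{1..1}. conf_monomial U (\<iota> ` B) k x} \<subseteq> \<iota> ` carrier L"
  proof
    fix x assume "x \<in> {x. \<exists>k\<in>{1..1}. conf_monomial U (\<iota> ` B) k x}"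
    then have "conf_monomial U (\<iota> ` B) 1 x" by auto
    then show "x \<in> \<iota> ` carrier L"
    proof (cases rule: conf_monomial.cases)
      case (2 k u l v n)
      then have "1 \<le> k" "1 \<le> l" by (auto dest: conf_monomial_pos)
      then show ?thesis using 2 by simp
    qed (use B in auto)
  qed
  ultimately have "fil.Fil 1 \<subseteq> \<iota> ` carrier L"
    unfolding env_filtration_def by (rule U.span_least)
  then show ?thesis using assms by blast
qed

definition \<phi> :: "'l \<Rightarrow> 'f \<Rightarrow> 'k poly \<times> 'k poly" where
  "\<phi> b = (SOME f. f \<in> conf_hom F test_alg \<and> (\<forall>b'\<in>B. f (i b') = (if b' = b then 1 else 0, 0)))"

lemma \<phi>: "\<phi> b \<in> conf_hom F test_alg" "b' \<in> B \<Longrightarrow> \<phi> b (i b') = (if b' = b then 1 else 0, 0)"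
proof -
  have "\<exists>f. f \<in> conf_hom F test_alg \<and> (\<forall>b'\<in>B. f (i b') = (if b' = b then 1 else 0, 0))"
    using test_alg_hom[OF free N, of b] by (simp only: Bex_def)
  then have "\<phi> b \<in> conf_hom F test_alg \<and> (\<forall>b'\<in>B. \<phi> b (i b') = (if b' = b then 1 else 0, 0))"
    unfolding \<phi>_def by (rule someI_ex)
  then show "\<phi> b \<in> conf_hom F test_alg" "b' \<in> B \<Longrightarrow> \<phi> b (i b') = (if b' = b then 1 else 0, 0)" by auto
qed

definition \<chi> :: "'l \<Rightarrow> (nat \<Rightarrow> 'u set) \<Rightarrow> 'k poly \<times> 'k poly" where
  "\<chi> b f = \<phi> b (\<psi> f)"

lemma \<chi>: "\<chi> b \<in> conf_hom (gr_alg U (\<iota> ` B)) test_alg"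
  unfolding \<chi>_def by (rule conf_hom_comp[OF \<psi>_hom \<phi>(1)])

text \<open>The coefficient of t in the image of the symbol of \<iota>(y). As \<open>\<psi>\<close>
  may mix degrees, it need not be the coordinate of \<open>y\<close> at \<open>b\<close>.\<close>

definition \<pi> :: "'l \<Rightarrow> 'l \<Rightarrow> 'k poly" where
  "\<pi> b y = fst (\<chi> b (fil.symb 1 (\<iota> y)))"

lemma \<pi>_add: "x \<in> carrier L \<Longrightarrow> y \<in> carrier L \<Longrightarrow> \<pi> b (x \<oplus>\<^bsub>L\<^esub> y) = \<pi> b x + \<pi> b y"
  unfolding \<pi>_def
  by (simp only: \<iota>.add fil.symb_add \<iota>_Fil fil.hom_add[OF \<chi>] fil.symb_closed)

lemma \<pi>_smult: "x \<in> carrier L \<Longrightarrow> \<pi> b (h \<odot>\<^bsub>L\<^esub> x) = h * \<pi> b x"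
  unfolding \<pi>_def
  by (simp only: \<iota>.smult fil.symb_smult \<iota>_Fil fil.hom_smult[OF \<chi>] fil.symb_closed fst_conv)

lemma \<pi>_lc: "finite A \<Longrightarrow> A \<subseteq> carrier L \<Longrightarrow> \<pi> b (L.lc A (\<lambda>x. x) v) = (\<Sum>k\<in>A. \<pi> b k * v k)"
proof (induction A rule: finite_induct)
  case empty
  then show ?case using \<pi>_smult[of "\<zero>\<^bsub>L\<^esub>" b 0] by (simp add: L.lc_def)
next
  case (insert a A)
  then have "L.lc (insert a A) (\<lambda>x. x) v = v a \<odot>\<^bsub>L\<^esub> a \<oplus>\<^bsub>L\<^esub> L.lc A (\<lambda>x. x) v"
    by (subst L.lc_remove[of _ a]) auto
  then show ?case using insert by (simp add: \<pi>_add \<pi>_smult L.lc_closed Pi_iff subset_iff mult.commute)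
qed

lemma coordinates_B: "x \<in> carrier L \<Longrightarrow> \<exists>v. x = L.lc B (\<lambda>x. x) v"
  using L.span_eq_lc[OF finite_B, of "\<lambda>x. x" x] B by auto

text \<open>The free generator \<open>i b\<close> is pulled back along \<open>\<psi>\<close>. Its
  preimage may have components in several degrees, but \<open>hom_degree_one\<close> replaces it by
  an element of degree 1, which comes from \<open>L\<close> by \<open>Fil_1\<close>.\<close>

lemma \<pi>_surjective:
  assumes "b \<in> B"
  shows "\<exists>y\<in>carrier L. \<forall>b'\<in>B. \<pi> b' y = (if b' = b then 1 else 0)"
proof -
  have "i b \<in> carrier F" using free assms unfolding free_comm_conformal_def by blast
  then have "i b \<in> \<psi> ` carrier (gr_alg U (\<iota> ` B))"
    using bij_betw_imp_surj_on[OF \<psi>_bij] by simp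
  then obtain f where f: "i b = \<psi> f" "f \<in> carrier (gr_alg U (\<iota> ` B))" by (rule imageE)
  obtain x where x: "x \<in> fil.Fil 1" "\<forall>\<chi>\<in>conf_hom (gr_alg U (\<iota> ` B)) test_alg.
      fst (\<chi> f) = fst (\<chi> (fil.symb 1 x))"
    using fil.hom_degree_one[OF f(2)] by (rule bexE)
  obtain y where y: "y \<in> carrier L" "x = \<iota> y" using Fil_1[OF x(1)] by blast
  have "\<pi> b' y = (if b' = b then 1 else 0)" if "b' \<in> B" for b'
  proof -
    have "\<pi> b' y = fst (\<chi> b' f)" unfolding \<pi>_def using bspec[OF x(2) \<chi>, of b'] y(2) by simp
    also have "\<dots> = fst (\<phi> b' (i b))" unfolding \<chi>_def f(1) ..
    also have "\<dots> = (if b' = b then 1 else 0)" unfolding \<phi>(2)[OF assms] by auto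
    finally show ?thesis .
  qed
  then show ?thesis using y(1) by blast
qed

text \<open>By \<open>\<pi>_surjective\<close> the square matrix of the \<open>\<pi> a k\<close>
  with \<open>a\<close> and \<open>k\<close> in \<open>B\<close> has a right inverse over
  \<open>H\<close>, so it annihilates no nonzero coordinate vector.\<close>

lemma \<pi>_injective:
  assumes "y \<in> carrier L" "\<And>b. b \<in> B \<Longrightarrow> \<pi> b y = 0"
  shows "y = \<zero>\<^bsub>L\<^esub>"
proof -
  have "\<exists>c. \<forall>b'\<in>B. \<pi> b' (L.lc B (\<lambda>x. x) c) = (if b' = b then 1 else 0)" if "b \<in> B" for b
    using \<pi>_surjective[OF that] coordinates_B by metis
  then obtain c where c: "\<And>b b'. b \<in> B \<Longrightarrow> b' \<in> B \<Longrightarrow>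
      \<pi> b' (L.lc B (\<lambda>x. x) (c b)) = (if b' = b then 1 else 0)" by metis
  obtain v where v: "y = L.lc B (\<lambda>x. x) v" using coordinates_B assms by blast
  have "v b = 0" if "b \<in> B" for b
  proof (rule right_invertible_injective[OF finite_B, of \<pi> "\<lambda>k b. c b k" v b])
    show "(\<Sum>k\<in>B. \<pi> a k * c b k) = (if a = b then 1 else 0)" if "a \<in> B" "b \<in> B" for a b
      using c[OF that(2,1)] \<pi>_lc[OF finite_B B(1)] by simp
    show "(\<Sum>k\<in>B. \<pi> a k * v k) = 0" if "a \<in> B" for a
      using assms(2)[OF that] \<pi>_lc[OF finite_B B(1)] v by simp
  qed (rule that)
  then show ?thesis unfolding v using B(1) by (intro L.lc_zero) auto
qed

lemma nprod_nontorsion: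
  assumes "a \<in> carrier L" "a \<noteq> \<zero>\<^bsub>L\<^esub>"
  shows "\<exists>n. \<exists>b\<in>carrier L. \<not> U.torsion (nprod U n (\<iota> a) (\<iota> b))"
proof -
  \<comment> \<open>Up to elements of H t^2, \<open>\<chi> b\<close> sends the symbols of \<iota>(a)
    and \<iota>(y) to p t and t, where p is \<open>\<pi> b a\<close>. Their \<lambda>-product is
    p(-\<lambda>) t^2, and the index \<open>degree (\<pi> b a)\<close> selects its leading
    coefficient. The result is nonzero in the torsion-free module H t^2.\<close>
  obtain b where b: "b \<in> B" "\<pi> b a \<noteq> 0" using \<pi>_injective assms by blast
  obtain y where y: "y \<in> carrier L" "\<pi> b y = 1" using \<pi>_surjective[OF b(1)] b(1) by auto
  define n where "n = degree (\<pi> b a)"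
  let ?z = "nprod U n (\<iota> a) (\<iota> y)"
  have a1: "\<iota> a \<in> fil.Fil 1" and y1: "\<iota> y \<in> fil.Fil 1" using \<iota>_Fil assms y by auto
  have z: "?z \<in> fil.Fil (1 + 1)" by (rule fil.Fil_nprod[OF a1 y1])
  have "\<chi> b (fil.symb (1 + 1) ?z) = (0, test_prod n (\<pi> b a) (\<pi> b y))"
    unfolding fil.symb_nprod[OF a1 y1, symmetric] \<pi>_def
    by (rule fil.hom_nprod[OF \<chi>]) (use a1 y1 fil.symb_closed in auto)
  then have nz: "snd (\<chi> b (fil.symb (1 + 1) ?z)) \<noteq> 0"
    using test_prod_nonzero[OF b(2)] y(2) unfolding n_def by simp
  have "\<not> U.torsion ?z"
  proof
    assume "U.torsion ?z"
    then obtain h where h: "h \<noteq> 0" "h \<odot>\<^bsub>U\<^esub> ?z = \<zero>\<^bsub>U\<^esub>" unfolding U.torsion_def by blast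
    have "h * snd (\<chi> b (fil.symb (1 + 1) ?z)) = snd (\<chi> b (fil.symb (1 + 1) (h \<odot>\<^bsub>U\<^esub> ?z)))"
      unfolding fil.symb_smult[OF z] fil.hom_smult[OF \<chi> fil.symb_closed[OF z]] by simp
    also have "\<dots> = 0" unfolding h(2) fil.hom_symb_zero[OF \<chi>] by simp
    finally show False using h(1) nz by simp
  qed
  then show ?thesis using y(1) by blast
qed

end

theorem proposition2:
  fixes L :: "('k::field_char_0 poly, 'l) conf_alg" and B :: "'l set"
  assumes "lie_conformal_algebra L"
    and "finitely_generated L"
    and "torsion_free L"
    and "H_basis L B"
    and "PBW_property L B"
  shows "\<exists>(M :: ('k poly, nat \<Rightarrow> 'k poly) module) act.
    conformal_representation L M act \<and> finitely_generated M \<and> free_module M \<and>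
    faithful_action L M act"
proof -
  obtain N\<^sub>0 where N\<^sub>0: "\<forall>N\<ge>N\<^sub>0. \<exists>(U :: ('k poly, ('k poly, 'l) conf_term) conf_alg) \<iota>
     (F :: ('k poly, ('k poly, 'l) conf_term) conf_alg) i.
      universal_envelope TYPE(('k poly, 'l) conf_term) L B (\<lambda>_ _. N) U \<iota> \<and>
      free_comm_conformal TYPE(('k poly, 'l) conf_term) B (\<lambda>_ _. N) F i \<and>
      conf_isomorphic (gr_alg U (\<iota> ` B)) F"
    using assms(5) unfolding PBW_property_def by blast
  \<comment> \<open>The maximum with 1 makes the assignment of t and 0 to the elements of
    \<open>B\<close> respect the locality bound.\<close>
  define N where "N = max N\<^sub>0 1"
  obtain U :: "('k poly, ('k poly, 'l) conf_term) conf_alg" and \<iota>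
    and F :: "('k poly, ('k poly, 'l) conf_term) conf_alg" and i where
    U: "universal_envelope TYPE(('k poly, 'l) conf_term) L B (\<lambda>_ _. N) U \<iota>"
    and F: "free_comm_conformal TYPE(('k poly, 'l) conf_term) B (\<lambda>_ _. N) F i"
    and iso: "conf_isomorphic (gr_alg U (\<iota> ` B)) F"
    using N\<^sub>0[rule_format, of N] unfolding N_def by auto
  obtain \<psi> where \<psi>: "\<psi> \<in> conf_hom (gr_alg U (\<iota> ` B)) F"
    "bij_betw \<psi> (carrier (gr_alg U (\<iota> ` B))) (carrier F)"
    using iso unfolding conf_isomorphic_def by blast
  have "assoc_envelope L U \<iota>" using U unfolding universal_envelope_def by (rule conjunct1)
  then have "lie_envelope L U \<iota>"
    using assms(1) unfolding assoc_envelope_def by (intro lie_envelope.intro lie_envelope_axioms.intro) auto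
  then interpret pbw_envelope L U \<iota> B N F i \<psi>
    using assms F \<psi> by (intro pbw_envelope.intro pbw_envelope_axioms.intro) (auto simp: N_def)
  show ?thesis by (rule finite_faithful_representation[OF assms(2) nprod_nontorsion])
qed

end
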